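(* Let $X$ be a non-empty compact metric space, $T:X\to X$ continuous, and let $\mathcal Z=\{Z_0\}\cup\{Z_i:i\ge1\}$ be a countable $\mathcal E_{\rm orb}(X,T)$-maximizable family of non-empty closed invariant subsets of $X$. Suppose that $(Z_i,T)$ has $X$-extendable TPO for every $i\ge1$. Let $$\mathcal P:=\operatorname{int}\{\eta\in\mathcal E_{\rm orb}(X,T):\mathcal M_{\max}(\eta)=\{\mu_Q\}\text{ for some periodic orbit }Q\}.$$ Then $\mathcal P\cup\operatorname{int}(\mathcal E_{Z_0})$ is open and dense in $\mathcal E_{\rm orb}(X,T)$. In particular, if $\operatorname{int}(\mathcal E_{Z_0})=\varnothing$, then $(X,T)$ has global TPO.
   Context: $(X,d)$ compact metric, $T:X\to X$ continuous; a set $Z$ is invariant if $T(Z)\subset Z$. $\mathcal M(X,T)$ is the set of $T$-invariant Borel probability measures (weak$^*$ topology); $\mathcal M(Z,T)$ those supported on the closed invariant set $Z$; $\mu_Q$ is the invariant probability measure on a periodic orbit $Q$. $S_ng=\sum_{j=0}^{n-1}g\circ T^j$. $\mathcal A(X,T)$: sequences $\Psi=\{\psi_n\}_{n\ge1}\subset C(X,\mathbb R)$ such that for every $\xi>0$ there is $g\in C(X,\mathbb R)$ with $\limsup_n\frac1n\|\psi_n-S_ng\|_\infty\le\xi$; norm $\|\Psi\|_{\mathcal A}=\sup_n\frac1n\|\psi_n\|_\infty$. $D(\Psi)=\sup_{n,m\ge1}\|\psi_{n+m}-\psi_n-\psi_m\circ T^n\|_\infty$ and $L_{\rm orb}(\Psi)=\sup_{n\ge1,x\ne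 y}|\psi_n(x)-\psi_n(y)|/\sum_{j=0}^{n-1}d(T^jx,T^jy)$. $\mathcal{AA}_{\rm orb}(X,T)=\{\Psi\in\mathcal A(X,T):D(\Psi),L_{\rm orb}(\Psi)<\infty\}$ with norm $\|\Psi\|_{\mathcal A}+D(\Psi)+L_{\rm orb}(\Psi)$. $\mathcal N=\{\Psi\in\mathcal A(X,T):\lim_n\frac1n\|\psi_n\|_\infty=0\}$. $\mathcal E_{\rm orb}(X,T)=\mathcal{AA}_{\rm orb}(X,T)/(\mathcal{AA}_{\rm orb}(X,T)\cap\mathcal N)$ with the quotient norm (a Banach space). For $\eta=[\Phi]$, $\eta_*(\mu)=\lim_n\frac1n\int\phi_n\,d\mu$ (exists, independent of the representative), $\mathcal M_{\max}(\eta)=\{\mu\in\mathcal M(X,T):\eta_*(\mu)=\max_{\nu\in\mathcal M(X,T)}\eta_*(\nu)\}$. For closed invariant $Z$, $\mathcal E_Z=\{\eta\in\mathcal E_{\rm orb}(X,T):\mathcal M_{\max}(\eta)\cap\mathcal M(Z,T)\ne\varnothing\}$. A family $\mathcal Z$ of closed invariant sets is $\mathcal E_{\rm orb}(X,T)$-maximizable if $\mathcal E_{\rm orb}(X,T)=\bigcup_{Z\in\mathcal Z}\mathcal E_Z$. Global TPO: there is an open dense subset of $\mathcal E_{\rm orb}(X,T)$ each of whose elements $\eta$ satisfies $\mathcal M_{\max}(\eta)=\{\mu_Q\}$ for some periodic orbit $Q$. Extendable space: for non-empty closed invariant $Z$, the restriction $R_Z:\mathcal E_{\rm orb}(X,T)\to\mathcal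 E_{\rm orb}(Z,T)$, $R_Z[\Phi]=[\Phi|_Z]$, is a well-defined bounded linear map. $\mathcal E^X_{\rm orb}(Z,T)=R_Z(\mathcal E_{\rm orb}(X,T))\cong\mathcal E_{\rm orb}(X,T)/\ker R_Z$ with the lifting norm $\|\zeta\|_{Z\leftarrow X}=\inf\{\|\theta\|_{\mathcal E_{\rm orb}(X,T)}:R_Z\theta=\zeta\}$. $(Z,T)$ has $X$-extendable TPO if there is a set, open and dense in $\mathcal E^X_{\rm orb}(Z,T)$ for the lifting norm, such that each $\zeta$ in it has $\{\mu\in\mathcal M(Z,T):\zeta_*(\mu)=\max_{\nu\in\mathcal M(Z,T)}\zeta_*(\nu)\}=\{\mu_Q\}$ for some periodic orbit $Q\subset Z$. *)

theory Defs
  imports "HOL-Probability.Probability"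
begin

text \<open>
  A system is a compact set \<open>X\<close> in a metric space together with a map \<open>T\<close> that is continuous on
  \<open>X\<close> and maps \<open>X\<close> into itself, so that a closed invariant \<open>Z \<subseteq> X\<close> is a system with the same map.
  Functions on \<open>X\<close> are total functions of which only the values on \<open>X\<close> are used, and of a sequence
  \<open>\<Psi>\<close> only the terms \<open>\<Psi> n\<close> with \<open>n \<ge> 1\<close> are used.  Two sequences that agree there differ by an
  element of \<open>null_seqs\<close> and have the same norm, so the quotient \<open>E_orb\<close> is not affected.
  Suprema that may be infinite are taken in \<^typ>\<open>ennreal\<close>.
\<close>

definition closed_invariant :: "'a::metric_space set \<Rightarrow> ('a \<Rightarrow> 'a) \<Rightarrow> 'a set \<Rightarrow> bool" where
  "closed_invariant X T Z \<longleftrightarrow> closed Z \<and> Z \<subseteq> X \<and> T ` Z \<subseteq> Z"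

subsection \<open>Asymptotically additive sequences\<close>

definition birkhoff_sum :: "('a \<Rightarrow> 'a) \<Rightarrow> ('a \<Rightarrow> real) \<Rightarrow> nat \<Rightarrow> 'a \<Rightarrow> real" where
  "birkhoff_sum T g n x = (\<Sum>j<n. g ((T ^^ j) x))"

definition sup_norm :: "'a set \<Rightarrow> ('a \<Rightarrow> real) \<Rightarrow> ennreal" where
  "sup_norm X f = (SUP x\<in>X. ennreal \<bar>f x\<bar>)"

definition asymp_additive ::
  "'a::metric_space set \<Rightarrow> ('a \<Rightarrow> 'a) \<Rightarrow> (nat \<Rightarrow> 'a \<Rightarrow> real) set" where
  "asymp_additive X T = {\<Psi>. (\<forall>n\<ge>1. continuous_on X (\<Psi> n)) \<and>
     (\<forall>\<xi>>0. \<exists>g. continuous_on X g \<and>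
        limsup (\<lambda>n. sup_norm X (\<lambda>x. \<Psi> n x - birkhoff_sum T g n x) / of_nat n) \<le> ennreal \<xi>)}"

definition A_norm :: "'a set \<Rightarrow> (nat \<Rightarrow> 'a \<Rightarrow> real) \<Rightarrow> ennreal" where
  "A_norm X \<Psi> = (SUP n\<in>{1..}. sup_norm X (\<Psi> n) / of_nat n)"

definition defect :: "'a set \<Rightarrow> ('a \<Rightarrow> 'a) \<Rightarrow> (nat \<Rightarrow> 'a \<Rightarrow> real) \<Rightarrow> ennreal" where
  "defect X T \<Psi> =
     (SUP n\<in>{1..}. SUP m\<in>{1..}. sup_norm X (\<lambda>x. \<Psi> (n + m) x - \<Psi> n x - \<Psi> m ((T ^^ n) x)))"

definition lip_orb ::
  "'a::metric_space set \<Rightarrow> ('a \<Rightarrow> 'a) \<Rightarrow> (nat \<Rightarrow> 'a \<Rightarrow> real) \<Rightarrow> ennreal" where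
  "lip_orb X T \<Psi> =
     (SUP n\<in>{1..}. SUP (x, y)\<in>{(x, y). x \<in> X \<and> y \<in> X \<and> x \<noteq> y}.
        ennreal (\<bar>\<Psi> n x - \<Psi> n y\<bar> / (\<Sum>j<n. dist ((T ^^ j) x) ((T ^^ j) y))))"

definition AA_orb ::
  "'a::metric_space set \<Rightarrow> ('a \<Rightarrow> 'a) \<Rightarrow> (nat \<Rightarrow> 'a \<Rightarrow> real) set" where
  "AA_orb X T = {\<Psi> \<in> asymp_additive X T. defect X T \<Psi> < \<infinity> \<and> lip_orb X T \<Psi> < \<infinity>}"

definition AA_norm ::
  "'a::metric_space set \<Rightarrow> ('a \<Rightarrow> 'a) \<Rightarrow> (nat \<Rightarrow> 'a \<Rightarrow> real) \<Rightarrow> ennreal" where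
  "AA_norm X T \<Psi> = A_norm X \<Psi> + defect X T \<Psi> + lip_orb X T \<Psi>"

definition null_seqs ::
  "'a::metric_space set \<Rightarrow> ('a \<Rightarrow> 'a) \<Rightarrow> (nat \<Rightarrow> 'a \<Rightarrow> real) set" where
  "null_seqs X T = {\<Psi> \<in> asymp_additive X T. (\<lambda>n. sup_norm X (\<Psi> n) / of_nat n) \<longlonglongrightarrow> 0}"

subsection \<open>The quotient space\<close>

definition null_rel ::
  "'a::metric_space set \<Rightarrow> ('a \<Rightarrow> 'a) \<Rightarrow> ((nat \<Rightarrow> 'a \<Rightarrow> real) \<times> (nat \<Rightarrow> 'a \<Rightarrow> real)) set" where
  "null_rel X T = {(\<Phi>, \<Psi>). \<Phi> \<in> AA_orb X T \<and> \<Psi> \<in> AA_orb X T \<and>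
     (\<lambda>n x. \<Phi> n x - \<Psi> n x) \<in> AA_orb X T \<inter> null_seqs X T}"

definition E_orb ::
  "'a::metric_space set \<Rightarrow> ('a \<Rightarrow> 'a) \<Rightarrow> (nat \<Rightarrow> 'a \<Rightarrow> real) set set" where
  "E_orb X T = AA_orb X T // null_rel X T"

definition E_norm ::
  "'a::metric_space set \<Rightarrow> ('a \<Rightarrow> 'a) \<Rightarrow> (nat \<Rightarrow> 'a \<Rightarrow> real) set \<Rightarrow> ennreal" where
  "E_norm X T \<eta> = (INF \<Phi>\<in>\<eta>. AA_norm X T \<Phi>)"

text \<open>For cosets \<open>\<eta>\<close>, \<open>\<theta>\<close> of the same subspace this set is again a coset, the difference
  \<open>\<eta> - \<theta>\<close> in the quotient vector space.\<close>

definition coset_diff ::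
  "(nat \<Rightarrow> 'a \<Rightarrow> real) set \<Rightarrow> (nat \<Rightarrow> 'a \<Rightarrow> real) set \<Rightarrow> (nat \<Rightarrow> 'a \<Rightarrow> real) set" where
  "coset_diff \<eta> \<theta> = {\<lambda>n x. \<Phi> n x - \<Psi> n x | \<Phi> \<Psi>. \<Phi> \<in> \<eta> \<and> \<Psi> \<in> \<theta>}"

definition E_dist ::
  "'a::metric_space set \<Rightarrow> ('a \<Rightarrow> 'a) \<Rightarrow> (nat \<Rightarrow> 'a \<Rightarrow> real) set \<Rightarrow> (nat \<Rightarrow> 'a \<Rightarrow> real) set \<Rightarrow> real"
  where "E_dist X T \<eta> \<theta> = enn2real (E_norm X T (coset_diff \<eta> \<theta>))"

definition E_topology ::
  "'a::metric_space set \<Rightarrow> ('a \<Rightarrow> 'a) \<Rightarrow> (nat \<Rightarrow> 'a \<Rightarrow> real) set topology" where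
  "E_topology X T = Metric_space.mtopology (E_orb X T) (E_dist X T)"

subsection \<open>Invariant measures and maximization\<close>

text \<open>Borel probability measures on \<open>X\<close> are represented by the Borel probability measures on the
  ambient space that give mass 1 to \<open>X\<close>.  For a closed invariant \<open>Z \<subseteq> X\<close> the elements of
  \<open>invariant_measures Z T\<close> are then exactly the elements of \<open>invariant_measures X T\<close> supported on
  \<open>Z\<close>.\<close>

definition invariant_measures :: "'a::metric_space set \<Rightarrow> ('a \<Rightarrow> 'a) \<Rightarrow> 'a measure set" where
  "invariant_measures X T = {\<mu>. prob_space \<mu> \<and> sets \<mu> = sets borel \<and> emeasure \<mu> X = 1 \<and>
     (\<forall>A\<in>sets borel. emeasure \<mu> (T -` A \<inter> X) = emeasure \<mu> A)}"

definition periodic_orbit :: "'a set \<Rightarrow> ('a \<Rightarrow> 'a) \<Rightarrow> 'a set \<Rightarrow> bool" where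
  "periodic_orbit X T Q \<longleftrightarrow>
     (\<exists>x\<in>X. \<exists>p\<ge>1. (T ^^ p) x = x \<and> Q = (\<lambda>j. (T ^^ j) x) ` {..<p})"

definition orbit_measure :: "'a::metric_space set \<Rightarrow> 'a measure" where
  "orbit_measure Q = distr (uniform_count_measure Q) borel (\<lambda>x. x)"

text \<open>The limit exists and is the same for all representatives; the integral is over \<open>X\<close> because
  representatives need not be measurable outside \<open>X\<close>.\<close>

definition E_star ::
  "'a::metric_space set \<Rightarrow> (nat \<Rightarrow> 'a \<Rightarrow> real) set \<Rightarrow> 'a measure \<Rightarrow> real" where
  "E_star X \<eta> \<mu> = (THE r. \<forall>\<Phi>\<in>\<eta>. (\<lambda>n. (LINT x:X|\<mu>. \<Phi> n x) / real n) \<longlonglongrightarrow> r)"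

definition max_measures ::
  "'a::metric_space set \<Rightarrow> ('a \<Rightarrow> 'a) \<Rightarrow> (nat \<Rightarrow> 'a \<Rightarrow> real) set \<Rightarrow> 'a measure set" where
  "max_measures X T \<eta> = {\<mu> \<in> invariant_measures X T.
     \<forall>\<nu>\<in>invariant_measures X T. E_star X \<eta> \<nu> \<le> E_star X \<eta> \<mu>}"

definition periodically_maximized ::
  "'a::metric_space set \<Rightarrow> ('a \<Rightarrow> 'a) \<Rightarrow> (nat \<Rightarrow> 'a \<Rightarrow> real) set \<Rightarrow> bool" where
  "periodically_maximized X T \<eta> \<longleftrightarrow>
     (\<exists>Q. periodic_orbit X T Q \<and> max_measures X T \<eta> = {orbit_measure Q})"

definition E_maximized_on ::
  "'a::metric_space set \<Rightarrow> ('a \<Rightarrow> 'a) \<Rightarrow> 'a set \<Rightarrow> (nat \<Rightarrow> 'a \<Rightarrow> real) set set" where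
  "E_maximized_on X T Z =
     {\<eta> \<in> E_orb X T. max_measures X T \<eta> \<inter> invariant_measures Z T \<noteq> {}}"

definition maximizable :: "'a::metric_space set \<Rightarrow> ('a \<Rightarrow> 'a) \<Rightarrow> 'a set set \<Rightarrow> bool" where
  "maximizable X T F \<longleftrightarrow>
     (\<forall>Z\<in>F. closed_invariant X T Z) \<and> E_orb X T = (\<Union>Z\<in>F. E_maximized_on X T Z)"

definition open_dense :: "'b topology \<Rightarrow> 'b set \<Rightarrow> bool" where
  "open_dense \<tau> U \<longleftrightarrow> openin \<tau> U \<and> \<tau> closure_of U = topspace \<tau>"

definition global_TPO :: "'a::metric_space set \<Rightarrow> ('a \<Rightarrow> 'a) \<Rightarrow> bool" where
  "global_TPO X T \<longleftrightarrow>
     (\<exists>U. open_dense (E_topology X T) U \<and> (\<forall>\<eta>\<in>U. periodically_maximized X T \<eta>))"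

subsection \<open>The extendable space\<close>

text \<open>Sequences on \<open>X\<close> are also sequences on \<open>Z \<subseteq> X\<close>, so \<open>E_restrict Z T \<eta>\<close> is the class
  \<open>[\<Phi>|\<^sub>Z]\<close> for any \<open>\<Phi> \<in> \<eta>\<close>.\<close>

definition E_restrict ::
  "'a::metric_space set \<Rightarrow> ('a \<Rightarrow> 'a) \<Rightarrow> (nat \<Rightarrow> 'a \<Rightarrow> real) set \<Rightarrow> (nat \<Rightarrow> 'a \<Rightarrow> real) set" where
  "E_restrict Z T \<eta> = null_rel Z T `` \<eta>"

definition E_ext ::
  "'a::metric_space set \<Rightarrow> ('a \<Rightarrow> 'a) \<Rightarrow> 'a set \<Rightarrow> (nat \<Rightarrow> 'a \<Rightarrow> real) set set" where
  "E_ext X T Z = E_restrict Z T ` E_orb X T"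

definition lift_norm ::
  "'a::metric_space set \<Rightarrow> ('a \<Rightarrow> 'a) \<Rightarrow> 'a set \<Rightarrow> (nat \<Rightarrow> 'a \<Rightarrow> real) set \<Rightarrow> ennreal" where
  "lift_norm X T Z \<zeta> = (INF \<theta>\<in>{\<theta> \<in> E_orb X T. E_restrict Z T \<theta> = \<zeta>}. E_norm X T \<theta>)"

definition lift_dist ::
  "'a::metric_space set \<Rightarrow> ('a \<Rightarrow> 'a) \<Rightarrow> 'a set \<Rightarrow>
   (nat \<Rightarrow> 'a \<Rightarrow> real) set \<Rightarrow> (nat \<Rightarrow> 'a \<Rightarrow> real) set \<Rightarrow> real" where
  "lift_dist X T Z \<zeta> \<zeta>' = enn2real (lift_norm X T Z (coset_diff \<zeta> \<zeta>'))"

definition lift_topology ::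
  "'a::metric_space set \<Rightarrow> ('a \<Rightarrow> 'a) \<Rightarrow> 'a set \<Rightarrow> (nat \<Rightarrow> 'a \<Rightarrow> real) set topology" where
  "lift_topology X T Z = Metric_space.mtopology (E_ext X T Z) (lift_dist X T Z)"

definition extendable_TPO :: "'a::metric_space set \<Rightarrow> ('a \<Rightarrow> 'a) \<Rightarrow> 'a set \<Rightarrow> bool" where
  "extendable_TPO X T Z \<longleftrightarrow>
     (\<exists>U. open_dense (lift_topology X T Z) U \<and> (\<forall>\<zeta>\<in>U. periodically_maximized Z T \<zeta>))"

end

theory Submission
  imports Defs "HOL-Library.Function_Algebras"
begin

text \<open>
  The space of almost additive sequences is complete, so the Baire category theorem applied to the
  closed sets \<open>E_maximized_on X T (Z i)\<close> shows that the union of their interiors is dense.  They are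
  closed without any appeal to weak-star compactness: if \<open>\<eta>\<close> is a limit of classes maximized on
  \<open>Z\<close>, then a maximizing measure of \<open>\<eta> - [S\<^sub>n d(\<cdot>, Z)]\<close>, which exists because the family is
  maximizable, lies on \<open>Z\<close> and maximizes \<open>\<eta>\<close>.  Inside the interior for some \<open>i \<ge> 1\<close>, extendable
  TPO provides, arbitrarily near any class, a class \<open>\<eta>\<close> maximized by the measure on a periodic orbit
  \<open>Q\<close>, and \<open>\<eta> - \<epsilon> [S\<^sub>n d(\<cdot>, Q)]\<close> is then uniquely maximized by it in a whole neighbourhood.
\<close>

subsection \<open>Bounds for almost additive sequences\<close>

text \<open>The obstacle is that all objects are cosets. A class near a given one is therefore
  always replaced by a representative near a given sequence, and completeness and genericity are
  handled on normalized sequences rather than on the quotient. The extendable space is treated as a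
  second quotient of the same sequences on X, so closeness in the lifting norm yields an actual
  perturbation on X.

  The closedness argument works because measures on Z pay no penalty: as they come within 2e of the
  maximum for \<eta>, the maximizer of the penalized class can afford a penalty of at most 2e, for
  every e > 0.

  The penalty at Q survives perturbation because of a locking inequality: for almost additive
  \<Theta>, moving from the orbit measure to \<nu> gains at most C times the norm of \<Theta> times
  the integral of d(., Q) against \<nu>, with C depending on Q but not on \<Theta> or \<nu>. Gain
  and penalty are multiples of the same integral, so it suffices that C times the norm stays below
  \<epsilon>.\<close>

lemma sup_norm_le_iff: "0 \<le> a \<Longrightarrow> sup_norm X f \<le> ennreal a \<longleftrightarrow> (\<forall>x\<in>X. \<bar>f x\<bar> \<le> a)"
  by (simp add: sup_norm_def SUP_le_iff ennreal_le_iff)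

lemma sup_norm_div_le_iff:
  assumes "0 \<le> a" "n \<ge> (1::nat)"
  shows "sup_norm X f / of_nat n \<le> ennreal a \<longleftrightarrow> (\<forall>x\<in>X. \<bar>f x\<bar> \<le> real n * a)"
proof -
  have "sup_norm X f / of_nat n \<le> ennreal a \<longleftrightarrow> sup_norm X f \<le> ennreal (real n * a)"
  proof
    assume "sup_norm X f / of_nat n \<le> ennreal a"
    then have "of_nat n * (sup_norm X f / of_nat n) \<le> of_nat n * ennreal a"
      by (rule mult_left_mono) simp
    moreover have "of_nat n * (sup_norm X f / of_nat n) = sup_norm X f"
      using assms mult_divide_eq_ennreal[of "of_nat n" "sup_norm X f"]
      by (simp add: ennreal_times_divide mult.commute)
    ultimately show "sup_norm X f \<le> ennreal (real n * a)"
      by (simp add: ennreal_mult' ennreal_of_nat_eq_real_of_nat)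
  next
    assume "sup_norm X f \<le> ennreal (real n * a)"
    then show "sup_norm X f / of_nat n \<le> ennreal a"
      using assms
      by (intro divide_le_posI_ennreal) (auto simp: ennreal_mult' ennreal_of_nat_eq_real_of_nat mult.commute)
  qed
  then show ?thesis
    using assms by (simp add: sup_norm_le_iff)
qed

text \<open>Real witnesses for the three extended-real terms of the norm. In this form the bounds
  pass to differences by the triangle inequality and to pointwise limits. The pairs x = y may be
  included because both sides vanish there.\<close>

definition AA_bound ::
  "'a::metric_space set \<Rightarrow> ('a \<Rightarrow> 'a) \<Rightarrow> (nat \<Rightarrow> 'a \<Rightarrow> real) \<Rightarrow> real \<Rightarrow> real \<Rightarrow> real \<Rightarrow> bool" where
  "AA_bound X T \<Psi> a b c \<longleftrightarrow> 0 \<le> a \<and> 0 \<le> b \<and> 0 \<le> c \<and>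
     (\<forall>n\<ge>1. \<forall>x\<in>X. \<bar>\<Psi> n x\<bar> \<le> real n * a) \<and>
     (\<forall>n\<ge>1. \<forall>m\<ge>1. \<forall>x\<in>X. \<bar>\<Psi> (n + m) x - \<Psi> n x - \<Psi> m ((T ^^ n) x)\<bar> \<le> b) \<and>
     (\<forall>n\<ge>1. \<forall>x\<in>X. \<forall>y\<in>X. \<bar>\<Psi> n x - \<Psi> n y\<bar> \<le> c * (\<Sum>j<n. dist ((T ^^ j) x) ((T ^^ j) y)))"

lemma A_norm_le_iff:
  "0 \<le> a \<Longrightarrow> A_norm X \<Psi> \<le> ennreal a \<longleftrightarrow> (\<forall>n\<ge>1. \<forall>x\<in>X. \<bar>\<Psi> n x\<bar> \<le> real n * a)"
  by (auto simp: A_norm_def SUP_le_iff sup_norm_div_le_iff)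

lemma defect_le_iff:
  "0 \<le> b \<Longrightarrow> defect X T \<Psi> \<le> ennreal b \<longleftrightarrow>
     (\<forall>n\<ge>1. \<forall>m\<ge>1. \<forall>x\<in>X. \<bar>\<Psi> (n + m) x - \<Psi> n x - \<Psi> m ((T ^^ n) x)\<bar> \<le> b)"
  by (auto simp: defect_def SUP_le_iff sup_norm_le_iff)

lemma lip_orb_le_iff:
  assumes "0 \<le> c"
  shows "lip_orb X T \<Psi> \<le> ennreal c \<longleftrightarrow>
     (\<forall>n\<ge>1. \<forall>x\<in>X. \<forall>y\<in>X. \<bar>\<Psi> n x - \<Psi> n y\<bar> \<le> c * (\<Sum>j<n. dist ((T ^^ j) x) ((T ^^ j) y)))"
proof -
  have "ennreal (\<bar>\<Psi> n x - \<Psi> n y\<bar> / (\<Sum>j<n. dist ((T ^^ j) x) ((T ^^ j) y))) \<le> ennreal c \<longleftrightarrow>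
      \<bar>\<Psi> n x - \<Psi> n y\<bar> \<le> c * (\<Sum>j<n. dist ((T ^^ j) x) ((T ^^ j) y))"
    if "n \<ge> 1" "x \<noteq> y" for n x y
  proof -
    \<comment> \<open>The term j = 0 alone makes the denominator positive.\<close>
    have "dist ((T ^^ 0) x) ((T ^^ 0) y) \<le> (\<Sum>j<n. dist ((T ^^ j) x) ((T ^^ j) y))"
      using that by (intro member_le_sum) auto
    then have "0 < (\<Sum>j<n. dist ((T ^^ j) x) ((T ^^ j) y))"
      using that by (smt (verit) funpow_0 zero_less_dist_iff)
    then show ?thesis
      using assms by (simp add: ennreal_le_iff pos_divide_le_eq)
  qed
  then have "lip_orb X T \<Psi> \<le> ennreal c \<longleftrightarrow> (\<forall>n\<ge>1. \<forall>x\<in>X. \<forall>y\<in>X. x \<noteq> y \<longrightarrow>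
      \<bar>\<Psi> n x - \<Psi> n y\<bar> \<le> c * (\<Sum>j<n. dist ((T ^^ j) x) ((T ^^ j) y)))"
    by (auto simp: lip_orb_def SUP_le_iff)
  also have "\<dots> \<longleftrightarrow> (\<forall>n\<ge>1. \<forall>x\<in>X. \<forall>y\<in>X.
      \<bar>\<Psi> n x - \<Psi> n y\<bar> \<le> c * (\<Sum>j<n. dist ((T ^^ j) x) ((T ^^ j) y)))"
  proof safe
    fix n x y
    assume "\<forall>n\<ge>1. \<forall>x\<in>X. \<forall>y\<in>X. x \<noteq> y \<longrightarrow>
        \<bar>\<Psi> n x - \<Psi> n y\<bar> \<le> c * (\<Sum>j<n. dist ((T ^^ j) x) ((T ^^ j) y))"
      and "n \<ge> (1::nat)" "x \<in> X" "y \<in> X"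
    then show "\<bar>\<Psi> n x - \<Psi> n y\<bar> \<le> c * (\<Sum>j<n. dist ((T ^^ j) x) ((T ^^ j) y))"
      by (cases "x = y") simp_all
  qed blast
  finally show ?thesis .
qed

lemma AA_bound_iff:
  "AA_bound X T \<Psi> a b c \<longleftrightarrow> 0 \<le> a \<and> 0 \<le> b \<and> 0 \<le> c \<and>
     A_norm X \<Psi> \<le> ennreal a \<and> defect X T \<Psi> \<le> ennreal b \<and> lip_orb X T \<Psi> \<le> ennreal c"
  by (simp add: AA_bound_def A_norm_le_iff defect_le_iff lip_orb_le_iff cong: conj_cong)

lemma AA_bound_mono:
  assumes "AA_bound X T \<Psi> a b c" "a \<le> a'" "b \<le> b'" "c \<le> c'"
  shows "AA_bound X T \<Psi> a' b' c'"
proof -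
  have "ennreal a \<le> ennreal a'" "ennreal b \<le> ennreal b'" "ennreal c \<le> ennreal c'"
    using assms by (auto intro: ennreal_leI)
  then show ?thesis
    using assms unfolding AA_bound_iff by (auto intro: order_trans)
qed

lemma AA_bound_norm: "AA_bound X T \<Psi> a b c \<Longrightarrow> AA_norm X T \<Psi> \<le> ennreal (a + b + c)"
  by (auto simp: AA_bound_iff AA_norm_def intro!: add_mono)

text \<open>\<open>enn2real\<close> sends an infinite norm to 0, so the value is meaningful only for
  finite norm; \<open>AA_finite\<close> supplies this on \<open>AA_orb\<close>.\<close>

definition AA_nm :: "'a::metric_space set \<Rightarrow> ('a \<Rightarrow> 'a) \<Rightarrow> (nat \<Rightarrow> 'a \<Rightarrow> real) \<Rightarrow> real" where
  "AA_nm X T \<Psi> = enn2real (AA_norm X T \<Psi>)"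

lemma AA_nm_nonneg: "0 \<le> AA_nm X T \<Psi>"
  by (simp add: AA_nm_def)

lemma AA_bound_nm_le: "AA_bound X T \<Psi> a b c \<Longrightarrow> AA_nm X T \<Psi> \<le> a + b + c"
  unfolding AA_nm_def
  by (metis AA_bound_iff AA_bound_norm add_nonneg_nonneg enn2real_leI)

text \<open>Since the constants add up exactly to the norm, the triangle inequality
  \<open>AA_nm_diff\<close> can be read off from \<open>AA_bound_diff\<close>.\<close>

lemma AA_bound_exact:
  assumes "AA_norm X T \<Psi> < \<infinity>"
  obtains a b c where "AA_bound X T \<Psi> a b c" "AA_nm X T \<Psi> = a + b + c"
proof
  have fin: "A_norm X \<Psi> < \<infinity>" "defect X T \<Psi> < \<infinity>" "lip_orb X T \<Psi> < \<infinity>"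
    using assms by (auto simp: AA_norm_def)
  show "AA_bound X T \<Psi> (enn2real (A_norm X \<Psi>)) (enn2real (defect X T \<Psi>)) (enn2real (lip_orb X T \<Psi>))"
    using fin by (simp add: AA_bound_iff)
  show "AA_nm X T \<Psi> = enn2real (A_norm X \<Psi>) + enn2real (defect X T \<Psi>) + enn2real (lip_orb X T \<Psi>)"
    using fin by (simp add: AA_nm_def AA_norm_def enn2real_plus)
qed

lemma AA_boundD:
  assumes "AA_bound X T \<Psi> a b c"
  shows "0 \<le> a" "0 \<le> b" "0 \<le> c"
    and "\<And>n x. n \<ge> 1 \<Longrightarrow> x \<in> X \<Longrightarrow> \<bar>\<Psi> n x\<bar> \<le> real n * a"
    and "\<And>n m x. n \<ge> 1 \<Longrightarrow> m \<ge> 1 \<Longrightarrow> x \<in> X \<Longrightarrow>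
      \<bar>\<Psi> (n + m) x - \<Psi> n x - \<Psi> m ((T ^^ n) x)\<bar> \<le> b"
    and "\<And>n x y. n \<ge> 1 \<Longrightarrow> x \<in> X \<Longrightarrow> y \<in> X \<Longrightarrow>
      \<bar>\<Psi> n x - \<Psi> n y\<bar> \<le> c * (\<Sum>j<n. dist ((T ^^ j) x) ((T ^^ j) y))"
  using assms unfolding AA_bound_def by simp_all

lemma AA_bound_diff:
  assumes "AA_bound X T \<Phi> a b c" "AA_bound X T \<Psi> a' b' c'"
  shows "AA_bound X T (\<Phi> - \<Psi>) (a + a') (b + b') (c + c')"
proof -
  have "\<bar>\<Phi> n x - \<Psi> n x\<bar> \<le> real n * (a + a')" if "n \<ge> 1" "x \<in> X" for n x
  proof -
    have "\<bar>\<Phi> n x\<bar> \<le> real n * a" "\<bar>\<Psi> n x\<bar> \<le> real n * a'"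
      using AA_boundD(4)[OF assms(1) that] AA_boundD(4)[OF assms(2) that] by simp_all
    then show ?thesis by (simp add: algebra_simps)
  qed
  moreover have "\<bar>\<Phi> (n + m) x - \<Psi> (n + m) x - (\<Phi> n x - \<Psi> n x) -
      (\<Phi> m ((T ^^ n) x) - \<Psi> m ((T ^^ n) x))\<bar> \<le> b + b'" if "n \<ge> 1" "m \<ge> 1" "x \<in> X" for n m x
  proof -
    have "\<bar>\<Phi> (n + m) x - \<Phi> n x - \<Phi> m ((T ^^ n) x)\<bar> \<le> b"
         "\<bar>\<Psi> (n + m) x - \<Psi> n x - \<Psi> m ((T ^^ n) x)\<bar> \<le> b'"
      using AA_boundD(5)[OF assms(1) that] AA_boundD(5)[OF assms(2) that] by simp_all
    then show ?thesis by (simp add: algebra_simps)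
  qed
  moreover have "\<bar>\<Phi> n x - \<Psi> n x - (\<Phi> n y - \<Psi> n y)\<bar> \<le> (c + c') * (\<Sum>j<n. dist ((T ^^ j) x) ((T ^^ j) y))"
    if "n \<ge> 1" "x \<in> X" "y \<in> X" for n x y
  proof -
    have "\<bar>\<Phi> n x - \<Phi> n y\<bar> \<le> c * (\<Sum>j<n. dist ((T ^^ j) x) ((T ^^ j) y))"
         "\<bar>\<Psi> n x - \<Psi> n y\<bar> \<le> c' * (\<Sum>j<n. dist ((T ^^ j) x) ((T ^^ j) y))"
      using AA_boundD(6)[OF assms(1) that] AA_boundD(6)[OF assms(2) that] by simp_all
    then show ?thesis by (simp add: distrib_right)
  qed
  moreover have "0 \<le> a + a'" "0 \<le> b + b'" "0 \<le> c + c'"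
    using AA_boundD(1-3)[OF assms(1)] AA_boundD(1-3)[OF assms(2)] by linarith+
  ultimately show ?thesis
    by (simp add: AA_bound_def)
qed

lemma AA_bound_zero: "AA_bound X T 0 0 0 0"
  by (simp add: AA_bound_def)

lemma AA_bound_subset: "AA_bound X T \<Phi> a b c \<Longrightarrow> Z \<subseteq> X \<Longrightarrow> AA_bound Z T \<Phi> a b c"
  unfolding AA_bound_def by blast

section \<open>Asymptotic additivity and null sequences as eventual uniform bounds\<close>

lemma birkhoff_sum_diff:
  "birkhoff_sum T (\<lambda>x. g x - h x) n x = birkhoff_sum T g n x - birkhoff_sum T h n x"
  by (simp add: birkhoff_sum_def sum_subtractf)

lemma asymp_additive_iff:
  "\<Psi> \<in> asymp_additive X T \<longleftrightarrow> (\<forall>n\<ge>1. continuous_on X (\<Psi> n)) \<and>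
     (\<forall>\<xi>>0. \<exists>g. continuous_on X g \<and>
       (\<forall>\<^sub>F n in sequentially. \<forall>x\<in>X. \<bar>\<Psi> n x - birkhoff_sum T g n x\<bar> \<le> real n * \<xi>))"
  (is "_ \<longleftrightarrow> ?cont \<and> ?R")
proof -
  let ?s = "\<lambda>g n. sup_norm X (\<lambda>x. \<Psi> n x - birkhoff_sum T g n x) / of_nat n"
  have ev: "(\<forall>\<^sub>F n in sequentially. ?s g n \<le> ennreal \<xi>) \<longleftrightarrow>
      (\<forall>\<^sub>F n in sequentially. \<forall>x\<in>X. \<bar>\<Psi> n x - birkhoff_sum T g n x\<bar> \<le> real n * \<xi>)"
    if "\<xi> > 0" for \<xi> g
    using that
    by (intro eventually_cong[OF eventually_ge_at_top[of 1]] sup_norm_div_le_iff) auto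
  have "(\<forall>\<xi>>0. \<exists>g. continuous_on X g \<and> limsup (?s g) \<le> ennreal \<xi>) \<longleftrightarrow> ?R"
  proof safe
    fix \<xi> :: real assume "\<xi> > 0" "\<forall>\<xi>>0. \<exists>g. continuous_on X g \<and> limsup (?s g) \<le> ennreal \<xi>"
    then obtain g where g: "continuous_on X g" "limsup (?s g) \<le> ennreal (\<xi>/2)"
      by (meson half_gt_zero)
    \<comment> \<open>A bound on the limsup gives an eventual bound only with strict room, hence the
      approximation to within \<xi>/2.\<close>
    have "ennreal (\<xi>/2) < ennreal \<xi>"
      using \<open>\<xi> > 0\<close> by (simp add: ennreal_less_iff)
    then have "limsup (?s g) < ennreal \<xi>"
      using g(2) by order
    then have "\<forall>\<^sub>F n in sequentially. ?s g n \<le> ennreal \<xi>"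
      by (rule eventually_mono[OF Limsup_lessD]) simp
    then show "\<exists>g. continuous_on X g \<and>
        (\<forall>\<^sub>F n in sequentially. \<forall>x\<in>X. \<bar>\<Psi> n x - birkhoff_sum T g n x\<bar> \<le> real n * \<xi>)"
      unfolding ev[OF \<open>\<xi> > 0\<close>, symmetric] using g(1) by (intro exI[of _ g] conjI)
  next
    fix \<xi> :: real assume "\<xi> > 0" ?R
    then obtain g where g: "continuous_on X g"
      "\<forall>\<^sub>F n in sequentially. \<forall>x\<in>X. \<bar>\<Psi> n x - birkhoff_sum T g n x\<bar> \<le> real n * \<xi>"
      by meson
    then show "\<exists>g. continuous_on X g \<and> limsup (?s g) \<le> ennreal \<xi>"
      using Limsup_bounded[OF g(2)[folded ev[OF \<open>\<xi> > 0\<close>]]] by (intro exI[of _ g] conjI)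
  qed
  then show ?thesis
    by (simp add: asymp_additive_def)
qed

lemma null_seqs_iff:
  "\<Psi> \<in> null_seqs X T \<longleftrightarrow> \<Psi> \<in> asymp_additive X T \<and>
     (\<forall>\<xi>>0. \<forall>\<^sub>F n in sequentially. \<forall>x\<in>X. \<bar>\<Psi> n x\<bar> \<le> real n * \<xi>)"
proof -
  let ?s = "\<lambda>n. sup_norm X (\<Psi> n) / of_nat n"
  have ev: "(\<forall>\<^sub>F n in sequentially. ?s n \<le> ennreal \<xi>) \<longleftrightarrow>
      (\<forall>\<^sub>F n in sequentially. \<forall>x\<in>X. \<bar>\<Psi> n x\<bar> \<le> real n * \<xi>)"
    if "\<xi> > 0" for \<xi>
    using that by (intro eventually_cong[OF eventually_ge_at_top[of 1]] sup_norm_div_le_iff) auto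
  have "?s \<longlonglongrightarrow> 0 \<longleftrightarrow> (\<forall>\<xi>>0. \<forall>\<^sub>F n in sequentially. ?s n \<le> ennreal \<xi>)"
  proof safe
    fix \<xi> :: real assume "\<xi> > 0" "?s \<longlonglongrightarrow> 0"
    then have "\<forall>\<^sub>F n in sequentially. ?s n < ennreal \<xi>"
      by (intro order_tendstoD(2)) auto
    then show "\<forall>\<^sub>F n in sequentially. ?s n \<le> ennreal \<xi>"
      by (rule eventually_mono) simp
  next
    assume *: "\<forall>\<xi>>0. \<forall>\<^sub>F n in sequentially. ?s n \<le> ennreal \<xi>"
    show "?s \<longlonglongrightarrow> 0"
    proof (rule order_tendstoI)
      fix a :: ennreal assume "0 < a"
      \<comment> \<open>The threshold a may be infinite; a finite b strictly below it makes the
        real-valued hypothesis applicable.\<close>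
      then obtain b where b: "0 < b" "b < a"
        using dense by blast
      then have "b \<noteq> \<infinity>" by auto
      then obtain r where r: "b = ennreal r" "0 \<le> r"
        by (cases b) auto
      then have "r > 0" using b by auto
      then show "\<forall>\<^sub>F n in sequentially. ?s n < a"
        using * b r by (auto elim!: eventually_mono dest!: spec[of _ r])
    qed simp
  qed
  also have "\<dots> \<longleftrightarrow> (\<forall>\<xi>>0. \<forall>\<^sub>F n in sequentially. \<forall>x\<in>X. \<bar>\<Psi> n x\<bar> \<le> real n * \<xi>)"
    using ev by blast
  finally show ?thesis by (simp add: null_seqs_def)
qed

lemma asymp_additive_diff:
  assumes "\<Phi> \<in> asymp_additive X T" "\<Psi> \<in> asymp_additive X T"
  shows "\<Phi> - \<Psi> \<in> asymp_additive X T"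
  unfolding asymp_additive_iff
proof (intro conjI allI impI)
  fix n :: nat assume "n \<ge> 1"
  then show "continuous_on X ((\<Phi> - \<Psi>) n)"
    using assms unfolding asymp_additive_iff fun_diff_def by (intro continuous_on_diff) auto
next
  fix \<xi> :: real assume "\<xi> > 0"
  then obtain g h where gh: "continuous_on X g" "continuous_on X h"
    "\<forall>\<^sub>F n in sequentially. \<forall>x\<in>X. \<bar>\<Phi> n x - birkhoff_sum T g n x\<bar> \<le> real n * (\<xi>/2)"
    "\<forall>\<^sub>F n in sequentially. \<forall>x\<in>X. \<bar>\<Psi> n x - birkhoff_sum T h n x\<bar> \<le> real n * (\<xi>/2)"
    using assms unfolding asymp_additive_iff by (meson half_gt_zero)
  show "\<exists>g. continuous_on X g \<and> (\<forall>\<^sub>F n in sequentially. \<forall>x\<in>X.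
      \<bar>(\<Phi> - \<Psi>) n x - birkhoff_sum T g n x\<bar> \<le> real n * \<xi>)"
  proof (intro exI conjI)
    show "continuous_on X (\<lambda>x. g x - h x)"
      using gh by (intro continuous_on_diff)
    show "\<forall>\<^sub>F n in sequentially. \<forall>x\<in>X.
        \<bar>(\<Phi> - \<Psi>) n x - birkhoff_sum T (\<lambda>x. g x - h x) n x\<bar> \<le> real n * \<xi>"
      using gh(3,4)
    proof eventually_elim
      case (elim n)
      show ?case
      proof
        fix x assume "x \<in> X"
        then have "\<bar>\<Phi> n x - birkhoff_sum T g n x\<bar> \<le> real n * (\<xi>/2)"
            "\<bar>\<Psi> n x - birkhoff_sum T h n x\<bar> \<le> real n * (\<xi>/2)"
          using elim by blast+
        then show "\<bar>(\<Phi> - \<Psi>) n x - birkhoff_sum T (\<lambda>x. g x - h x) n x\<bar> \<le> real n * \<xi>"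
          unfolding birkhoff_sum_diff fun_diff_def by argo
      qed
    qed
  qed
qed

lemma asymp_additive_zero: "0 \<in> asymp_additive X T"
  unfolding asymp_additive_iff
  by (auto simp: birkhoff_sum_def zero_fun_def intro!: exI[of _ "\<lambda>_. 0"])

lemma asymp_additive_subset:
  assumes "\<Phi> \<in> asymp_additive X T" "Z \<subseteq> X"
  shows "\<Phi> \<in> asymp_additive Z T"
  unfolding asymp_additive_iff
proof (intro conjI allI impI)
  fix n :: nat assume "n \<ge> 1"
  then show "continuous_on Z (\<Phi> n)"
    using assms continuous_on_subset unfolding asymp_additive_iff by blast
next
  fix \<xi> :: real assume "\<xi> > 0"
  then obtain g where g: "continuous_on X g"
    "\<forall>\<^sub>F n in sequentially. \<forall>x\<in>X. \<bar>\<Phi> n x - birkhoff_sum T g n x\<bar> \<le> real n * \<xi>"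
    using assms unfolding asymp_additive_iff by blast
  then show "\<exists>g. continuous_on Z g \<and>
      (\<forall>\<^sub>F n in sequentially. \<forall>x\<in>Z. \<bar>\<Phi> n x - birkhoff_sum T g n x\<bar> \<le> real n * \<xi>)"
    using assms(2) by (auto intro!: exI[of _ g] elim!: eventually_mono intro: continuous_on_subset)
qed

lemma null_seqs_diff:
  assumes "\<Phi> \<in> null_seqs X T" "\<Psi> \<in> null_seqs X T"
  shows "\<Phi> - \<Psi> \<in> null_seqs X T"
  unfolding null_seqs_iff
proof (intro conjI allI impI)
  show "\<Phi> - \<Psi> \<in> asymp_additive X T"
    using assms asymp_additive_diff by (auto simp: null_seqs_iff)
  fix \<xi> :: real assume "\<xi> > 0"
  then have "\<forall>\<^sub>F n in sequentially. \<forall>x\<in>X. \<bar>\<Phi> n x\<bar> \<le> real n * (\<xi>/2)"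
      "\<forall>\<^sub>F n in sequentially. \<forall>x\<in>X. \<bar>\<Psi> n x\<bar> \<le> real n * (\<xi>/2)"
    using assms half_gt_zero unfolding null_seqs_iff by blast+
  then show "\<forall>\<^sub>F n in sequentially. \<forall>x\<in>X. \<bar>(\<Phi> - \<Psi>) n x\<bar> \<le> real n * \<xi>"
  proof eventually_elim
    case (elim n)
    show ?case
    proof
      fix x assume "x \<in> X"
      then have "\<bar>\<Phi> n x\<bar> \<le> real n * (\<xi>/2)" "\<bar>\<Psi> n x\<bar> \<le> real n * (\<xi>/2)"
        using elim by blast+
      then show "\<bar>(\<Phi> - \<Psi>) n x\<bar> \<le> real n * \<xi>" by simp
    qed
  qed
qed

lemma null_seqs_zero: "0 \<in> null_seqs X T"
  by (auto simp: null_seqs_iff asymp_additive_zero)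

lemma null_seqs_subset:
  assumes "\<Phi> \<in> null_seqs X T" "Z \<subseteq> X"
  shows "\<Phi> \<in> null_seqs Z T"
proof -
  have "\<forall>\<^sub>F n in sequentially. \<forall>x\<in>Z. \<bar>\<Phi> n x\<bar> \<le> real n * \<xi>" if "\<xi> > 0" for \<xi>
  proof (rule eventually_mono)
    show "\<forall>\<^sub>F n in sequentially. \<forall>x\<in>X. \<bar>\<Phi> n x\<bar> \<le> real n * \<xi>"
      using assms that by (simp add: null_seqs_iff)
  qed (use assms(2) in auto)
  then show ?thesis
    using assms asymp_additive_subset by (auto simp: null_seqs_iff)
qed

subsection \<open>Quotient metrics\<close>

text \<open>The quotient of V by N under a subadditive size p, with \<open>c\<close> naming cosets.
  \<open>d_less\<close> says that d is the infimum of p over a coset, without forming the infimum,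
  and \<open>N_closed\<close> makes d separate points. The names \<open>c x\<close> are left
  abstract because there are two instances: in \<open>E\<close> they are classes on X, in
  \<open>lift\<close> they are classes on Z of sequences defined on X.\<close>

locale coset_metric =
  fixes V N :: "'v::ab_group_add set" and p :: "'v \<Rightarrow> real"
    and c :: "'v \<Rightarrow> 'q" and d :: "'q \<Rightarrow> 'q \<Rightarrow> real"
  assumes V_zero: "0 \<in> V" and V_diff: "x \<in> V \<Longrightarrow> y \<in> V \<Longrightarrow> x - y \<in> V"
    and N_zero: "0 \<in> N" and N_diff: "x \<in> N \<Longrightarrow> y \<in> N \<Longrightarrow> x - y \<in> N"
    and p_zero: "p 0 = 0" and p_diff: "x \<in> V \<Longrightarrow> y \<in> V \<Longrightarrow> p (x - y) \<le> p x + p y"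
    and c_eq: "x \<in> V \<Longrightarrow> y \<in> V \<Longrightarrow> c x = c y \<longleftrightarrow> x - y \<in> N"
    and d_nonneg: "0 \<le> d a b" and d_commute: "d a b = d b a"
    and d_less: "x \<in> V \<Longrightarrow> y \<in> V \<Longrightarrow> d (c x) (c y) < r \<longleftrightarrow> (\<exists>z\<in>V. x - y - z \<in> N \<and> p z < r)"
    and N_closed: "x \<in> V \<Longrightarrow> (\<And>e. e > 0 \<Longrightarrow> \<exists>z\<in>V. x - z \<in> N \<and> p z < e) \<Longrightarrow> x \<in> N"
begin

lemma V_uminus: "x \<in> V \<Longrightarrow> - x \<in> V"
  using V_diff[OF V_zero, of x] by simp

lemma N_uminus: "x \<in> N \<Longrightarrow> - x \<in> N"
  using N_diff[OF N_zero, of x] by simp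

lemma V_add: "x \<in> V \<Longrightarrow> y \<in> V \<Longrightarrow> x + y \<in> V"
  using V_diff[OF _ V_uminus, of x y] by simp

lemma N_add: "x \<in> N \<Longrightarrow> y \<in> N \<Longrightarrow> x + y \<in> N"
  using N_diff[OF _ N_uminus, of x y] by simp

lemma p_uminus: "x \<in> V \<Longrightarrow> p (- x) \<le> p x"
  using p_diff[OF V_zero, of x] by (simp add: p_zero)

lemma p_add: "x \<in> V \<Longrightarrow> y \<in> V \<Longrightarrow> p (x + y) \<le> p x + p y"
  using p_diff[OF _ V_uminus, of x y] p_uminus[of y] by simp

text \<open>If p (x - y) were smaller, z = x - y would witness \<open>d_less\<close> with r equal to
  the distance itself, giving a number less than itself.\<close>

lemma d_le: "x \<in> V \<Longrightarrow> y \<in> V \<Longrightarrow> d (c x) (c y) \<le> p (x - y)"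
  using d_less[of x y "d (c x) (c y)"] V_diff[of x y] N_zero by force

text \<open>Moving y inside its coset to x - z, with z from \<open>d_less\<close>, puts it at size p
  z from x. All later perturbation arguments pass from distances of classes to representatives in
  this way.\<close>

lemma d_lessE:
  assumes "x \<in> V" "y \<in> V" "d (c x) (c y) < r"
  obtains y' where "y' \<in> V" "c y' = c y" "p (x - y') < r"
proof -
  obtain z where z: "z \<in> V" "x - y - z \<in> N" "p z < r"
    using assms d_less by blast
  have "x - z - y \<in> N"
    using z(2) by (simp add: algebra_simps)
  then show thesis
    using that[of "x - z"] z assms by (simp add: V_diff c_eq)
qed

sublocale Metric_space "c ` V" d
proof
  have "\<exists>x. x \<in> V \<and> a = c x" if "a \<in> c ` V" for a
    using that by auto
  note repr = this
  show "0 \<le> d a b" for a b by (rule d_nonneg)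
  show "d a b = 0 \<longleftrightarrow> a = b" if ab: "a \<in> c ` V" "b \<in> c ` V" for a b
  proof -
    obtain x y where xy: "x \<in> V" "y \<in> V" "a = c x" "b = c y"
      using repr[OF ab(1)] repr[OF ab(2)] by blast
    show ?thesis
    proof
      assume "d a b = 0"
      then have "\<exists>z\<in>V. x - y - z \<in> N \<and> p z < e" if "e > 0" for e
        using d_less[of x y e] xy that by simp
      then have "x - y \<in> N"
        by (intro N_closed V_diff xy)
      then show "a = b" using c_eq xy by simp
    next
      assume "a = b"
      then have "d a b \<le> 0"
        using d_le[of x x] xy p_zero by simp
      then show "d a b = 0" using d_nonneg[of a b] by linarith
    qed
  qed
  show "d a e \<le> d a b + d b e" if abe: "a \<in> c ` V" "b \<in> c ` V" "e \<in> c ` V" for a b e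
  proof (rule ccontr)
    obtain x y z where xyz: "x \<in> V" "y \<in> V" "z \<in> V" "a = c x" "b = c y" "e = c z"
      using repr[OF abe(1)] repr[OF abe(2)] repr[OF abe(3)] by blast
    assume neg: "\<not> d a e \<le> d a b + d b e"
    \<comment> \<open>\<open>d_less\<close> needs strict inequalities, so a failure of the triangle
      inequality is split into two equal slacks, one for each summand.\<close>
    define h where "h = (d a e - d a b - d b e) / 2"
    have h: "h > 0" "d a b + h + (d b e + h) = d a e"
      using neg by (auto simp: h_def field_simps)
    have "d (c x) (c y) < d a b + h" "d (c y) (c z) < d b e + h"
      using h xyz by auto
    then obtain u v where u: "u \<in> V" "x - y - u \<in> N" "p u < d a b + h"
        and v: "v \<in> V" "y - z - v \<in> N" "p v < d b e + h"
      using d_less xyz by meson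
    have "x - z - (u + v) \<in> N"
      using N_add[OF u(2) v(2)] by (simp add: algebra_simps)
    moreover have "p (u + v) < d a e"
      using p_add[OF u(1) v(1)] u(3) v(3) h by linarith
    ultimately have "d (c x) (c z) < d a e"
      using d_less[of x z "d a e"] xyz V_add[OF u(1) v(1)] by blast
    then show False using xyz by simp
  qed
  show "d a b = d b a" for a b by (rule d_commute)
qed

end

subsection \<open>The quotient space and the extendable space\<close>

lemma AA_norm_uminus: "AA_norm X T (- \<Psi>) = AA_norm X T \<Psi>"
proof -
  have "\<bar>- a + b + c\<bar> = \<bar>a - b - c\<bar>" "\<bar>b - a\<bar> = \<bar>a - b\<bar>" for a b c :: real
    by linarith+
  then show ?thesis
    by (simp add: AA_norm_def A_norm_def defect_def lip_orb_def sup_norm_def)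
qed

lemma AA_orb_I: "\<Psi> \<in> asymp_additive X T \<Longrightarrow> AA_bound X T \<Psi> a b c \<Longrightarrow> \<Psi> \<in> AA_orb X T"
  by (auto simp: AA_orb_def AA_bound_iff intro: le_less_trans)

definition E_class ::
  "'a::metric_space set \<Rightarrow> ('a \<Rightarrow> 'a) \<Rightarrow> (nat \<Rightarrow> 'a \<Rightarrow> real) \<Rightarrow> (nat \<Rightarrow> 'a \<Rightarrow> real) set" where
  "E_class X T \<Phi> = null_rel X T `` {\<Phi>}"

lemma E_orb_eq: "E_orb X T = E_class X T ` AA_orb X T"
  by (auto simp: E_orb_def quotient_def E_class_def)

lemma coset_diff_commute: "coset_diff \<theta> \<eta> = uminus ` coset_diff \<eta> \<theta>"
proof -
  have "coset_diff \<theta> \<eta> = (\<lambda>(\<Phi>, \<Psi>). \<Psi> - \<Phi>) ` (\<eta> \<times> \<theta>)" for \<theta> \<eta> :: "(nat \<Rightarrow> 'a \<Rightarrow> real) set"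
    by (auto simp: coset_diff_def fun_diff_def image_def)
  moreover have "coset_diff \<eta> \<theta> = (\<lambda>(\<Phi>, \<Psi>). \<Phi> - \<Psi>) ` (\<eta> \<times> \<theta>)" for \<theta> \<eta> :: "(nat \<Rightarrow> 'a \<Rightarrow> real) set"
    by (auto simp: coset_diff_def fun_diff_def image_def)
  ultimately show ?thesis
    by (auto simp: image_image case_prod_unfold)
qed

lemma E_norm_uminus: "E_norm X T (uminus ` \<eta>) = E_norm X T \<eta>"
  by (simp add: E_norm_def image_image AA_norm_uminus)

lemma E_dist_commute: "E_dist X T \<eta> \<theta> = E_dist X T \<theta> \<eta>"
  by (metis E_dist_def E_norm_uminus coset_diff_commute)

locale compact_system =
  fixes X :: "'a::metric_space set" and T :: "'a \<Rightarrow> 'a"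
  assumes compact: "compact X" and cont: "continuous_on X T" and invariant: "T ` X \<subseteq> X"
begin

lemma funpow_in: "x \<in> X \<Longrightarrow> (T ^^ n) x \<in> X"
  using invariant by (induction n) auto

lemma continuous_on_funpow: "continuous_on X (T ^^ n)"
proof (induction n)
  case (Suc n)
  have "continuous_on X (T \<circ> (T ^^ n))"
    using funpow_in by (intro continuous_on_compose Suc continuous_on_subset[OF cont]) auto
  then show ?case by simp
qed (simp add: id_def)

lemma AA_continuous: "\<Psi> \<in> AA_orb X T \<Longrightarrow> n \<ge> 1 \<Longrightarrow> continuous_on X (\<Psi> n)"
  by (auto simp: AA_orb_def asymp_additive_iff)

text \<open>Finiteness of the size is not part of the definition of \<open>AA_orb\<close>. Cutting
  \<Psi> n into translates of \<Psi> 1 costs at most b per cut, and \<Psi> 1 is bounded on the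
  compact X.\<close>

lemma AA_finite:
  assumes "\<Psi> \<in> AA_orb X T"
  shows "AA_norm X T \<Psi> < \<infinity>"
proof -
  have fin: "defect X T \<Psi> < \<infinity>" "lip_orb X T \<Psi> < \<infinity>"
    using assms by (auto simp: AA_orb_def)
  define b where "b = enn2real (defect X T \<Psi>)"
  have b: "0 \<le> b" "defect X T \<Psi> \<le> ennreal b"
    using fin by (auto simp: b_def)
  have "bounded (\<Psi> 1 ` X)"
    using compact AA_continuous[OF assms]
    by (intro compact_imp_bounded compact_continuous_image) auto
  then obtain B where B: "\<And>x. x \<in> X \<Longrightarrow> \<bar>\<Psi> 1 x\<bar> \<le> B"
    by (auto simp: bounded_iff)
  \<comment> \<open>B may be negative when X is empty, but the bound must be a nonnegative
    constant.\<close>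
  define A where "A = max 0 B"
  have "\<bar>\<Psi> (Suc n) x\<bar> \<le> real (Suc n) * (A + b)" if "x \<in> X" for n x
    using that
  proof (induction n)
    case 0
    then show ?case using B[of x] b(1) by (simp add: A_def)
  next
    case (Suc n)
    have "\<bar>\<Psi> (Suc n + 1) x - \<Psi> (Suc n) x - \<Psi> 1 ((T ^^ Suc n) x)\<bar> \<le> b"
      using b Suc.prems unfolding defect_le_iff[OF b(1)] by (metis One_nat_def Suc_le_mono le0 order_refl)
    moreover have "\<bar>\<Psi> 1 ((T ^^ Suc n) x)\<bar> \<le> A"
      using B[OF funpow_in[OF Suc.prems]] unfolding A_def by (rule max.coboundedI2)
    ultimately show ?case
      using Suc.IH[OF Suc.prems] by (simp add: algebra_simps)
  qed
  then have "\<forall>n\<ge>1. \<forall>x\<in>X. \<bar>\<Psi> n x\<bar> \<le> real n * (A + b)"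
    by (metis One_nat_def Suc_le_D)
  then have "A_norm X \<Psi> \<le> ennreal (A + b)"
    using b(1) by (subst A_norm_le_iff) (auto simp: A_def)
  then have "A_norm X \<Psi> < \<infinity>"
    by (rule le_less_trans) simp
  then show ?thesis
    using fin by (simp add: AA_norm_def)
qed

lemma AA_boundE:
  assumes "\<Psi> \<in> AA_orb X T"
  obtains a b c where "AA_bound X T \<Psi> a b c" "AA_nm X T \<Psi> = a + b + c"
  using AA_bound_exact[OF AA_finite[OF assms]] by blast

lemma AA_nm_bounds:
  assumes "\<Psi> \<in> AA_orb X T"
  shows "AA_bound X T \<Psi> (AA_nm X T \<Psi>) (AA_nm X T \<Psi>) (AA_nm X T \<Psi>)"
proof -
  obtain a b c where abc: "AA_bound X T \<Psi> a b c" "AA_nm X T \<Psi> = a + b + c"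
    using AA_boundE[OF assms] .
  then show ?thesis
    using AA_boundD(1-3)[OF abc(1)] by (intro AA_bound_mono[OF abc(1)]) auto
qed

lemma AA_norm_less_iff:
  "\<Psi> \<in> AA_orb X T \<Longrightarrow> AA_norm X T \<Psi> < ennreal r \<longleftrightarrow> AA_nm X T \<Psi> < r"
  using AA_finite[of \<Psi>] AA_nm_nonneg[of X T \<Psi>]
  by (metis AA_nm_def ennreal_enn2real_if ennreal_less_iff infinity_ennreal_def less_irrefl)

lemma AA_zero: "0 \<in> AA_orb X T"
  using AA_orb_I asymp_additive_zero AA_bound_zero by blast

lemma AA_diff:
  assumes "\<Phi> \<in> AA_orb X T" "\<Psi> \<in> AA_orb X T"
  shows "\<Phi> - \<Psi> \<in> AA_orb X T"
proof -
  have "\<Phi> - \<Psi> \<in> asymp_additive X T"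
    using assms by (intro asymp_additive_diff) (auto simp: AA_orb_def)
  then show ?thesis
    using AA_orb_I AA_bound_diff[OF AA_nm_bounds[OF assms(1)] AA_nm_bounds[OF assms(2)]] by blast
qed

lemma AA_add: "\<Phi> \<in> AA_orb X T \<Longrightarrow> \<Psi> \<in> AA_orb X T \<Longrightarrow> \<Phi> + \<Psi> \<in> AA_orb X T"
  using AA_diff[of \<Phi> "0 - \<Psi>"] AA_diff[OF AA_zero, of \<Psi>] by simp

lemma AA_nm_diff:
  assumes "\<Phi> \<in> AA_orb X T" "\<Psi> \<in> AA_orb X T"
  shows "AA_nm X T (\<Phi> - \<Psi>) \<le> AA_nm X T \<Phi> + AA_nm X T \<Psi>"
proof -
  obtain a b c where abc: "AA_bound X T \<Phi> a b c" "AA_nm X T \<Phi> = a + b + c"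
    using AA_boundE[OF assms(1)] .
  obtain a' b' c' where abc': "AA_bound X T \<Psi> a' b' c'" "AA_nm X T \<Psi> = a' + b' + c'"
    using AA_boundE[OF assms(2)] .
  show ?thesis
    using AA_bound_nm_le[OF AA_bound_diff[OF abc(1) abc'(1)]] abc(2) abc'(2) by simp
qed

lemma AA_nm_zero: "AA_nm X T 0 = 0"
  using AA_bound_nm_le[OF AA_bound_zero, of X T] AA_nm_nonneg[of X T 0] by simp

lemma AA_uminus: "\<Phi> \<in> AA_orb X T \<Longrightarrow> - \<Phi> \<in> AA_orb X T"
  using AA_diff[OF AA_zero] by simp

lemma E_class_iff:
  assumes "\<Phi> \<in> AA_orb X T"
  shows "\<Psi> \<in> E_class X T \<Phi> \<longleftrightarrow> \<Psi> \<in> AA_orb X T \<and> \<Phi> - \<Psi> \<in> null_seqs X T"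
  using assms AA_diff[OF assms, of \<Psi>] by (auto simp: E_class_def null_rel_def fun_diff_def)

lemma E_class_self: "\<Phi> \<in> AA_orb X T \<Longrightarrow> \<Phi> \<in> E_class X T \<Phi>"
  by (simp add: E_class_iff null_seqs_zero)

lemma null_seqs_uminus: "\<Phi> \<in> null_seqs X T \<Longrightarrow> - \<Phi> \<in> null_seqs X T"
  using null_seqs_diff[OF null_seqs_zero, of \<Phi>] by simp

lemma E_class_eq_iff:
  assumes "\<Phi> \<in> AA_orb X T" "\<Psi> \<in> AA_orb X T"
  shows "E_class X T \<Phi> = E_class X T \<Psi> \<longleftrightarrow> \<Phi> - \<Psi> \<in> null_seqs X T"
proof
  assume "E_class X T \<Phi> = E_class X T \<Psi>"
  then show "\<Phi> - \<Psi> \<in> null_seqs X T"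
    using E_class_iff[OF assms(1)] E_class_self[OF assms(2)] by simp
next
  assume *: "\<Phi> - \<Psi> \<in> null_seqs X T"
  have "\<Phi> - \<Theta> \<in> null_seqs X T \<longleftrightarrow> \<Psi> - \<Theta> \<in> null_seqs X T" for \<Theta>
  proof
    assume "\<Phi> - \<Theta> \<in> null_seqs X T"
    from null_seqs_diff[OF this *] show "\<Psi> - \<Theta> \<in> null_seqs X T" by simp
  next
    assume "\<Psi> - \<Theta> \<in> null_seqs X T"
    from null_seqs_diff[OF * null_seqs_uminus[OF this]] show "\<Phi> - \<Theta> \<in> null_seqs X T" by simp
  qed
  then show "E_class X T \<Phi> = E_class X T \<Psi>"
    using E_class_iff assms by blast
qed

lemma coset_diff_E_class:
  assumes "\<Phi> \<in> AA_orb X T" "\<Psi> \<in> AA_orb X T"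
  shows "coset_diff (E_class X T \<Phi>) (E_class X T \<Psi>) = E_class X T (\<Phi> - \<Psi>)"
proof safe
  fix \<Theta> assume "\<Theta> \<in> coset_diff (E_class X T \<Phi>) (E_class X T \<Psi>)"
  then obtain \<Phi>' \<Psi>' where \<Theta>: "\<Theta> = \<Phi>' - \<Psi>'" "\<Phi>' \<in> E_class X T \<Phi>" "\<Psi>' \<in> E_class X T \<Psi>"
    by (auto simp: coset_diff_def fun_diff_def)
  then have "(\<Phi> - \<Phi>') - (\<Psi> - \<Psi>') \<in> null_seqs X T"
    using E_class_iff assms by (blast intro: null_seqs_diff)
  then have "\<Phi> - \<Psi> - \<Theta> \<in> null_seqs X T"
    by (simp add: \<Theta> algebra_simps)
  then show "\<Theta> \<in> E_class X T (\<Phi> - \<Psi>)"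
    using \<Theta> assms by (simp add: E_class_iff AA_diff)
next
  fix \<Theta> assume *: "\<Theta> \<in> E_class X T (\<Phi> - \<Psi>)"
  have "\<Phi> - (\<Theta> + \<Psi>) \<in> null_seqs X T" "\<Theta> + \<Psi> \<in> AA_orb X T"
    using * assms by (auto simp: E_class_iff AA_diff AA_add algebra_simps)
  then have "\<Theta> + \<Psi> \<in> E_class X T \<Phi>"
    using assms by (simp add: E_class_iff)
  moreover have "\<Theta> = (\<lambda>n x. (\<Theta> + \<Psi>) n x - \<Psi> n x)"
    by (simp add: fun_eq_iff)
  ultimately show "\<Theta> \<in> coset_diff (E_class X T \<Phi>) (E_class X T \<Psi>)"
    using E_class_self[OF assms(2)] unfolding coset_diff_def by blast
qed

lemma AA_nm_size: "\<Psi> \<in> AA_orb X T \<Longrightarrow> n \<ge> 1 \<Longrightarrow> x \<in> X \<Longrightarrow> \<bar>\<Psi> n x\<bar> \<le> real n * AA_nm X T \<Psi>"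
  by (rule AA_boundD(4)[OF AA_nm_bounds])

text \<open>A representative of norm below \<xi>/2 contributes at most n * \<xi>/2 at time n,
  uniformly on X, and the null part eventually contributes no more on Z. Keeping Z separate from X
  serves both quotients: Z = X for \<open>E\<close>, and the kernel of the restriction for
  \<open>lift\<close>.\<close>

lemma null_seqs_closed:
  assumes "\<Phi> \<in> AA_orb X T" "Z \<subseteq> X"
    and *: "\<And>e. e > 0 \<Longrightarrow> \<exists>\<Psi>\<in>AA_orb X T. \<Phi> - \<Psi> \<in> null_seqs Z T \<and> AA_nm X T \<Psi> < e"
  shows "\<Phi> \<in> null_seqs Z T"
  unfolding null_seqs_iff
proof (intro conjI allI impI)
  show "\<Phi> \<in> asymp_additive Z T"
    using assms asymp_additive_subset by (auto simp: AA_orb_def)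
  fix \<xi> :: real assume "\<xi> > 0"
  then obtain \<Psi> where \<Psi>: "\<Psi> \<in> AA_orb X T" "\<Phi> - \<Psi> \<in> null_seqs Z T" "AA_nm X T \<Psi> < \<xi>/2"
    using *[of "\<xi>/2"] by auto
  have "\<forall>\<^sub>F n in sequentially. \<forall>x\<in>Z. \<bar>(\<Phi> - \<Psi>) n x\<bar> \<le> real n * (\<xi>/2)"
    using \<Psi>(2) \<open>\<xi> > 0\<close> half_gt_zero unfolding null_seqs_iff by blast
  then show "\<forall>\<^sub>F n in sequentially. \<forall>x\<in>Z. \<bar>\<Phi> n x\<bar> \<le> real n * \<xi>"
    using eventually_ge_at_top[of 1]
  proof eventually_elim
    case (elim n)
    show ?case
    proof
      fix x assume "x \<in> Z"
      then have "\<bar>(\<Phi> - \<Psi>) n x\<bar> \<le> real n * (\<xi>/2)" "\<bar>\<Psi> n x\<bar> \<le> real n * AA_nm X T \<Psi>"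
        using elim AA_nm_size[OF \<Psi>(1)] assms(2) by blast+
      moreover have "real n * AA_nm X T \<Psi> \<le> real n * (\<xi>/2)"
        using \<Psi>(3) by (intro mult_left_mono) auto
      ultimately show "\<bar>\<Phi> n x\<bar> \<le> real n * \<xi>"
        unfolding minus_apply by argo
    qed
  qed
qed

lemma E_dist_less_iff:
  assumes "\<Phi> \<in> AA_orb X T" "\<Psi> \<in> AA_orb X T"
  shows "E_dist X T (E_class X T \<Phi>) (E_class X T \<Psi>) < r \<longleftrightarrow>
    (\<exists>\<Theta>\<in>AA_orb X T. \<Phi> - \<Psi> - \<Theta> \<in> AA_orb X T \<inter> null_seqs X T \<and> AA_nm X T \<Theta> < r)"
proof -
  let ?N = "E_norm X T (E_class X T (\<Phi> - \<Psi>))"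
  have D: "\<Phi> - \<Psi> \<in> AA_orb X T"
    by (intro AA_diff assms)
  have "?N \<le> AA_norm X T (\<Phi> - \<Psi>)"
    unfolding E_norm_def by (rule INF_lower[OF E_class_self[OF D]])
  \<comment> \<open>Finiteness is what lets a strict inequality pass through
    \<open>enn2real\<close>, which would turn an infinite norm into 0.\<close>
  then have fin: "?N < \<infinity>"
    using AA_finite[OF D] by order
  have "E_dist X T (E_class X T \<Phi>) (E_class X T \<Psi>) < r \<longleftrightarrow> enn2real ?N < r"
    using assms by (simp add: E_dist_def coset_diff_E_class)
  also have "\<dots> \<longleftrightarrow> ?N < ennreal r"
    using fin by (cases ?N) (auto simp: ennreal_less_iff)
  also have "\<dots> \<longleftrightarrow> (\<exists>\<Theta>\<in>E_class X T (\<Phi> - \<Psi>). AA_norm X T \<Theta> < ennreal r)"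
    by (simp add: E_norm_def INF_less_iff)
  also have "\<dots> \<longleftrightarrow> (\<exists>\<Theta>\<in>E_class X T (\<Phi> - \<Psi>). AA_nm X T \<Theta> < r)"
    using AA_norm_less_iff E_class_iff[OF D] by blast
  also have "\<dots> \<longleftrightarrow> (\<exists>\<Theta>\<in>AA_orb X T. \<Phi> - \<Psi> - \<Theta> \<in> AA_orb X T \<inter> null_seqs X T \<and> AA_nm X T \<Theta> < r)"
    using E_class_iff[OF D] AA_diff[OF D] by blast
  finally show ?thesis .
qed

sublocale E: coset_metric "AA_orb X T" "AA_orb X T \<inter> null_seqs X T" "AA_nm X T" "E_class X T" "E_dist X T"
proof
  show "x \<in> AA_orb X T \<inter> null_seqs X T"
    if "x \<in> AA_orb X T" "\<And>e. e > 0 \<Longrightarrow> \<exists>z\<in>AA_orb X T. x - z \<in> AA_orb X T \<inter> null_seqs X T \<and> AA_nm X T z < e"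
    for x
    using null_seqs_closed[OF that(1) order_refl] that by blast
qed (auto simp: AA_zero AA_diff null_seqs_zero null_seqs_diff AA_nm_zero AA_nm_diff
       E_class_eq_iff E_dist_def E_dist_commute[unfolded E_dist_def] E_dist_less_iff[unfolded E_dist_def])

lemma E_topology_eq: "E_topology X T = E.mtopology"
  by (simp add: E_topology_def E_orb_eq)

end

subsection \<open>Completeness and the Baire property\<close>

context compact_system
begin

lemma AA_norm_cong:
  assumes eq: "\<And>n x. n \<ge> 1 \<Longrightarrow> x \<in> X \<Longrightarrow> \<Phi> n x = \<Psi> n x"
  shows "AA_norm X T \<Phi> = AA_norm X T \<Psi>"
proof -
  have "sup_norm X (\<Phi> n) = sup_norm X (\<Psi> n)" if "n \<ge> 1" for n
    using eq that by (auto simp: sup_norm_def intro!: SUP_cong)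
  then have "A_norm X \<Phi> = A_norm X \<Psi>"
    by (auto simp: A_norm_def intro!: SUP_cong)
  moreover have "defect X T \<Phi> = defect X T \<Psi>"
    using eq funpow_in by (auto simp: defect_def sup_norm_def intro!: SUP_cong)
  moreover have "lip_orb X T \<Phi> = lip_orb X T \<Psi>"
    using eq by (auto simp: lip_orb_def intro!: SUP_cong)
  ultimately show ?thesis
    by (simp add: AA_norm_def)
qed

text \<open>Values at n = 0 and off X are invisible to the norm, so on \<open>AA_orb\<close> it
  separates points only up to them. Fixing these values to be 0 gives a genuine metric space of
  representatives, in which Baire's theorem can be used.\<close>

definition AA_normal :: "(nat \<Rightarrow> 'a \<Rightarrow> real) set" where
  "AA_normal = {\<Psi> \<in> AA_orb X T. \<forall>n x. n = 0 \<or> x \<notin> X \<longrightarrow> \<Psi> n x = 0}"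

lemma AA_normal_AA: "\<Psi> \<in> AA_normal \<Longrightarrow> \<Psi> \<in> AA_orb X T"
  by (simp add: AA_normal_def)

text \<open>The last clause carries the estimate of \<open>E.d_lessE\<close> over to the normalized
  representative.\<close>

lemma AA_normal_representative:
  assumes "\<Psi> \<in> AA_orb X T"
  obtains \<Psi>' where "\<Psi>' \<in> AA_normal" "E_class X T \<Psi>' = E_class X T \<Psi>"
    "\<forall>\<Phi>. AA_nm X T (\<Phi> - \<Psi>') = AA_nm X T (\<Phi> - \<Psi>)"
proof
  define \<Psi>' where "\<Psi>' = (\<lambda>n x. if n \<ge> 1 \<and> x \<in> X then \<Psi> n x else 0)"
  have eq: "\<Psi>' n x = \<Psi> n x" if "n \<ge> 1" "x \<in> X" for n x
    using that by (simp add: \<Psi>'_def)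
  have AA0: "AA_bound X T (\<Psi> - \<Psi>') 0 0 0"
    using eq funpow_in by (simp add: AA_bound_def)
  have as: "\<Psi> - \<Psi>' \<in> asymp_additive X T"
    unfolding asymp_additive_iff
  proof (intro conjI allI impI)
    fix n :: nat assume "n \<ge> 1"
    then show "continuous_on X ((\<Psi> - \<Psi>') n)"
      using eq by (intro continuous_on_eq[OF continuous_on_const[of _ 0]]) auto
  next
    fix \<xi> :: real assume "\<xi> > 0"
    have "\<forall>x\<in>X. \<bar>(\<Psi> - \<Psi>') n x - birkhoff_sum T (\<lambda>_. 0) n x\<bar> \<le> real n * \<xi>" if "n \<ge> 1" for n
      using eq that \<open>\<xi> > 0\<close> by (simp add: birkhoff_sum_def)
    then show "\<exists>g. continuous_on X g \<and>
        (\<forall>\<^sub>F n in sequentially. \<forall>x\<in>X. \<bar>(\<Psi> - \<Psi>') n x - birkhoff_sum T g n x\<bar> \<le> real n * \<xi>)"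
      by (intro exI[of _ "\<lambda>_. 0"] conjI eventually_mono[OF eventually_ge_at_top[of 1]]) auto
  qed
  have AA': "\<Psi>' \<in> AA_orb X T"
    using AA_diff[OF assms AA_orb_I[OF as AA0]] by simp
  then show "\<Psi>' \<in> AA_normal"
    by (auto simp: AA_normal_def \<Psi>'_def)
  have "\<forall>\<^sub>F n in sequentially. \<forall>x\<in>X. \<bar>(\<Psi>' - \<Psi>) n x\<bar> \<le> real n * \<xi>" if "\<xi> > 0" for \<xi>
    using that eq by (intro eventually_mono[OF eventually_ge_at_top[of 1]]) auto
  moreover have "\<Psi>' - \<Psi> \<in> asymp_additive X T"
    using asymp_additive_diff[OF asymp_additive_zero as] by simp
  ultimately show "E_class X T \<Psi>' = E_class X T \<Psi>"
    using E_class_eq_iff[OF AA' assms] by (simp add: null_seqs_iff)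
  show "\<forall>\<Phi>. AA_nm X T (\<Phi> - \<Psi>') = AA_nm X T (\<Phi> - \<Psi>)"
    unfolding AA_nm_def using eq by (intro allI arg_cong[of _ _ enn2real] AA_norm_cong) simp
qed

sublocale N: Metric_space AA_normal "\<lambda>\<Phi> \<Psi>. AA_nm X T (\<Phi> - \<Psi>)"
proof
  show "0 \<le> AA_nm X T (\<Phi> - \<Psi>)" for \<Phi> \<Psi> by (rule AA_nm_nonneg)
  show "AA_nm X T (\<Phi> - \<Psi>) = AA_nm X T (\<Psi> - \<Phi>)" for \<Phi> \<Psi>
    unfolding AA_nm_def using AA_norm_uminus[of X T "\<Phi> - \<Psi>"] by simp
  show "AA_nm X T (\<Phi> - \<Psi>) = 0 \<longleftrightarrow> \<Phi> = \<Psi>" if "\<Phi> \<in> AA_normal" "\<Psi> \<in> AA_normal" for \<Phi> \<Psi>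
  proof
    assume *: "AA_nm X T (\<Phi> - \<Psi>) = 0"
    have "\<Phi> n x = \<Psi> n x" for n x
    proof (cases "n \<ge> 1 \<and> x \<in> X")
      case True
      then have "\<bar>(\<Phi> - \<Psi>) n x\<bar> \<le> real n * AA_nm X T (\<Phi> - \<Psi>)"
        using that by (intro AA_nm_size AA_diff AA_normal_AA) auto
      then show ?thesis using * by simp
    next
      case False
      then have "n = 0 \<or> x \<notin> X" by auto
      then show ?thesis using that unfolding AA_normal_def by auto
    qed
    then show "\<Phi> = \<Psi>" by blast
  qed (simp add: AA_nm_zero)
  show "AA_nm X T (\<Phi> - \<Theta>) \<le> AA_nm X T (\<Phi> - \<Psi>) + AA_nm X T (\<Psi> - \<Theta>)"
    if "\<Phi> \<in> AA_normal" "\<Psi> \<in> AA_normal" "\<Theta> \<in> AA_normal" for \<Phi> \<Psi> \<Theta>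
    using E.p_add[of "\<Phi> - \<Psi>" "\<Psi> - \<Theta>"] that by (simp add: AA_normal_AA AA_diff)
qed

text \<open>The norm controls each value up to the factor n, so a Cauchy sequence has a pointwise
  limit; the three bounds are closed conditions and survive the limit. Convergence is uniform at
  each fixed n and, after division by n, uniform in n as well, which preserves continuity and
  asymptotic additivity.\<close>

lemma mcomplete_AA_normal: "N.mcomplete"
  unfolding N.mcomplete_def
proof (intro allI impI)
  fix \<sigma> assume "N.MCauchy \<sigma>"
  then have \<sigma>_normal: "\<sigma> k \<in> AA_normal" and
    cauchy: "\<And>e. e > 0 \<Longrightarrow> \<exists>K. \<forall>k\<ge>K. \<forall>l\<ge>K. AA_nm X T (\<sigma> k - \<sigma> l) < e" for k
    unfolding N.MCauchy_def by auto
  note \<sigma>_AA = AA_normal_AA[OF \<sigma>_normal]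
  have "convergent (\<lambda>k. \<sigma> k n x)" if nx: "n \<ge> 1" "x \<in> X" for n x
  proof -
    have "\<exists>K. \<forall>k\<ge>K. \<forall>l\<ge>K. norm (\<sigma> k n x - \<sigma> l n x) < e" if "e > 0" for e
    proof -
      have "e / real n > 0" using nx that by simp
      from cauchy[OF this]
      obtain K where K: "\<And>k l. k \<ge> K \<Longrightarrow> l \<ge> K \<Longrightarrow> AA_nm X T (\<sigma> k - \<sigma> l) < e / real n"
        by blast
      have "norm (\<sigma> k n x - \<sigma> l n x) < e" if "k \<ge> K" "l \<ge> K" for k l
      proof -
        have "\<bar>(\<sigma> k - \<sigma> l) n x\<bar> \<le> real n * AA_nm X T (\<sigma> k - \<sigma> l)"
          using nx by (intro AA_nm_size AA_diff \<sigma>_AA)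
        also have "\<dots> < e"
          using K[OF that] nx by (simp add: field_simps)
        finally show ?thesis by simp
      qed
      then show ?thesis by blast
    qed
    then show ?thesis
      unfolding Cauchy_convergent_iff[symmetric] Cauchy_iff by blast
  qed
  note conv = this
  define \<Phi> where "\<Phi> = (\<lambda>n x. if n \<ge> 1 \<and> x \<in> X then lim (\<lambda>k. \<sigma> k n x) else 0)"
  have lim: "(\<lambda>k. \<sigma> k n x) \<longlonglongrightarrow> \<Phi> n x" if "n \<ge> 1" "x \<in> X" for n x
    using conv[OF that] that by (simp add: \<Phi>_def convergent_LIMSEQ_iff)
  \<comment> \<open>Keep k fixed and let l tend to infinity in the bounds for \<sigma> k - \<sigma>
    l.\<close>
  have bound: "\<exists>K. \<forall>k\<ge>K. AA_bound X T (\<sigma> k - \<Phi>) e e e" if "e > 0" for e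
  proof -
    obtain K where K: "\<And>k l. k \<ge> K \<Longrightarrow> l \<ge> K \<Longrightarrow> AA_nm X T (\<sigma> k - \<sigma> l) < e"
      using cauchy[OF \<open>e > 0\<close>] by blast
    have "AA_bound X T (\<sigma> k - \<Phi>) e e e" if k: "k \<ge> K" for k
    proof -
      have B: "AA_bound X T (\<sigma> k - \<sigma> l) e e e" if "l \<ge> K" for l
      proof -
        have "AA_nm X T (\<sigma> k - \<sigma> l) \<le> e"
          using K[OF k that] by simp
        then show ?thesis
          by (intro AA_bound_mono[OF AA_nm_bounds[OF AA_diff[OF \<sigma>_AA \<sigma>_AA]]])
      qed
      have "\<bar>\<sigma> k n x - \<Phi> n x\<bar> \<le> real n * e" if "n \<ge> 1" "x \<in> X" for n x
      proof (rule tendsto_upperbound)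
        show "(\<lambda>l. \<bar>\<sigma> k n x - \<sigma> l n x\<bar>) \<longlonglongrightarrow> \<bar>\<sigma> k n x - \<Phi> n x\<bar>"
          by (intro tendsto_intros lim that)
        show "\<forall>\<^sub>F l in sequentially. \<bar>\<sigma> k n x - \<sigma> l n x\<bar> \<le> real n * e"
          by (rule eventually_mono[OF eventually_ge_at_top[of K]]) (use AA_boundD(4)[OF B that] in simp)
      qed simp
      moreover have "\<bar>\<sigma> k (n + m) x - \<Phi> (n + m) x - (\<sigma> k n x - \<Phi> n x) -
          (\<sigma> k m ((T ^^ n) x) - \<Phi> m ((T ^^ n) x))\<bar> \<le> e" if "n \<ge> 1" "m \<ge> 1" "x \<in> X" for n m x
      proof (rule tendsto_upperbound)
        show "(\<lambda>l. \<bar>\<sigma> k (n + m) x - \<sigma> l (n + m) x - (\<sigma> k n x - \<sigma> l n x) -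
            (\<sigma> k m ((T ^^ n) x) - \<sigma> l m ((T ^^ n) x))\<bar>) \<longlonglongrightarrow>
          \<bar>\<sigma> k (n + m) x - \<Phi> (n + m) x - (\<sigma> k n x - \<Phi> n x) -
            (\<sigma> k m ((T ^^ n) x) - \<Phi> m ((T ^^ n) x))\<bar>"
          using that by (intro tendsto_intros lim funpow_in) auto
        show "\<forall>\<^sub>F l in sequentially. \<bar>\<sigma> k (n + m) x - \<sigma> l (n + m) x - (\<sigma> k n x - \<sigma> l n x) -
            (\<sigma> k m ((T ^^ n) x) - \<sigma> l m ((T ^^ n) x))\<bar> \<le> e"
          by (rule eventually_mono[OF eventually_ge_at_top[of K]]) (use AA_boundD(5)[OF B that] in simp)
      qed simp
      moreover have "\<bar>\<sigma> k n x - \<Phi> n x - (\<sigma> k n y - \<Phi> n y)\<bar>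
          \<le> e * (\<Sum>j<n. dist ((T ^^ j) x) ((T ^^ j) y))" if "n \<ge> 1" "x \<in> X" "y \<in> X" for n x y
      proof (rule tendsto_upperbound)
        show "(\<lambda>l. \<bar>\<sigma> k n x - \<sigma> l n x - (\<sigma> k n y - \<sigma> l n y)\<bar>) \<longlonglongrightarrow>
            \<bar>\<sigma> k n x - \<Phi> n x - (\<sigma> k n y - \<Phi> n y)\<bar>"
          by (intro tendsto_intros lim that)
        show "\<forall>\<^sub>F l in sequentially. \<bar>\<sigma> k n x - \<sigma> l n x - (\<sigma> k n y - \<sigma> l n y)\<bar>
            \<le> e * (\<Sum>j<n. dist ((T ^^ j) x) ((T ^^ j) y))"
          by (rule eventually_mono[OF eventually_ge_at_top[of K]]) (use AA_boundD(6)[OF B that] in simp)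
      qed simp
      ultimately show ?thesis
        using \<open>e > 0\<close> by (simp add: AA_bound_def)
    qed
    then show ?thesis by blast
  qed
  have "\<Phi> \<in> asymp_additive X T"
    unfolding asymp_additive_iff
  proof (intro conjI allI impI)
    fix n :: nat assume n: "n \<ge> 1"
    have "uniform_limit X (\<lambda>k. \<sigma> k n) (\<Phi> n) sequentially"
    proof (rule uniform_limitI)
      fix e :: real assume "e > 0"
      then have "e / (2 * real n) > 0" using n by simp
      from bound[OF this] obtain K where K: "\<And>k. k \<ge> K \<Longrightarrow>
          AA_bound X T (\<sigma> k - \<Phi>) (e / (2 * real n)) (e / (2 * real n)) (e / (2 * real n))"
        by blast
      have "dist (\<sigma> k n x) (\<Phi> n x) < e" if "k \<ge> K" "x \<in> X" for k x
      proof -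
        have "\<bar>(\<sigma> k - \<Phi>) n x\<bar> \<le> real n * (e / (2 * real n))"
          by (rule AA_boundD(4)[OF K[OF that(1)] n that(2)])
        also have "\<dots> < e" using n \<open>e > 0\<close> by simp
        finally show ?thesis by (simp add: dist_real_def)
      qed
      then show "\<forall>\<^sub>F k in sequentially. \<forall>x\<in>X. dist (\<sigma> k n x) (\<Phi> n x) < e"
        by (intro eventually_mono[OF eventually_ge_at_top[of K]]) blast
    qed
    then show "continuous_on X (\<Phi> n)"
      using AA_continuous[OF \<sigma>_AA n] by (intro uniform_limit_theorem[where F=sequentially and f="\<lambda>k. \<sigma> k n"]) auto
  next
    fix \<xi> :: real assume "\<xi> > 0"
    then obtain k where k: "AA_bound X T (\<sigma> k - \<Phi>) (\<xi>/2) (\<xi>/2) (\<xi>/2)"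
      using bound[of "\<xi>/2"] by auto
    have "\<sigma> k \<in> asymp_additive X T"
      using \<sigma>_AA[of k] by (simp add: AA_orb_def)
    \<comment> \<open>One late term \<sigma> k is within n * \<xi>/2 of \<Phi> for all n at once, so
      a function g that approximates \<sigma> k to within \<xi>/2 serves for \<Phi>.\<close>
    with half_gt_zero[OF \<open>\<xi> > 0\<close>] obtain g where g: "continuous_on X g"
      "\<forall>\<^sub>F n in sequentially. \<forall>x\<in>X. \<bar>\<sigma> k n x - birkhoff_sum T g n x\<bar> \<le> real n * (\<xi>/2)"
      unfolding asymp_additive_iff by meson
    have "\<forall>\<^sub>F n in sequentially. \<forall>x\<in>X. \<bar>\<Phi> n x - birkhoff_sum T g n x\<bar> \<le> real n * \<xi>"
      using g(2) eventually_ge_at_top[of 1]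
    proof eventually_elim
      case (elim n)
      show ?case
      proof
        fix x assume "x \<in> X"
        then have "\<bar>(\<sigma> k - \<Phi>) n x\<bar> \<le> real n * (\<xi>/2)"
            "\<bar>\<sigma> k n x - birkhoff_sum T g n x\<bar> \<le> real n * (\<xi>/2)"
          using elim AA_boundD(4)[OF k] by (blast, blast)
        then show "\<bar>\<Phi> n x - birkhoff_sum T g n x\<bar> \<le> real n * \<xi>"
          unfolding minus_apply by argo
      qed
    qed
    then show "\<exists>g. continuous_on X g \<and>
        (\<forall>\<^sub>F n in sequentially. \<forall>x\<in>X. \<bar>\<Phi> n x - birkhoff_sum T g n x\<bar> \<le> real n * \<xi>)"
      using g(1) by blast
  qed
  moreover obtain k where "AA_bound X T (\<sigma> k - \<Phi>) 1 1 1"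
    using bound[of 1] by auto
  \<comment> \<open>Writing \<Phi> as a difference of two sequences with finite bounds gives finite
    defect and Lipschitz constant.\<close>
  then have "AA_bound X T (\<sigma> k - (\<sigma> k - \<Phi>))
      (AA_nm X T (\<sigma> k) + 1) (AA_nm X T (\<sigma> k) + 1) (AA_nm X T (\<sigma> k) + 1)"
    by (intro AA_bound_diff AA_nm_bounds \<sigma>_AA)
  ultimately have "\<Phi> \<in> AA_orb X T"
    using AA_orb_I by simp
  then have "\<Phi> \<in> AA_normal"
    by (auto simp: AA_normal_def \<Phi>_def)
  moreover have "\<forall>\<^sub>F k in sequentially. AA_nm X T (\<sigma> k - \<Phi>) < e" if "e > 0" for e
  proof -
    \<comment> \<open>The norm is the sum of three bounds, and 3 * (e/4) < e.\<close>
    have "e/4 > 0" using that by simp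
    from bound[OF this] obtain K where K: "\<And>k. k \<ge> K \<Longrightarrow> AA_bound X T (\<sigma> k - \<Phi>) (e/4) (e/4) (e/4)"
      by blast
    have "AA_nm X T (\<sigma> k - \<Phi>) < e" if "k \<ge> K" for k
      using AA_bound_nm_le[OF K[OF that]] \<open>e > 0\<close> by simp
    then show ?thesis
      by (intro eventually_mono[OF eventually_ge_at_top[of K]]) blast
  qed
  ultimately show "\<exists>\<Phi>. limitin N.mtopology \<sigma> \<Phi> sequentially"
    unfolding N.limitin_metric using \<sigma>_normal by (intro exI[of _ \<Phi>]) simp
qed

text \<open>By \<open>E.d_le\<close> the class map does not increase distances, hence it is
  continuous.\<close>

lemma openin_class_vimage:
  assumes "openin E.mtopology U"
  shows "openin N.mtopology {\<Phi> \<in> AA_normal. E_class X T \<Phi> \<in> U}"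
  unfolding N.openin_mtopology
proof (intro conjI allI impI)
  fix \<Phi> assume "\<Phi> \<in> {\<Phi> \<in> AA_normal. E_class X T \<Phi> \<in> U}"
  then have \<Phi>: "\<Phi> \<in> AA_normal" "E_class X T \<Phi> \<in> U" by auto
  then obtain r where r: "r > 0" "E.mball (E_class X T \<Phi>) r \<subseteq> U"
    using assms unfolding E.openin_mtopology by blast
  have "E_class X T \<Psi> \<in> U" if "\<Psi> \<in> N.mball \<Phi> r" for \<Psi>
  proof -
    have \<Psi>: "\<Psi> \<in> AA_normal" "AA_nm X T (\<Phi> - \<Psi>) < r" using that by auto
    then have "E_dist X T (E_class X T \<Phi>) (E_class X T \<Psi>) < r"
      using E.d_le[OF AA_normal_AA[OF \<Phi>(1)] AA_normal_AA[OF \<Psi>(1)]] by linarith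
    then have "E_class X T \<Psi> \<in> E.mball (E_class X T \<Phi>) r"
      using \<Phi>(1) \<Psi>(1) by (auto dest: AA_normal_AA)
    then show ?thesis using r by blast
  qed
  then show "\<exists>r>0. N.mball \<Phi> r \<subseteq> {\<Phi> \<in> AA_normal. E_class X T \<Phi> \<in> U}"
    using r(1) by (auto intro!: exI[of _ r])
qed auto

text \<open>The Baire category theorem is applied to the sets of points that lie outside \<open>C i\<close> or in its
  interior; a point in all of these sets lies in the interior of each \<open>C i\<close> that contains it.\<close>

lemma interiors_dense:
  fixes C :: "nat \<Rightarrow> (nat \<Rightarrow> 'a \<Rightarrow> real) set set"
  assumes closed: "\<And>i. closedin E.mtopology (C i)" and cover: "E_orb X T \<subseteq> (\<Union>i. C i)"
  shows "E.mtopology closure_of (\<Union>i. E.mtopology interior_of C i) = E_orb X T"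
proof -
  define G where "G i = {\<Phi> \<in> AA_normal. E_class X T \<Phi> \<in> E_orb X T - C i} \<union>
    {\<Phi> \<in> AA_normal. E_class X T \<Phi> \<in> E.mtopology interior_of C i}" for i
  have class_in: "E_class X T \<Phi> \<in> E_orb X T" if "\<Phi> \<in> AA_orb X T" for \<Phi>
    using that by (simp add: E_orb_eq)
  have "openin N.mtopology (G i) \<and> N.mtopology closure_of (G i) = AA_normal" for i
  proof
    have "openin E.mtopology (E_orb X T - C i)"
      using closed[of i] by (simp add: E_orb_eq closedin_def)
    then show "openin N.mtopology (G i)"
      unfolding G_def by (intro openin_Un openin_class_vimage openin_interior_of)
    have "\<exists>\<Psi>\<in>G i. \<Psi> \<in> N.mball \<Phi> r" if \<Phi>: "\<Phi> \<in> AA_normal" and r: "r > 0" for \<Phi> r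
    proof (rule ccontr)
      assume neg: "\<not> ?thesis"
      \<comment> \<open>Every class in this ball has a normalized representative within r of \<Phi>.
        As \<open>G i\<close> misses the ball around \<Phi>, that class lies in \<open>C i\<close>;
        so the centre is interior to \<open>C i\<close>, which puts \<Phi> itself into
        \<open>G i\<close>.\<close>
      have "E.mball (E_class X T \<Phi>) r \<subseteq> C i"
      proof
        fix \<eta> assume "\<eta> \<in> E.mball (E_class X T \<Phi>) r"
        then obtain \<Psi> where \<Psi>: "\<Psi> \<in> AA_orb X T" "\<eta> = E_class X T \<Psi>" "E_dist X T (E_class X T \<Phi>) \<eta> < r"
          by auto
        then obtain \<Psi>' where \<Psi>': "\<Psi>' \<in> AA_orb X T" "E_class X T \<Psi>' = \<eta>" "AA_nm X T (\<Phi> - \<Psi>') < r"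
          using E.d_lessE[OF AA_normal_AA[OF \<Phi>] \<Psi>(1), of r] by auto
        obtain \<Psi>'' where \<Psi>'': "\<Psi>'' \<in> AA_normal" "E_class X T \<Psi>'' = E_class X T \<Psi>'"
            "\<forall>\<Phi>. AA_nm X T (\<Phi> - \<Psi>'') = AA_nm X T (\<Phi> - \<Psi>')"
          using AA_normal_representative[OF \<Psi>'(1)] .
        have "\<Psi>'' \<in> N.mball \<Phi> r"
          using \<Psi>' \<Psi>'' \<Phi> by simp
        then have "\<Psi>'' \<notin> G i" using neg by blast
        then show "\<eta> \<in> C i"
          using \<Psi>' \<Psi>'' class_in unfolding G_def by auto
      qed
      then have "E_class X T \<Phi> \<in> E.mtopology interior_of C i"
        using AA_normal_AA[OF \<Phi>] r by (auto simp: E.in_interior_of_mball)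
      then have "\<Phi> \<in> G i" using \<Phi> by (simp add: G_def)
      then show False using neg \<Phi> r N.centre_in_mball_iff by blast
    qed
    then show "N.mtopology closure_of (G i) = AA_normal"
      by (auto simp: N.metric_closure_of)
  qed
  then have dense: "N.mtopology closure_of (\<Inter>(range G)) = AA_normal"
    by (intro N.metric_Baire_category mcomplete_AA_normal) auto
  have "\<exists>\<zeta>\<in>\<Union>i. E.mtopology interior_of C i. \<zeta> \<in> E.mball \<eta> r"
    if \<eta>: "\<eta> \<in> E_orb X T" and r: "r > 0" for \<eta> r
  proof -
    obtain \<Phi>0 where "\<Phi>0 \<in> AA_orb X T" "\<eta> = E_class X T \<Phi>0"
      using \<eta> by (auto simp: E_orb_eq)
    then obtain \<Phi> where \<Phi>: "\<Phi> \<in> AA_normal" "\<eta> = E_class X T \<Phi>"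
      by (metis AA_normal_representative)
    then obtain \<Psi> where \<Psi>: "\<Psi> \<in> \<Inter>(range G)" "\<Psi> \<in> N.mball \<Phi> r"
      using dense r unfolding N.metric_closure_of by blast
    then have \<Psi>_in: "\<Psi> \<in> AA_normal" "AA_nm X T (\<Phi> - \<Psi>) < r" by auto
    then obtain i where i: "E_class X T \<Psi> \<in> C i"
      using cover class_in[OF AA_normal_AA] by blast
    then have "E_class X T \<Psi> \<in> E.mtopology interior_of C i"
      using \<Psi>(1) by (auto simp: G_def)
    moreover have "E_dist X T \<eta> (E_class X T \<Psi>) < r"
      using E.d_le[OF AA_normal_AA[OF \<Phi>(1)] AA_normal_AA[OF \<Psi>_in(1)]] \<Psi>_in(2) \<Phi>(2) by simp
    then have "E_class X T \<Psi> \<in> E.mball \<eta> r"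
      using \<Psi>_in \<Phi> by (auto dest: AA_normal_AA)
    ultimately show "\<exists>\<zeta>\<in>\<Union>i. E.mtopology interior_of C i. \<zeta> \<in> E.mball \<eta> r"
      by blast
  qed
  then show ?thesis
    unfolding E.metric_closure_of unfolding E_orb_eq[symmetric] by blast
qed

end

subsection \<open>The lifting metric\<close>

locale compact_subsystem = compact_system +
  fixes Z :: "'a set"
  assumes Z: "closed_invariant X T Z"
begin

lemma Z_subset: "Z \<subseteq> X"
  using Z by (simp add: closed_invariant_def)

sublocale Z: compact_system Z T
proof
  show "compact Z"
    using Z compact by (metis closed_invariant_def closed_Int_compact inf.absorb1)
  show "continuous_on Z T"
    using cont Z_subset by (rule continuous_on_subset)
  show "T ` Z \<subseteq> Z"
    using Z by (simp add: closed_invariant_def)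
qed

lemma AA_restrict:
  assumes "\<Phi> \<in> AA_orb X T"
  shows "\<Phi> \<in> AA_orb Z T"
proof (rule AA_orb_I)
  show "\<Phi> \<in> asymp_additive Z T"
    using assms asymp_additive_subset[OF _ Z_subset] by (simp add: AA_orb_def)
  show "AA_bound Z T \<Phi> (AA_nm X T \<Phi>) (AA_nm X T \<Phi>) (AA_nm X T \<Phi>)"
    by (rule AA_bound_subset[OF AA_nm_bounds[OF assms] Z_subset])
qed

text \<open>Representatives that differ by a null sequence on X differ by one on Z, so all the
  classes that \<open>E_restrict\<close> unites coincide, and the union is over a nonempty set
  because \<Phi> represents its own class.\<close>

lemma E_restrict_class:
  assumes "\<Phi> \<in> AA_orb X T"
  shows "E_restrict Z T (E_class X T \<Phi>) = E_class Z T \<Phi>"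
proof -
  have "E_class Z T \<Psi> = E_class Z T \<Phi>" if "\<Psi> \<in> E_class X T \<Phi>" for \<Psi>
  proof -
    have \<Psi>: "\<Psi> \<in> AA_orb X T" "\<Phi> - \<Psi> \<in> null_seqs Z T"
      using that assms null_seqs_subset[OF _ Z_subset] by (auto simp: E_class_iff)
    then show ?thesis
      using Z.E_class_eq_iff[OF AA_restrict[OF assms] AA_restrict[OF \<Psi>(1)]] by simp
  qed
  then have "(\<Union>\<Psi>\<in>E_class X T \<Phi>. E_class Z T \<Psi>) = (\<Union>\<Psi>\<in>E_class X T \<Phi>. E_class Z T \<Phi>)"
    by (intro SUP_cong refl)
  also have "\<dots> = E_class Z T \<Phi>"
    using E_class_self[OF assms] by blast
  also have "(\<Union>\<Psi>\<in>E_class X T \<Phi>. E_class Z T \<Psi>) = E_restrict Z T (E_class X T \<Phi>)"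
    unfolding E_restrict_def E_class_def by blast
  finally show ?thesis .
qed

lemma E_ext_eq: "E_ext X T Z = E_class Z T ` AA_orb X T"
  unfolding E_ext_def E_orb_eq image_image by (intro image_cong refl E_restrict_class)

text \<open>This gives symmetry of \<open>lift_dist\<close>. The locale \<open>coset_metric\<close>
  asks for symmetry at arbitrary arguments, so \<zeta> is any set of sequences and not only a
  class.\<close>

lemma lift_norm_uminus: "lift_norm X T Z (uminus ` \<zeta>) = lift_norm X T Z \<zeta>"
proof -
  have restrict: "E_restrict Z T (uminus ` \<theta>) = uminus ` E_restrict Z T \<theta>" for \<theta>
  proof -
    have *: "(- \<Phi>, - \<Psi>) \<in> null_rel Z T" if "(\<Phi>, \<Psi>) \<in> null_rel Z T" for \<Phi> \<Psi>
    proof -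
      have "\<Phi> - \<Psi> \<in> AA_orb Z T \<inter> null_seqs Z T" "\<Phi> \<in> AA_orb Z T" "\<Psi> \<in> AA_orb Z T"
        using that by (auto simp: null_rel_def fun_diff_def)
      then have "- \<Phi> - (- \<Psi>) \<in> AA_orb Z T \<inter> null_seqs Z T" "- \<Phi> \<in> AA_orb Z T" "- \<Psi> \<in> AA_orb Z T"
        using Z.AA_uminus Z.null_seqs_uminus[of "\<Phi> - \<Psi>"] Z.AA_uminus[of "\<Phi> - \<Psi>"] by auto
      then show ?thesis by (simp add: null_rel_def fun_diff_def)
    qed
    show ?thesis
    proof safe
      fix \<Psi> assume "\<Psi> \<in> E_restrict Z T (uminus ` \<theta>)"
      then obtain \<Phi> where "\<Phi> \<in> \<theta>" "(- \<Phi>, \<Psi>) \<in> null_rel Z T"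
        by (auto simp: E_restrict_def)
      then have "- \<Psi> \<in> E_restrict Z T \<theta>"
        using *[of "- \<Phi>" \<Psi>] by (auto simp: E_restrict_def)
      then show "\<Psi> \<in> uminus ` E_restrict Z T \<theta>"
        by (metis add.inverse_inverse imageI)
    qed (use * in \<open>auto simp: E_restrict_def\<close>)
  qed
  have E_orb: "uminus ` \<theta> \<in> E_orb X T" if \<theta>: "\<theta> \<in> E_orb X T" for \<theta>
  proof -
    obtain \<Phi> where \<Phi>: "\<Phi> \<in> AA_orb X T" "\<theta> = E_class X T \<Phi>"
      using \<theta> by (auto simp: E_orb_eq)
    have "E_class X T (- \<Phi>) = coset_diff (E_class X T 0) (E_class X T \<Phi>)"
      using coset_diff_E_class[OF AA_zero \<Phi>(1)] by simp
    also have "\<dots> = uminus ` coset_diff (E_class X T \<Phi>) (E_class X T 0)"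
      by (rule coset_diff_commute)
    also have "\<dots> = uminus ` \<theta>"
      using coset_diff_E_class[OF \<Phi>(1) AA_zero] \<Phi> by simp
    finally show ?thesis
      using AA_uminus[OF \<Phi>(1)] by (auto simp: E_orb_eq)
  qed
  have le: "lift_norm X T Z (uminus ` \<zeta>) \<le> lift_norm X T Z \<zeta>" for \<zeta>
    unfolding lift_norm_def
  proof (rule INF_mono)
    fix \<theta> assume "\<theta> \<in> {\<theta> \<in> E_orb X T. E_restrict Z T \<theta> = \<zeta>}"
    then show "\<exists>\<theta>'\<in>{\<theta> \<in> E_orb X T. E_restrict Z T \<theta> = uminus ` \<zeta>}. E_norm X T \<theta>' \<le> E_norm X T \<theta>"
      using E_orb restrict by (intro bexI[of _ "uminus ` \<theta>"]) (auto simp: E_norm_uminus)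
  qed
  \<comment> \<open>Negation is an involution, so one inequality applied twice gives
    equality.\<close>
  have "lift_norm X T Z (uminus ` uminus ` \<zeta>) \<le> lift_norm X T Z (uminus ` \<zeta>)"
    by (rule le)
  then show ?thesis
    using le[of \<zeta>] by (simp add: image_image)
qed

text \<open>The nested infima, over lifts of a class and over representatives of each lift, merge
  into one choice of a sequence on X whose class on Z is prescribed.\<close>

lemma lift_dist_less_iff:
  assumes "\<Phi> \<in> AA_orb X T" "\<Psi> \<in> AA_orb X T"
  shows "lift_dist X T Z (E_class Z T \<Phi>) (E_class Z T \<Psi>) < r \<longleftrightarrow>
    (\<exists>\<Theta>\<in>AA_orb X T. \<Phi> - \<Psi> - \<Theta> \<in> {\<Phi> \<in> AA_orb X T. \<Phi> \<in> null_seqs Z T} \<and> AA_nm X T \<Theta> < r)"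
proof -
  let ?l = "lift_norm X T Z (E_class Z T (\<Phi> - \<Psi>))"
  have D: "\<Phi> - \<Psi> \<in> AA_orb X T"
    by (intro AA_diff assms)
  have less: "?l < s \<longleftrightarrow> (\<exists>\<Theta>\<in>AA_orb X T. \<Phi> - \<Psi> - \<Theta> \<in> null_seqs Z T \<and> AA_norm X T \<Theta> < s)" for s
  proof -
    have "?l < s \<longleftrightarrow> (\<exists>\<theta>. \<theta> \<in> E_orb X T \<and> E_restrict Z T \<theta> = E_class Z T (\<Phi> - \<Psi>) \<and>
        (\<exists>\<Theta>\<in>\<theta>. AA_norm X T \<Theta> < s))"
      by (auto simp: lift_norm_def E_norm_def INF_less_iff)
    also have "\<dots> \<longleftrightarrow> (\<exists>\<Theta>\<in>AA_orb X T. E_class Z T (\<Phi> - \<Psi>) = E_class Z T \<Theta> \<and> AA_norm X T \<Theta> < s)"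
    proof safe
      fix \<theta> \<Theta>
      assume *: "\<theta> \<in> E_orb X T" "E_restrict Z T \<theta> = E_class Z T (\<Phi> - \<Psi>)" "\<Theta> \<in> \<theta>" "AA_norm X T \<Theta> < s"
      then obtain \<Theta>' where \<Theta>': "\<Theta>' \<in> AA_orb X T" "\<theta> = E_class X T \<Theta>'"
        by (auto simp: E_orb_eq)
      then have \<Theta>: "\<Theta> \<in> AA_orb X T" "E_class X T \<Theta>' = E_class X T \<Theta>"
        using *(3) E_class_iff[OF \<Theta>'(1)] E_class_eq_iff[OF \<Theta>'(1)] by auto
      then have "E_class Z T (\<Phi> - \<Psi>) = E_class Z T \<Theta>"
        using *(2) \<Theta>' E_restrict_class[of \<Theta>] by simp
      then show "\<exists>\<Theta>\<in>AA_orb X T. E_class Z T (\<Phi> - \<Psi>) = E_class Z T \<Theta> \<and> AA_norm X T \<Theta> < s"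
        using \<Theta> *(4) by blast
    next
      fix \<Theta> assume "\<Theta> \<in> AA_orb X T" "E_class Z T (\<Phi> - \<Psi>) = E_class Z T \<Theta>" "AA_norm X T \<Theta> < s"
      then show "\<exists>\<theta>. \<theta> \<in> E_orb X T \<and> E_restrict Z T \<theta> = E_class Z T (\<Phi> - \<Psi>) \<and>
          (\<exists>\<Theta>\<in>\<theta>. AA_norm X T \<Theta> < s)"
        using E_class_self E_restrict_class by (intro exI[of _ "E_class X T \<Theta>"]) (auto simp: E_orb_eq)
    qed
    also have "\<dots> \<longleftrightarrow> (\<exists>\<Theta>\<in>AA_orb X T. \<Phi> - \<Psi> - \<Theta> \<in> null_seqs Z T \<and> AA_norm X T \<Theta> < s)"
      by (intro bex_cong refl) (simp add: Z.E_class_eq_iff AA_restrict D)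
    finally show ?thesis .
  qed
  have fin: "?l < \<infinity>"
    unfolding less using D AA_finite[OF D] null_seqs_zero by (intro bexI[of _ "\<Phi> - \<Psi>"]) auto
  have "lift_dist X T Z (E_class Z T \<Phi>) (E_class Z T \<Psi>) < r \<longleftrightarrow> enn2real ?l < r"
    using assms AA_restrict by (simp add: lift_dist_def Z.coset_diff_E_class)
  also have "\<dots> \<longleftrightarrow> ?l < ennreal r"
    using fin by (cases ?l) (auto simp: ennreal_less_iff)
  also have "\<dots> \<longleftrightarrow> (\<exists>\<Theta>\<in>AA_orb X T.
      \<Phi> - \<Psi> - \<Theta> \<in> {\<Phi> \<in> AA_orb X T. \<Phi> \<in> null_seqs Z T} \<and> AA_nm X T \<Theta> < r)"
    unfolding less by (intro bex_cong refl) (simp add: AA_norm_less_iff AA_diff D)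
  finally show ?thesis .
qed

text \<open>The vector space and the norm are those of \<open>E\<close>; only the subgroup grows, to
  the sequences on X that are null on Z. This realizes the extendable space as the quotient by the
  kernel of the restriction.\<close>

sublocale lift: coset_metric "AA_orb X T" "{\<Phi> \<in> AA_orb X T. \<Phi> \<in> null_seqs Z T}" "AA_nm X T"
  "E_class Z T" "lift_dist X T Z"
proof
  show "x \<in> {\<Phi> \<in> AA_orb X T. \<Phi> \<in> null_seqs Z T}"
    if "x \<in> AA_orb X T" "\<And>e. e > 0 \<Longrightarrow>
      \<exists>z\<in>AA_orb X T. x - z \<in> {\<Phi> \<in> AA_orb X T. \<Phi> \<in> null_seqs Z T} \<and> AA_nm X T z < e" for x
    using null_seqs_closed[OF that(1) Z_subset] that by blast
  show "lift_dist X T Z a b = lift_dist X T Z b a" for a b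
    unfolding lift_dist_def using coset_diff_commute[of b a] lift_norm_uminus by metis
  show "0 \<le> lift_dist X T Z a b" for a b
    by (simp add: lift_dist_def)
  show "x \<in> AA_orb X T \<Longrightarrow> y \<in> AA_orb X T \<Longrightarrow>
      (E_class Z T x = E_class Z T y) = (x - y \<in> {\<Phi> \<in> AA_orb X T. \<Phi> \<in> null_seqs Z T})" for x y
    by (simp add: Z.E_class_eq_iff AA_restrict AA_diff)
  show "x \<in> AA_orb X T \<Longrightarrow> y \<in> AA_orb X T \<Longrightarrow> lift_dist X T Z (E_class Z T x) (E_class Z T y) < r \<longleftrightarrow>
    (\<exists>z\<in>AA_orb X T. x - y - z \<in> {\<Phi> \<in> AA_orb X T. \<Phi> \<in> null_seqs Z T} \<and> AA_nm X T z < r)" for x y r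
    by (rule lift_dist_less_iff)
qed (simp_all add: AA_zero AA_diff null_seqs_zero null_seqs_diff AA_nm_zero AA_nm_diff)

lemma lift_topology_eq: "lift_topology X T Z = lift.mtopology"
  by (simp add: lift_topology_def E_ext_eq)

end

subsection \<open>Mean values along invariant measures\<close>

text \<open>Comparing a (k * n) with both k * a n and n * a k shows that the averages at k and n
  differ by at most D / k + D / n. This gives the Cauchy property, and letting k tend to infinity
  gives an error bound that does not grow with n.\<close>

lemma quasi_additive_limit:
  fixes a :: "nat \<Rightarrow> real"
  assumes D: "\<And>n m. n \<ge> 1 \<Longrightarrow> m \<ge> 1 \<Longrightarrow> \<bar>a (n + m) - a n - a m\<bar> \<le> D"
  obtains L where "(\<lambda>n. a n / real n) \<longlonglongrightarrow> L" "\<And>n. n \<ge> 1 \<Longrightarrow> \<bar>a n - real n * L\<bar> \<le> D"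
proof -
  have D0: "0 \<le> D"
    using D[of 1 1] by linarith
  \<comment> \<open>Indexing by \<open>Suc k\<close> avoids a 0, which is unconstrained; joining
    \<open>Suc k\<close> blocks takes k joins.\<close>
  have mult: "\<bar>a (Suc k * n) - real (Suc k) * a n\<bar> \<le> real k * D" if n: "n \<ge> 1" for k n
  proof (induction k)
    case (Suc k)
    have "\<bar>a (n + Suc k * n) - a n - a (Suc k * n)\<bar> \<le> D"
      using n by (intro D) auto
    then show ?case
      using Suc by (simp add: algebra_simps)
  qed simp
  have quot: "\<bar>a (k * n) / real (k * n) - a n / real n\<bar> \<le> D / real n" if kn: "k \<ge> 1" "n \<ge> 1" for k n
  proof -
    have "\<bar>a (k * n) - real k * a n\<bar> \<le> real (k - 1) * D"
      using mult[OF kn(2), of "k - 1"] kn(1) by simp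
    also have "\<dots> \<le> real k * D"
      using D0 by (intro mult_right_mono) auto
    finally have "\<bar>a (k * n) - real k * a n\<bar> / real (k * n) \<le> real k * D / real (k * n)"
      by (rule divide_right_mono) simp
    moreover have "\<bar>a (k * n) - real k * a n\<bar> / real (k * n) = \<bar>a (k * n) / real (k * n) - a n / real n\<bar>"
    proof -
      have "a (k * n) / real (k * n) - a n / real n = (a (k * n) - real k * a n) / real (k * n)"
        using kn by (simp add: diff_divide_distrib)
      then show ?thesis by (simp add: abs_divide)
    qed
    ultimately show ?thesis
      using kn by simp
  qed
  have compare: "\<bar>a k / real k - a n / real n\<bar> \<le> D / real k + D / real n" if "k \<ge> 1" "n \<ge> 1" for k n
    using quot[OF that] quot[OF that(2) that(1)] unfolding mult.commute[of n k] by linarith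
  have "Cauchy (\<lambda>n. a n / real n)"
    unfolding Cauchy_iff
  proof (intro allI impI)
    fix e :: real assume "e > 0"
    obtain K where K: "real K > 2 * D / e"
      using reals_Archimedean2 by blast
    have small: "D / real n < e / 2" if "n \<ge> max 1 K" for n
    proof -
      have "2 * D / e < real n" "real n > 0"
        using K that by auto
      then show ?thesis
        using \<open>e > 0\<close> by (simp add: field_simps)
    qed
    have "norm (a k / real k - a n / real n) < e" if "k \<ge> max 1 K" "n \<ge> max 1 K" for k n
    proof -
      have "k \<ge> 1" "n \<ge> 1" using that by auto
      from compare[OF this] show ?thesis
        using small[OF that(1)] small[OF that(2)] unfolding real_norm_def by argo
    qed
    then show "\<exists>M. \<forall>m\<ge>M. \<forall>n\<ge>M. norm (a m / real m - a n / real n) < e"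
      by blast
  qed
  then obtain L where L: "(\<lambda>n. a n / real n) \<longlonglongrightarrow> L"
    by (auto simp: Cauchy_convergent_iff convergent_def)
  have "\<bar>a n - real n * L\<bar> \<le> D" if n: "n \<ge> 1" for n
  proof -
    have "\<bar>L - a n / real n\<bar> \<le> 0 + D / real n"
    proof (rule tendsto_le[OF sequentially_bot])
      show "(\<lambda>k. D / real k + D / real n) \<longlonglongrightarrow> 0 + D / real n"
        by (intro tendsto_add tendsto_const lim_const_over_n)
      show "(\<lambda>k. \<bar>a k / real k - a n / real n\<bar>) \<longlonglongrightarrow> \<bar>L - a n / real n\<bar>"
        by (intro tendsto_intros L)
      show "\<forall>\<^sub>F k in sequentially. \<bar>a k / real k - a n / real n\<bar> \<le> D / real k + D / real n"
        by (rule eventually_mono[OF eventually_ge_at_top[of 1]]) (use compare n in simp)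
    qed
    then have "real n * \<bar>L - a n / real n\<bar> \<le> D"
      using n by (simp add: field_simps)
    moreover have "real n * \<bar>L - a n / real n\<bar> = \<bar>real n * (L - a n / real n)\<bar>"
      by (simp add: abs_mult)
    moreover have "real n * (L - a n / real n) = real n * L - a n"
      using n by (simp add: field_simps)
    ultimately show ?thesis
      by (simp add: abs_minus_commute)
  qed
  with L show thesis by (rule that)
qed

text \<open>The value that \<open>E_star\<close> assigns to the class of \<Phi>, by
  \<open>E_star_eq\<close>, but expressed through one representative so that estimates can be made
  on it.\<close>

definition mean_value :: "'a::metric_space set \<Rightarrow> (nat \<Rightarrow> 'a \<Rightarrow> real) \<Rightarrow> 'a measure \<Rightarrow> real" where
  "mean_value X \<Phi> \<mu> = lim (\<lambda>n. (LINT x:X|\<mu>. \<Phi> n x) / real n)"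

section \<open>Integration against an invariant measure\<close>

context compact_system
begin

lemma X_borel: "X \<in> sets borel"
  using compact by (intro borel_closed compact_imp_closed)

lemma vimage_borel: "A \<in> sets borel \<Longrightarrow> T -` A \<inter> X \<in> sets borel"
  using measurable_sets[OF borel_measurable_continuous_on_restrict[OF cont], of A] X_borel
  by (simp add: space_restrict_space sets_restrict_space_iff)

lemma continuous_on_comp_funpow:
  "continuous_on X f \<Longrightarrow> continuous_on X (\<lambda>x. f ((T ^^ n) x))"
  using funpow_in by (intro continuous_on_compose2[OF _ continuous_on_funpow]) auto

context
  fixes \<mu> :: "'a measure"
  assumes \<mu>: "\<mu> \<in> invariant_measures X T"
begin

lemma inv_prob: "prob_space \<mu>" and inv_sets [measurable_cong]: "sets \<mu> = sets borel"
  and inv_space: "space \<mu> = UNIV"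
  and inv_X: "emeasure \<mu> X = 1"
  and inv_vimage: "A \<in> sets borel \<Longrightarrow> emeasure \<mu> (T -` A \<inter> X) = emeasure \<mu> A"
  using \<mu> sets_eq_imp_space_eq[of \<mu> borel] by (auto simp: invariant_measures_def)

lemma inv_AE: "AE x in \<mu>. x \<in> X"
proof -
  interpret prob_space \<mu> by (rule inv_prob)
  show ?thesis
    using inv_X by (intro AE_prob_1) (simp add: measure_def)
qed

lemma cont_integrable:
  assumes "continuous_on X f"
  shows "set_integrable \<mu> X (f :: 'a \<Rightarrow> real)"
proof -
  interpret prob_space \<mu> by (rule inv_prob)
  have "bounded (f ` X)"
    using assms compact by (intro compact_imp_bounded compact_continuous_image)
  then obtain B where "\<And>x. x \<in> X \<Longrightarrow> \<bar>f x\<bar> \<le> B"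
    by (auto simp: bounded_iff)
  then have "AE x in \<mu>. norm (indicator X x *\<^sub>R f x) \<le> B"
    using inv_AE by (auto elim!: eventually_mono)
  moreover have "(\<lambda>x. indicator X x *\<^sub>R f x) \<in> borel_measurable \<mu>"
    using borel_measurable_continuous_on_indicator[OF X_borel assms] inv_sets
    by (simp cong: measurable_cong_sets)
  ultimately show ?thesis
    unfolding set_integrable_def by (rule integrable_const_bound)
qed

lemma integral_const: "(LINT x:X|\<mu>. c) = (c :: real)"
  using inv_X X_borel inv_sets by (subst set_integral_const) (auto simp: measure_def)

lemma integral_upper:
  assumes "continuous_on X f" "\<And>x. x \<in> X \<Longrightarrow> f x \<le> c"
  shows "(LINT x:X|\<mu>. f x) \<le> (c :: real)"
  using set_integral_mono[OF cont_integrable[OF assms(1)] cont_integrable[OF continuous_on_const] assms(2)]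
  by (simp add: integral_const)

lemma integral_abs_bound:
  assumes "continuous_on X f" "\<And>x. x \<in> X \<Longrightarrow> \<bar>f x\<bar> \<le> c"
  shows "\<bar>LINT x:X|\<mu>. f x\<bar> \<le> (c :: real)"
proof -
  have "(LINT x:X|\<mu>. f x) \<le> c"
    using assms by (intro integral_upper) (auto simp: abs_le_iff)
  moreover have "(LINT x:X|\<mu>. - f x) \<le> c"
    using assms by (intro integral_upper continuous_on_minus) (auto simp: abs_le_iff)
  ultimately show ?thesis
    using set_integral_uminus[OF cont_integrable[OF assms(1)]] by (simp add: abs_le_iff)
qed

lemma integral_comp_T:
  assumes f: "continuous_on X f"
  shows "(LINT x:X|\<mu>. f (T x)) = (LINT x:X|\<mu>. (f x :: real))"
proof -
  \<comment> \<open>T is constrained only on X and need not be measurable elsewhere. Replacing it by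
    the identity off X, a null set, makes it a measure-preserving map of the ambient space.\<close>
  define T' where "T' x = (if x \<in> X then T x else x)" for x
  have vimage: "T' -` A = (T -` A \<inter> X) \<union> (A - X)" for A
    by (auto simp: T'_def split: if_splits)
  have T': "T' \<in> measurable \<mu> \<mu>"
  proof (rule measurableI)
    fix A assume "A \<in> sets \<mu>"
    then show "T' -` A \<inter> space \<mu> \<in> sets \<mu>"
      using vimage_borel X_borel inv_sets by (simp add: vimage inv_space)
  qed (simp add: inv_space)
  have "distr \<mu> \<mu> T' = \<mu>"
  proof (rule measure_eqI)
    fix A assume "A \<in> sets (distr \<mu> \<mu> T')"
    then have A: "A \<in> sets borel" using inv_sets by simp
    then have "emeasure (distr \<mu> \<mu> T') A = emeasure \<mu> ((T -` A \<inter> X) \<union> (A - X))"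
      using T' inv_sets by (simp add: emeasure_distr vimage inv_space)
    also have "\<dots> = emeasure \<mu> (T -` A \<inter> X)"
      using A vimage_borel X_borel inv_sets inv_AE by (intro emeasure_eq_AE) (auto elim!: eventually_mono)
    finally show "emeasure (distr \<mu> \<mu> T') A = emeasure \<mu> A"
      using inv_vimage[OF A] by simp
  qed simp
  then have "(LINT x:X|\<mu>. f x) = integral\<^sup>L (distr \<mu> \<mu> T') (\<lambda>x. indicator X x *\<^sub>R f x)"
    by (simp add: set_lebesgue_integral_def)
  also have "\<dots> = (\<integral>x. indicator X (T' x) *\<^sub>R f (T' x) \<partial>\<mu>)"
    using cont_integrable[OF f] unfolding set_integrable_def by (intro integral_distr T') auto
  also have "\<dots> = (LINT x:X|\<mu>. f (T x))"
    unfolding set_lebesgue_integral_def using invariant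
    by (intro Bochner_Integration.integral_cong) (auto simp: T'_def split: split_indicator)
  finally show ?thesis by simp
qed

lemma integral_comp_funpow:
  assumes "continuous_on X f"
  shows "(LINT x:X|\<mu>. f ((T ^^ n) x)) = (LINT x:X|\<mu>. (f x :: real))"
proof (induction n)
  case (Suc n)
  have "(LINT x:X|\<mu>. f ((T ^^ n) (T x))) = (LINT x:X|\<mu>. f ((T ^^ n) x))"
    by (intro integral_comp_T continuous_on_comp_funpow assms)
  then show ?case
    using Suc by (simp add: funpow_swap1)
qed simp

text \<open>Invariance removes the shift by T ^^ n under the integral, so the integrals form an
  almost additive sequence of numbers, to which \<open>quasi_additive_limit\<close> applies.\<close>

lemma integral_defect:
  assumes \<Phi>: "\<Phi> \<in> AA_orb X T" and nm: "n \<ge> 1" "m \<ge> 1"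
  shows "\<bar>(LINT x:X|\<mu>. \<Phi> (n + m) x) - (LINT x:X|\<mu>. \<Phi> n x) - (LINT x:X|\<mu>. \<Phi> m x)\<bar> \<le> AA_nm X T \<Phi>"
proof -
  have c: "continuous_on X (\<Phi> (n + m))" "continuous_on X (\<Phi> n)" "continuous_on X (\<Phi> m)"
    using nm by (auto intro: AA_continuous[OF \<Phi>])
  note c' = continuous_on_comp_funpow[OF c(3), of n]
  have "\<bar>LINT x:X|\<mu>. \<Phi> (n + m) x - \<Phi> n x - \<Phi> m ((T ^^ n) x)\<bar> \<le> AA_nm X T \<Phi>"
    by (intro integral_abs_bound continuous_on_diff c c' AA_boundD(5)[OF AA_nm_bounds[OF \<Phi>] nm])
  then show ?thesis
    using cont_integrable[OF c(1)] cont_integrable[OF c(2)] cont_integrable[OF c']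
    by (simp add: set_integral_diff integral_comp_funpow[OF c(3)])
qed

text \<open>The error in the second clause is uniform in n; \<open>locking_inequality\<close> uses
  this to bound \<Phi> n on the periodic orbit by n times the mean plus a constant.\<close>

lemma mean_value_limit:
  assumes "\<Phi> \<in> AA_orb X T"
  shows "(\<lambda>n. (LINT x:X|\<mu>. \<Phi> n x) / real n) \<longlonglongrightarrow> mean_value X \<Phi> \<mu>"
    and "n \<ge> 1 \<Longrightarrow> \<bar>(LINT x:X|\<mu>. \<Phi> n x) - real n * mean_value X \<Phi> \<mu>\<bar> \<le> AA_nm X T \<Phi>"
proof -
  obtain L where L: "(\<lambda>n. (LINT x:X|\<mu>. \<Phi> n x) / real n) \<longlonglongrightarrow> L"
    "\<And>n. n \<ge> 1 \<Longrightarrow> \<bar>(LINT x:X|\<mu>. \<Phi> n x) - real n * L\<bar> \<le> AA_nm X T \<Phi>"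
    using quasi_additive_limit[of "\<lambda>n. LINT x:X|\<mu>. \<Phi> n x", OF integral_defect[OF assms]] by blast
  then have "mean_value X \<Phi> \<mu> = L"
    by (simp add: mean_value_def limI)
  with L show "(\<lambda>n. (LINT x:X|\<mu>. \<Phi> n x) / real n) \<longlonglongrightarrow> mean_value X \<Phi> \<mu>"
    "n \<ge> 1 \<Longrightarrow> \<bar>(LINT x:X|\<mu>. \<Phi> n x) - real n * mean_value X \<Phi> \<mu>\<bar> \<le> AA_nm X T \<Phi>"
    by auto
qed

lemma mean_value_diff:
  assumes "\<Phi> \<in> AA_orb X T" "\<Psi> \<in> AA_orb X T"
  shows "mean_value X (\<Phi> - \<Psi>) \<mu> = mean_value X \<Phi> \<mu> - mean_value X \<Psi> \<mu>"
proof (rule LIMSEQ_unique)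
  show "(\<lambda>n. (LINT x:X|\<mu>. (\<Phi> - \<Psi>) n x) / real n) \<longlonglongrightarrow> mean_value X (\<Phi> - \<Psi>) \<mu>"
    by (intro mean_value_limit AA_diff assms)
  have "(\<lambda>n. (LINT x:X|\<mu>. \<Phi> n x) / real n - (LINT x:X|\<mu>. \<Psi> n x) / real n)
      \<longlonglongrightarrow> mean_value X \<Phi> \<mu> - mean_value X \<Psi> \<mu>"
    by (intro tendsto_diff mean_value_limit assms)
  moreover have "\<forall>\<^sub>F n in sequentially. (LINT x:X|\<mu>. \<Phi> n x) / real n - (LINT x:X|\<mu>. \<Psi> n x) / real n =
      (LINT x:X|\<mu>. (\<Phi> - \<Psi>) n x) / real n"
  proof (rule eventually_mono[OF eventually_ge_at_top[of 1]])
    fix n :: nat assume "1 \<le> n"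
    then have "set_integrable \<mu> X (\<Phi> n)" "set_integrable \<mu> X (\<Psi> n)"
      using assms by (auto intro!: cont_integrable AA_continuous)
    then show "(LINT x:X|\<mu>. \<Phi> n x) / real n - (LINT x:X|\<mu>. \<Psi> n x) / real n =
        (LINT x:X|\<mu>. (\<Phi> - \<Psi>) n x) / real n"
      by (simp add: set_integral_diff diff_divide_distrib)
  qed
  ultimately show "(\<lambda>n. (LINT x:X|\<mu>. (\<Phi> - \<Psi>) n x) / real n)
      \<longlonglongrightarrow> mean_value X \<Phi> \<mu> - mean_value X \<Psi> \<mu>"
    by (rule Lim_transform_eventually)
qed

lemma mean_value_upper:
  assumes \<Phi>: "\<Phi> \<in> AA_orb X T" and
    le: "\<forall>\<^sub>F n in sequentially. \<forall>x\<in>X. \<bar>\<Phi> n x\<bar> \<le> real n * c"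
  shows "\<bar>mean_value X \<Phi> \<mu>\<bar> \<le> c"
proof (rule tendsto_upperbound)
  show "(\<lambda>n. \<bar>(LINT x:X|\<mu>. \<Phi> n x) / real n\<bar>) \<longlonglongrightarrow> \<bar>mean_value X \<Phi> \<mu>\<bar>"
    by (intro tendsto_rabs mean_value_limit \<Phi>)
  show "\<forall>\<^sub>F n in sequentially. \<bar>(LINT x:X|\<mu>. \<Phi> n x) / real n\<bar> \<le> c"
    using le eventually_ge_at_top[of 1]
  proof eventually_elim
    case (elim n)
    then have "\<bar>LINT x:X|\<mu>. \<Phi> n x\<bar> \<le> real n * c"
      by (intro integral_abs_bound AA_continuous \<Phi>) auto
    then show ?case
      using elim by (simp add: abs_divide field_simps)
  qed
qed simp

lemma mean_value_bound:
  assumes "\<Phi> \<in> AA_orb X T"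
  shows "\<bar>mean_value X \<Phi> \<mu>\<bar> \<le> AA_nm X T \<Phi>"
  by (rule mean_value_upper[OF assms], rule eventually_mono[OF eventually_ge_at_top[of 1]])
     (use AA_nm_size[OF assms] in simp)

lemma mean_value_null:
  assumes "\<Phi> \<in> AA_orb X T" "\<Phi> \<in> null_seqs X T"
  shows "mean_value X \<Phi> \<mu> = 0"
proof -
  have "\<bar>mean_value X \<Phi> \<mu>\<bar> \<le> e" if "e > 0" for e
    using assms(2) that by (intro mean_value_upper assms) (auto simp: null_seqs_iff)
  then show ?thesis
    by (metis abs_le_zero_iff field_le_epsilon add_0)
qed

lemma E_star_eq:
  assumes \<Phi>: "\<Phi> \<in> AA_orb X T"
  shows "E_star X (E_class X T \<Phi>) \<mu> = mean_value X \<Phi> \<mu>"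
  unfolding E_star_def
proof (rule the_equality)
  show "\<forall>\<Psi>\<in>E_class X T \<Phi>. (\<lambda>n. (LINT x:X|\<mu>. \<Psi> n x) / real n) \<longlonglongrightarrow> mean_value X \<Phi> \<mu>"
  proof
    fix \<Psi> assume "\<Psi> \<in> E_class X T \<Phi>"
    then have \<Psi>: "\<Psi> \<in> AA_orb X T" "\<Phi> - \<Psi> \<in> null_seqs X T"
      using E_class_iff[OF \<Phi>] by auto
    then have "mean_value X \<Psi> \<mu> = mean_value X \<Phi> \<mu>"
      using mean_value_null[OF AA_diff[OF \<Phi> \<Psi>(1)] \<Psi>(2)] mean_value_diff[OF \<Phi> \<Psi>(1)] by simp
    then show "(\<lambda>n. (LINT x:X|\<mu>. \<Psi> n x) / real n) \<longlonglongrightarrow> mean_value X \<Phi> \<mu>"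
      using mean_value_limit(1)[OF \<Psi>(1)] by simp
  qed
next
  fix r assume "\<forall>\<Psi>\<in>E_class X T \<Phi>. (\<lambda>n. (LINT x:X|\<mu>. \<Psi> n x) / real n) \<longlonglongrightarrow> r"
  then show "r = mean_value X \<Phi> \<mu>"
    using LIMSEQ_unique mean_value_limit(1)[OF \<Phi>] E_class_self[OF \<Phi>] by blast
qed

lemma integral_birkhoff_sum:
  assumes "continuous_on X g"
  shows "(LINT x:X|\<mu>. birkhoff_sum T g n x) = real n * (LINT x:X|\<mu>. g x)"
proof (induction n)
  case 0
  then show ?case using integral_const[of 0] by (simp add: birkhoff_sum_def)
next
  case (Suc n)
  have "continuous_on X (\<lambda>x. birkhoff_sum T g n x)"
    unfolding birkhoff_sum_def by (intro continuous_on_sum continuous_on_comp_funpow assms)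
  then have "(LINT x:X|\<mu>. birkhoff_sum T g n x + g ((T ^^ n) x)) =
      real n * (LINT x:X|\<mu>. g x) + (LINT x:X|\<mu>. g x)"
    using Suc cont_integrable continuous_on_comp_funpow[OF assms, of n]
    by (subst set_integral_add) (auto simp: integral_comp_funpow[OF assms])
  then show ?case
    by (simp add: birkhoff_sum_def distrib_right)
qed

lemma mean_value_birkhoff_sum:
  assumes "continuous_on X g"
  shows "mean_value X (birkhoff_sum T g) \<mu> = (LINT x:X|\<mu>. g x)"
  unfolding mean_value_def
proof (rule limI, rule Lim_transform_eventually[OF tendsto_const])
  show "\<forall>\<^sub>F n in sequentially. (LINT x:X|\<mu>. g x) = (LINT x:X|\<mu>. birkhoff_sum T g n x) / real n"
    by (rule eventually_mono[OF eventually_ge_at_top[of 1]]) (simp add: integral_birkhoff_sum[OF assms])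
qed

text \<open>A nonnegative function with integral 0 vanishes almost everywhere, and for closed A the
  distance vanishes only on A. For empty A, \<open>infdist\<close> is 0 by convention, so A must be
  nonempty.\<close>

lemma integral_infdist_eq_0:
  assumes "closed A" "A \<noteq> {}" "(LINT x:X|\<mu>. infdist x A) = 0"
  shows "emeasure \<mu> A = 1"
proof -
  interpret prob_space \<mu> by (rule inv_prob)
  have "continuous_on X (\<lambda>x. infdist x A)"
    by (intro continuous_on_infdist continuous_on_id)
  then have "integrable \<mu> (\<lambda>x. indicator X x *\<^sub>R infdist x A)"
    using cont_integrable unfolding set_integrable_def by blast
  then have "AE x in \<mu>. indicator X x *\<^sub>R infdist x A = 0"
    using assms(3) infdist_nonneg unfolding set_lebesgue_integral_def
    by (subst (asm) integral_nonneg_eq_0_iff_AE) (auto intro!: AE_I2 mult_nonneg_nonneg infdist_nonneg)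
  then have "AE x in \<mu>. x \<in> A"
    using inv_AE
  proof eventually_elim
    case (elim x)
    then show ?case using in_closed_iff_infdist_zero[OF assms(1,2), of x] by simp
  qed
  then show ?thesis
    using assms(1) inv_sets by (intro emeasure_eq_1_AE) auto
qed

end

text \<open>Birkhoff sums are exactly additive, so the defect contributes nothing to the norm; size
  and Lipschitz bounds are inherited termwise from g.\<close>

lemma birkhoff_sum_AA:
  assumes g: "\<And>x y. x \<in> X \<Longrightarrow> y \<in> X \<Longrightarrow> \<bar>g x - g y\<bar> \<le> c * dist x y" "0 \<le> c"
    and a: "\<And>x. x \<in> X \<Longrightarrow> \<bar>g x\<bar> \<le> a" "0 \<le> a"
  shows "birkhoff_sum T g \<in> AA_orb X T" "AA_nm X T (birkhoff_sum T g) \<le> a + c"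
proof -
  have cont_g: "continuous_on X g"
    unfolding continuous_on_iff
  proof (intro ballI allI impI)
    fix x e assume "x \<in> X" "e > (0::real)"
    show "\<exists>d>0. \<forall>x'\<in>X. dist x' x < d \<longrightarrow> dist (g x') (g x) < e"
    \<comment> \<open>Dividing by c + 1 covers the case c = 0.\<close>
    proof (intro exI[of _ "e / (c + 1)"] conjI ballI impI)
      fix x' assume x': "x' \<in> X" "dist x' x < e / (c + 1)"
      have "dist (g x') (g x) \<le> c * dist x' x"
        using g(1)[OF x'(1) \<open>x \<in> X\<close>] by (simp add: dist_real_def)
      also have "\<dots> \<le> (c + 1) * dist x' x"
        by (intro mult_right_mono) auto
      also have "\<dots> < e"
        using x'(2) g(2) by (simp add: field_simps)
      finally show "dist (g x') (g x) < e" .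
    qed (use \<open>e > 0\<close> g(2) in simp)
  qed
  have add: "birkhoff_sum T g (n + m) x = birkhoff_sum T g n x + birkhoff_sum T g m ((T ^^ n) x)" for n m x
  proof (induction m)
    case (Suc m)
    have "(T ^^ (n + m)) x = (T ^^ m) ((T ^^ n) x)"
      by (metis add.commute comp_apply funpow_add)
    then show ?case using Suc by (simp add: birkhoff_sum_def)
  qed (simp add: birkhoff_sum_def)
  have "\<bar>birkhoff_sum T g n x\<bar> \<le> real n * a" if "x \<in> X" for n x
  proof -
    have "\<bar>birkhoff_sum T g n x\<bar> \<le> (\<Sum>j<n. \<bar>g ((T ^^ j) x)\<bar>)"
      unfolding birkhoff_sum_def by (rule sum_abs)
    also have "\<dots> \<le> (\<Sum>j<n. a)"
      using a(1) funpow_in that by (intro sum_mono) auto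
    finally show ?thesis by simp
  qed
  moreover have "\<bar>birkhoff_sum T g n x - birkhoff_sum T g n y\<bar> \<le> c * (\<Sum>j<n. dist ((T ^^ j) x) ((T ^^ j) y))"
    if "x \<in> X" "y \<in> X" for n x y
  proof -
    have "\<bar>birkhoff_sum T g n x - birkhoff_sum T g n y\<bar> \<le> (\<Sum>j<n. \<bar>g ((T ^^ j) x) - g ((T ^^ j) y)\<bar>)"
      unfolding birkhoff_sum_def sum_subtractf[symmetric] by (rule sum_abs)
    also have "\<dots> \<le> (\<Sum>j<n. c * dist ((T ^^ j) x) ((T ^^ j) y))"
      using g(1) funpow_in that by (intro sum_mono) auto
    finally show ?thesis by (simp add: sum_distrib_left)
  qed
  ultimately have B: "AA_bound X T (birkhoff_sum T g) a 0 c"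
    using a(2) g(2) add by (simp add: AA_bound_def)
  have "birkhoff_sum T g \<in> asymp_additive X T"
    unfolding asymp_additive_iff
  proof (intro conjI allI impI)
    show "continuous_on X (birkhoff_sum T g n)" for n
    proof -
      have "continuous_on X (\<lambda>x. \<Sum>j<n. g ((T ^^ j) x))"
        using funpow_in by (intro continuous_on_sum continuous_on_compose2[OF cont_g continuous_on_funpow]) auto
      then show ?thesis by (simp add: birkhoff_sum_def[abs_def])
    qed
    show "\<exists>h. continuous_on X h \<and> (\<forall>\<^sub>F n in sequentially. \<forall>x\<in>X.
        \<bar>birkhoff_sum T g n x - birkhoff_sum T h n x\<bar> \<le> real n * \<xi>)" if "\<xi> > 0" for \<xi>
      using that cont_g by (intro exI[of _ g]) simp
  qed
  then show "birkhoff_sum T g \<in> AA_orb X T"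
    using B by (rule AA_orb_I)
  show "AA_nm X T (birkhoff_sum T g) \<le> a + c"
    using AA_bound_nm_le[OF B] by simp
qed

end

section \<open>Invariant measures of a subsystem within the whole system\<close>

context compact_subsystem
begin

text \<open>When \<mu> is concentrated on Z, the preimages of A within Z and within X differ by a
  null set, so invariance passes from X to Z. The extension lemma below uses the same observation in
  the other direction.\<close>

lemma invariant_measures_restrict:
  assumes \<mu>: "\<mu> \<in> invariant_measures X T" and "emeasure \<mu> Z = 1"
  shows "\<mu> \<in> invariant_measures Z T"
proof -
  interpret prob_space \<mu> by (rule inv_prob[OF \<mu>])
  have AE: "AE x in \<mu>. x \<in> Z"
    using assms(2) by (intro AE_prob_1) (simp add: measure_def)
  have "emeasure \<mu> (T -` A \<inter> Z) = emeasure \<mu> A" if A: "A \<in> sets borel" for A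
  proof -
    have "emeasure \<mu> (T -` A \<inter> Z) = emeasure \<mu> (T -` A \<inter> X)"
    proof (rule emeasure_eq_AE)
      show "AE x in \<mu>. x \<in> T -` A \<inter> Z \<longleftrightarrow> x \<in> T -` A \<inter> X"
        using AE by eventually_elim (use Z_subset in auto)
    qed (use vimage_borel[OF A] Z.vimage_borel[OF A] inv_sets[OF \<mu>] in auto)
    then show ?thesis
      using inv_vimage[OF \<mu> A] by simp
  qed
  then show ?thesis
    using assms inv_sets[OF \<mu>] prob_space_axioms by (simp add: invariant_measures_def)
qed

lemma invariant_measures_extend:
  assumes \<mu>: "\<mu> \<in> invariant_measures Z T"
  shows "\<mu> \<in> invariant_measures X T"
proof -
  interpret prob_space \<mu> by (rule Z.inv_prob[OF \<mu>])
  note AE = Z.inv_AE[OF \<mu>]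
  have AE_X: "AE x in \<mu>. x \<in> X"
    using AE by eventually_elim (use Z_subset in auto)
  have "emeasure \<mu> (T -` A \<inter> X) = emeasure \<mu> A" if A: "A \<in> sets borel" for A
  proof -
    have "emeasure \<mu> (T -` A \<inter> Z) = emeasure \<mu> (T -` A \<inter> X)"
    proof (rule emeasure_eq_AE)
      show "AE x in \<mu>. x \<in> T -` A \<inter> Z \<longleftrightarrow> x \<in> T -` A \<inter> X"
        using AE by eventually_elim (use Z_subset in auto)
    qed (use vimage_borel[OF A] Z.vimage_borel[OF A] Z.inv_sets[OF \<mu>] in auto)
    then show ?thesis
      using Z.inv_vimage[OF \<mu> A] by simp
  qed
  moreover have "emeasure \<mu> X = 1"
    using AE_X X_borel Z.inv_sets[OF \<mu>] by (intro emeasure_eq_1_AE) auto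
  ultimately show ?thesis
    using Z.inv_sets[OF \<mu>] prob_space_axioms by (simp add: invariant_measures_def)
qed

lemma mean_value_restrict:
  assumes \<mu>: "\<mu> \<in> invariant_measures Z T" and \<Phi>: "\<Phi> \<in> AA_orb X T"
  shows "mean_value Z \<Phi> \<mu> = mean_value X \<Phi> \<mu>"
proof (rule LIMSEQ_unique)
  note \<mu>X = invariant_measures_extend[OF \<mu>]
  show "(\<lambda>n. (LINT x:Z|\<mu>. \<Phi> n x) / real n) \<longlonglongrightarrow> mean_value Z \<Phi> \<mu>"
    by (rule Z.mean_value_limit(1)[OF \<mu> AA_restrict[OF \<Phi>]])
  have "\<forall>\<^sub>F n in sequentially. (LINT x:X|\<mu>. \<Phi> n x) / real n = (LINT x:Z|\<mu>. \<Phi> n x) / real n"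
  proof (rule eventually_mono[OF eventually_ge_at_top[of 1]])
    fix n :: nat assume "1 \<le> n"
    then have c: "continuous_on X (\<Phi> n)" "continuous_on Z (\<Phi> n)"
      using AA_continuous[OF \<Phi>] continuous_on_subset[OF _ Z_subset] by auto
    have "(LINT x:X|\<mu>. \<Phi> n x) = (LINT x:Z|\<mu>. \<Phi> n x)"
    proof (rule set_integral_cong_set)
      show "set_borel_measurable \<mu> X (\<Phi> n)"
        using cont_integrable[OF \<mu>X c(1)] unfolding set_integrable_def set_borel_measurable_def
        by (rule borel_measurable_integrable)
      show "set_borel_measurable \<mu> Z (\<Phi> n)"
        using Z.cont_integrable[OF \<mu> c(2)] unfolding set_integrable_def set_borel_measurable_def
        by (rule borel_measurable_integrable)
      show "AE x in \<mu>. x \<in> Z \<longleftrightarrow> x \<in> X"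
        using Z.inv_AE[OF \<mu>] by eventually_elim (use Z_subset in auto)
    qed
    then show "(LINT x:X|\<mu>. \<Phi> n x) / real n = (LINT x:Z|\<mu>. \<Phi> n x) / real n" by simp
  qed
  then show "(\<lambda>n. (LINT x:Z|\<mu>. \<Phi> n x) / real n) \<longlonglongrightarrow> mean_value X \<Phi> \<mu>"
    by (rule Lim_transform_eventually[OF mean_value_limit(1)[OF \<mu>X \<Phi>]])
qed

end

subsection \<open>Periodic orbits\<close>

lemma funpow_mem: "T ` Q \<subseteq> Q \<Longrightarrow> q \<in> Q \<Longrightarrow> (T ^^ i) q \<in> Q"
  by (induction i) auto

lemma infdist_attained:
  assumes "finite Q" "Q \<noteq> {}"
  obtains q where "q \<in> Q" "infdist y Q = dist y q"
proof -
  have "infdist y Q = Min (dist y ` Q)"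
    using assms by (simp add: infdist_def cInf_eq_Min)
  moreover have "Min (dist y ` Q) \<in> dist y ` Q"
    using assms by (intro Min_in) auto
  ultimately have "infdist y Q \<in> dist y ` Q" by simp
  then obtain q where "infdist y Q = dist y q" "q \<in> Q" by (rule imageE)
  then show thesis by (intro that)
qed

lemma sum_lessThan_split: "(\<Sum>i<j + r. f i) = (\<Sum>i<j. f i) + (\<Sum>i<r. f (j + i))"
  for f :: "nat \<Rightarrow> real"
  by (induction r) (simp_all add: add.assoc)

section \<open>Shadowing and locking near a periodic orbit\<close>

context compact_system
begin

text \<open>While a point and its image both stay within \<delta> of Q, nearest points of Q are
  carried to nearest points. Equality with \<open>infdist\<close>, rather than an estimate, lets
  \<open>shadowing\<close> iterate this step without accumulating errors and without any expansion
  hypothesis on T.\<close>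

definition follow_radius :: "'a set \<Rightarrow> real \<Rightarrow> bool" where
  "follow_radius Q \<delta> \<longleftrightarrow> \<delta> > 0 \<and> (\<forall>y\<in>X. \<forall>q\<in>Q. dist y q = infdist y Q \<longrightarrow> infdist y Q < \<delta> \<longrightarrow>
     infdist (T y) Q < \<delta> \<longrightarrow> dist (T y) (T q) = infdist (T y) Q)"

text \<open>Let d separate T q from the other points of Q. If T y is within d/2 of T q, by
  continuity, and within d/2 of its nearest point q', then q' = T q. Finiteness of Q allows one
  radius for all q.\<close>

lemma follow_radius_exists:
  assumes Q: "finite Q" "Q \<noteq> {}" "Q \<subseteq> X"
  obtains \<delta> where "follow_radius Q \<delta>"
proof -
  define P where "P q \<delta> \<longleftrightarrow> \<delta> > 0 \<and> (\<forall>y\<in>X. dist y q < \<delta> \<longrightarrow> infdist (T y) Q < \<delta> \<longrightarrow>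
      dist (T y) (T q) = infdist (T y) Q)" for q \<delta>
  have "\<forall>q\<in>Q. \<exists>\<delta>. P q \<delta>"
  proof
    fix q assume q: "q \<in> Q"
    obtain d where d: "d > 0" "\<forall>x\<in>Q. x \<noteq> T q \<longrightarrow> d \<le> dist (T q) x"
      using finite_set_avoid[OF Q(1)] by blast
    have "d / 2 > 0" "q \<in> X" using d(1) q Q(3) by auto
    from cont[unfolded continuous_on_iff, rule_format, OF this(2,1)]
    obtain \<delta>1 where \<delta>1: "\<delta>1 > 0" "\<forall>y\<in>X. dist y q < \<delta>1 \<longrightarrow> dist (T y) (T q) < d / 2"
      by blast
    have "dist (T y) (T q) = infdist (T y) Q"
      if y: "y \<in> X" "dist y q < min \<delta>1 (d/2)" "infdist (T y) Q < min \<delta>1 (d/2)" for y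
    proof -
      obtain q' where q': "q' \<in> Q" "infdist (T y) Q = dist (T y) q'"
        using infdist_attained[OF Q(1,2)] .
      have "dist (T q) q' \<le> dist (T y) (T q) + dist (T y) q'"
        by (rule dist_triangle3)
      also have "\<dots> < d"
      proof -
        have "dist (T y) (T q) < d / 2"
          using \<delta>1(2) y(1,2) by simp
        moreover have "dist (T y) q' < d / 2"
          using q'(2) y(3) by simp
        ultimately show ?thesis by simp
      qed
      finally have "q' = T q"
        using bspec[OF d(2) q'(1)] by (meson not_le)
      then show ?thesis using q' by simp
    qed
    then have "P q (min \<delta>1 (d/2))"
      using \<delta>1(1) d(1) unfolding P_def by simp
    then show "\<exists>\<delta>. P q \<delta>" ..
  qed
  from bchoice[OF this] obtain f where f: "\<forall>q\<in>Q. P q (f q)"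
    by (rule exE)
  have "dist (T y) (T q) = infdist (T y) Q"
    if *: "y \<in> X" "q \<in> Q" "dist y q = infdist y Q" "infdist y Q < Min (f ` Q)"
      "infdist (T y) Q < Min (f ` Q)" for y q
  proof -
    have "Min (f ` Q) \<le> f q"
      using Q(1) *(2) by simp
    then have "dist y q < f q" "infdist (T y) Q < f q"
      using *(3-5) by linarith+
    moreover have "P q (f q)"
      using f *(2) by blast
    ultimately show ?thesis
      using *(1) unfolding P_def by blast
  qed
  moreover have "Min (f ` Q) > 0"
    using Q f unfolding P_def by simp
  ultimately show thesis
    by (intro that[of "Min (f ` Q)"]) (simp add: follow_radius_def)
qed

lemma shadowing:
  assumes follow: "follow_radius Q \<delta>"
    and Q: "T ` Q \<subseteq> Q" and x: "x \<in> X" and q: "q \<in> Q" "dist x q = infdist x Q"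
    and near: "\<And>j. j < n \<Longrightarrow> infdist ((T ^^ j) x) Q < \<delta>"
  shows "j < n \<Longrightarrow> dist ((T ^^ j) x) ((T ^^ j) q) = infdist ((T ^^ j) x) Q"
proof (induction j)
  case (Suc j)
  have "dist (T ((T ^^ j) x)) (T ((T ^^ j) q)) = infdist (T ((T ^^ j) x)) Q"
  proof (rule follow[unfolded follow_radius_def, THEN conjunct2, rule_format])
    show "dist ((T ^^ j) x) ((T ^^ j) q) = infdist ((T ^^ j) x) Q"
      by (rule Suc.IH) (use Suc.prems in simp)
    show "infdist ((T ^^ j) x) Q < \<delta>"
      by (rule near) (use Suc.prems in simp)
    show "infdist (T ((T ^^ j) x)) Q < \<delta>"
      using near[OF Suc.prems] by simp
  qed (rule funpow_in[OF x] funpow_mem[OF Q q(1)])+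
  then show ?case by simp
qed (use q in simp)

text \<open>An orbit segment that stays near \<open>Q\<close> shadows a segment of \<open>Q\<close>.  Each time an orbit leaves the
  neighbourhood, the bounded loss is paid for by one visit at distance at least \<open>\<delta>\<close> from \<open>Q\<close>.\<close>

lemma locking_pointwise:
  assumes \<Phi>: "\<Phi> \<in> AA_orb X T" and Q: "finite Q" "Q \<noteq> {}" "T ` Q \<subseteq> Q" "Q \<subseteq> X"
    and follow: "follow_radius Q \<delta>"
    and M: "M = AA_nm X T \<Phi>" and \<alpha>: "\<bar>\<alpha>\<bar> \<le> M" and K: "0 \<le> K"
    and on_Q: "\<And>n q. n \<ge> 1 \<Longrightarrow> q \<in> Q \<Longrightarrow> \<Phi> n q \<le> real n * \<alpha> + K"
    and x: "x \<in> X" and n: "n \<ge> 1"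
  shows "\<Phi> n x \<le> real n * \<alpha> + K + (M + (K + 4 * M) / \<delta>) * (\<Sum>j<n. infdist ((T ^^ j) x) Q)"
proof -
  \<comment> \<open>The bounds say nothing about \<Phi> 0; the value 0 makes empty segments harmless
    when an orbit is cut.\<close>
  define f where "f n x = (if n = 0 then 0 else \<Phi> n x)" for n x
  \<comment> \<open>The summand M is the Lipschitz cost along a shadowing segment. The second
    summand, multiplied by the distance of a far visit, which is at least \<delta>, yields at least
    K + 4 * M.\<close>
  define K' where "K' = M + (K + 4 * M) / \<delta>"
  have \<delta>: "\<delta> > 0"
    using follow by (simp add: follow_radius_def)
  have M0: "0 \<le> M"
    using M AA_nm_nonneg by simp
  have K'M: "M \<le> K'"
    unfolding K'_def using M0 K \<delta> by simp
  have K'\<delta>: "K + 4 * M \<le> K' * s" if "\<delta> \<le> s" for s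
  proof -
    have "K + 4 * M = (K + 4 * M) / \<delta> * \<delta>" using \<delta> by simp
    also have "\<dots> \<le> K' * s"
      unfolding K'_def using M0 K \<delta> that by (intro mult_mono) auto
    finally show ?thesis .
  qed
  note bd = AA_nm_bounds[OF \<Phi>, folded M]
  have defect: "\<bar>f (n + m) x - f n x - f m ((T ^^ n) x)\<bar> \<le> M" if "x \<in> X" for n m x
    using AA_boundD(5)[OF bd, of n m x] that M0 by (cases "n = 0 \<or> m = 0") (auto simp: f_def)
  have near: "f n x \<le> real n * \<alpha> + K + M * (\<Sum>j<n. infdist ((T ^^ j) x) Q)"
    if x: "x \<in> X" and near: "\<And>j. j < n \<Longrightarrow> infdist ((T ^^ j) x) Q < \<delta>" for n x
  proof (cases "n = 0")
    case False
    then have n: "n \<ge> 1" by simp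
    obtain q where q: "q \<in> Q" "infdist x Q = dist x q"
      using infdist_attained[OF Q(1,2)] .
    have "\<bar>\<Phi> n x - \<Phi> n q\<bar> \<le> M * (\<Sum>j<n. dist ((T ^^ j) x) ((T ^^ j) q))"
      using q Q by (intro AA_boundD(6)[OF bd n x]) auto
    also have "(\<Sum>j<n. dist ((T ^^ j) x) ((T ^^ j) q)) = (\<Sum>j<n. infdist ((T ^^ j) x) Q)"
      by (intro sum.cong refl shadowing[OF follow Q(3) x q(1) q(2)[symmetric] near]) simp_all
    finally have "\<Phi> n x \<le> \<Phi> n q + M * (\<Sum>j<n. infdist ((T ^^ j) x) Q)"
      by (simp add: abs_le_iff)
    moreover have "f n x = \<Phi> n x"
      using False by (simp add: f_def)
    ultimately show ?thesis
      using on_Q[OF n q(1)] by linarith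
  qed (use K in \<open>simp add: f_def\<close>)
  have "f n x \<le> real n * \<alpha> + K + K' * (\<Sum>j<n. infdist ((T ^^ j) x) Q)" if "x \<in> X" for n x
    using that
  proof (induction n arbitrary: x rule: less_induct)
    case (less n)
    let ?S = "\<lambda>n x. \<Sum>j<n. infdist ((T ^^ j) x) Q"
    have S0: "0 \<le> ?S n x" for n x
      by (intro sum_nonneg infdist_nonneg)
    show ?case
    proof (cases "\<forall>j<n. infdist ((T ^^ j) x) Q < \<delta>")
      case True
      have "f n x \<le> real n * \<alpha> + K + M * ?S n x"
        using near[OF less.prems] True by blast
      also have "M * ?S n x \<le> K' * ?S n x"
        by (intro mult_right_mono K'M S0)
      finally show ?thesis by simp
    next
      case False
      let ?far = "\<lambda>j. j < n \<and> \<not> infdist ((T ^^ j) x) Q < \<delta>"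
      have ex: "\<exists>j. ?far j" using False by blast
      define j where "j = (LEAST j. ?far j)"
      have "?far j" unfolding j_def by (rule LeastI_ex[OF ex])
      then have j: "j < n" "\<delta> \<le> infdist ((T ^^ j) x) Q" by simp_all
      have before: "infdist ((T ^^ i) x) Q < \<delta>" if "i < j" for i
      proof -
        have "\<not> ?far i" using that unfolding j_def by (rule not_less_Least)
        then show ?thesis using that j(1) by simp
      qed
      define r where "r = n - j - 1"
      have r: "n = j + (1 + r)"
        using j(1) by (simp add: r_def)
      define y where "y = (T ^^ j) x"
      define z where "z = T y"
      have y: "y \<in> X" and z: "z \<in> X"
        using funpow_in[OF less.prems] invariant by (auto simp: y_def z_def)
      \<comment> \<open>The orbit is cut at its first far visit y into segments of lengths j, 1 and
        r. The losses are two defects, \<open>f 1 y\<close> and -\<alpha>, each at most M, and the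
        second K from the remaining segment; the term K' * infdist y Q pays for all of them, so only
        one K is left.\<close>
      have "f n x \<le> f j x + f (1 + r) y + M"
        using defect[OF less.prems, of j "1 + r"] unfolding r y_def abs_le_iff by linarith
      moreover have "f (1 + r) y \<le> f 1 y + f r z + M"
        using defect[OF y, of 1 r] by (simp add: z_def abs_le_iff)
      moreover have "f 1 y \<le> M"
        using AA_boundD(4)[OF bd _ y, of 1] by (simp add: f_def abs_le_iff)
      moreover have "f j x \<le> real j * \<alpha> + K + M * ?S j x"
        using near[OF less.prems before] by simp
      moreover have "M * ?S j x \<le> K' * ?S j x"
        by (intro mult_right_mono K'M S0)
      moreover have "f r z \<le> real r * \<alpha> + K + K' * ?S r z"
        using r by (intro less.IH z) simp
      moreover have "K + 4 * M \<le> K' * infdist y Q"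
        using K'\<delta> j(2) by (simp add: y_def)
      moreover have "K' * ?S n x = K' * ?S j x + K' * infdist y Q + K' * ?S r z"
      proof -
        have "(T ^^ (j + Suc i)) x = (T ^^ i) z" for i
        proof -
          have "(T ^^ (j + Suc i)) x = (T ^^ Suc i) y"
            unfolding add.commute[of j "Suc i"] funpow_add y_def by simp
          then show ?thesis by (simp add: z_def funpow_swap1)
        qed
        then have "?S n x = ?S j x + (infdist y Q + ?S r z)"
          unfolding r sum_lessThan_split[of _ j] sum_lessThan_split[of _ 1] by (simp add: y_def)
        then show ?thesis by (simp add: distrib_left)
      qed
      moreover have "real n * \<alpha> = real j * \<alpha> + \<alpha> + real r * \<alpha>"
        unfolding r by (simp add: algebra_simps)
      moreover have "- \<alpha> \<le> M"
        using \<alpha> by (simp add: abs_le_iff)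
      ultimately show ?thesis
        by linarith
    qed
  qed
  from this[OF x, of n] show ?thesis
    using n by (simp add: f_def K'_def)
qed

text \<open>Splitting \<Phi> (n + 1) at a point y as n + 1 and as 1 + n compares \<Phi> n at y and
  at T y. Each step along the orbit thus costs two defects and two values of \<Phi> 1.\<close>

lemma orbit_oscillation:
  assumes \<Phi>: "\<Phi> \<in> AA_orb X T" and n: "n \<ge> 1" and x: "x \<in> X"
  shows "\<bar>\<Phi> n x - \<Phi> n ((T ^^ k) x)\<bar> \<le> real k * (4 * AA_nm X T \<Phi>)"
proof (induction k)
  case (Suc k)
  let ?M = "AA_nm X T \<Phi>" and ?y = "(T ^^ k) x"
  note bd = AA_nm_bounds[OF \<Phi>]
  have y: "?y \<in> X" "(T ^^ n) ?y \<in> X" using funpow_in x by auto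
  have "\<bar>\<Phi> (n + 1) ?y - \<Phi> n ?y - \<Phi> 1 ((T ^^ n) ?y)\<bar> \<le> ?M"
    by (rule AA_boundD(5)[OF bd n _ y(1)]) simp
  moreover have "\<bar>\<Phi> (1 + n) ?y - \<Phi> 1 ?y - \<Phi> n ((T ^^ 1) ?y)\<bar> \<le> ?M"
    by (rule AA_boundD(5)[OF bd _ n y(1)]) simp
  moreover have "\<bar>\<Phi> 1 ?y\<bar> \<le> ?M" "\<bar>\<Phi> 1 ((T ^^ n) ?y)\<bar> \<le> ?M"
    using AA_boundD(4)[OF bd, of 1] y by auto
  ultimately have "\<bar>\<Phi> n ?y - \<Phi> n (T ?y)\<bar> \<le> 4 * ?M"
    by (simp add: add.commute)
  moreover have "real (Suc k) * (4 * ?M) = real k * (4 * ?M) + 4 * ?M"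
    by (simp add: algebra_simps)
  ultimately show ?case
    using Suc by simp
qed simp

lemma periodic_orbit_facts:
  assumes "periodic_orbit X T Q"
  obtains x p where "x \<in> X" "(T ^^ p) x = x" "Q = (\<lambda>j. (T ^^ j) x) ` {..<p}" "p \<ge> 1"
    "finite Q" "Q \<noteq> {}" "Q \<subseteq> X" "T ` Q \<subseteq> Q"
proof -
  obtain x p where xp: "x \<in> X" "(T ^^ p) x = x" "Q = (\<lambda>j. (T ^^ j) x) ` {..<p}" "p \<ge> 1"
    using assms by (auto simp: periodic_orbit_def)
  have "T ((T ^^ j) x) \<in> Q" if "j < p" for j
  proof (cases "Suc j < p")
    case True
    then show ?thesis using xp(3) by (auto intro!: image_eqI[of _ _ "Suc j"])
  next
    case False
    then have "T ((T ^^ j) x) = (T ^^ p) x"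
      using that by (metis Suc_lessI comp_apply funpow.simps(2))
    then show ?thesis using xp by (auto intro!: image_eqI[of _ _ 0])
  qed
  then have "T ` Q \<subseteq> Q" using xp(3) by auto
  moreover have "finite Q" "Q \<noteq> {}" "Q \<subseteq> X"
    using xp funpow_in by (auto simp: lessThan_empty_iff)
  ultimately show thesis using that xp by blast
qed

lemma integral_infdist_concentrated:
  assumes \<mu>: "\<mu> \<in> invariant_measures X T" and Q: "closed Q" "emeasure \<mu> Q = 1"
  shows "(LINT x:X|\<mu>. infdist x Q) = 0"
proof -
  interpret prob_space \<mu> by (rule inv_prob[OF \<mu>])
  have "AE x in \<mu>. x \<in> Q"
    using Q(2) by (intro AE_prob_1) (simp add: measure_def)
  then have "AE x in \<mu>. indicator X x *\<^sub>R infdist x Q = 0"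
    by eventually_elim simp
  then show ?thesis
    unfolding set_lebesgue_integral_def by (rule integral_eq_zero_AE)
qed

text \<open>On Q the values of \<Phi> n oscillate by a multiple of the norm that does not depend on
  n, and their average is close to n times the mean, so \<open>locking_pointwise\<close> applies
  with K proportional to the norm. Integrating against \<nu> and dividing by n removes K. Since C is
  chosen before \<Phi>, the inequality can later be applied to arbitrary perturbations.\<close>

lemma locking_inequality:
  assumes Q: "periodic_orbit X T Q"
  obtains C where "C \<ge> 0"
    "\<forall>\<Phi> \<mu> \<nu>. \<Phi> \<in> AA_orb X T \<longrightarrow> \<mu> \<in> invariant_measures X T \<longrightarrow> emeasure \<mu> Q = 1 \<longrightarrow>
      \<nu> \<in> invariant_measures X T \<longrightarrow>
      mean_value X \<Phi> \<nu> \<le> mean_value X \<Phi> \<mu> + C * AA_nm X T \<Phi> * (LINT x:X|\<nu>. infdist x Q)"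
proof -
  obtain x0 p where xp: "x0 \<in> X" "(T ^^ p) x0 = x0" "Q = (\<lambda>j. (T ^^ j) x0) ` {..<p}" "p \<ge> 1"
    and Qf: "finite Q" "Q \<noteq> {}" "Q \<subseteq> X" "T ` Q \<subseteq> Q"
    using periodic_orbit_facts[OF Q] .
  obtain \<delta> where follow: "follow_radius Q \<delta>"
    using follow_radius_exists[OF Qf(1-3)] .
  then have \<delta>: "\<delta> > 0"
    by (simp add: follow_radius_def)
  \<comment> \<open>Two points of Q are compared through x0 at a cost of 4 * p * M each, which gives
    8 * p; the 1 is the error between the integral of \<Phi> n and n * \<alpha>. With K = c * M, the
    factor in \<open>locking_pointwise\<close> becomes C * M.\<close>
  define c where "c = 1 + 8 * real p"
  define C where "C = 1 + (c + 4) / \<delta>"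
  have "C \<ge> 0" using \<delta> by (simp add: C_def c_def)
  moreover have "mean_value X \<Phi> \<nu> \<le> mean_value X \<Phi> \<mu> + C * AA_nm X T \<Phi> * (LINT x:X|\<nu>. infdist x Q)"
    if \<Phi>: "\<Phi> \<in> AA_orb X T" and \<mu>: "\<mu> \<in> invariant_measures X T" "emeasure \<mu> Q = 1"
      and \<nu>: "\<nu> \<in> invariant_measures X T" for \<Phi> \<mu> \<nu>
  proof -
    define M where "M = AA_nm X T \<Phi>"
    define \<alpha> where "\<alpha> = mean_value X \<Phi> \<mu>"
    have M0: "0 \<le> M" by (simp add: M_def AA_nm_nonneg)
    have K0: "0 \<le> c * M" using M0 by (simp add: c_def)
    have \<alpha>: "\<bar>\<alpha>\<bar> \<le> M" unfolding \<alpha>_def M_def by (rule mean_value_bound[OF \<mu>(1) \<Phi>])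
    have on_Q: "\<Phi> n q \<le> real n * \<alpha> + c * M" if n: "n \<ge> 1" and q: "q \<in> Q" for n q
    proof -
      interpret prob_space \<mu> by (rule inv_prob[OF \<mu>(1)])
      have osc: "\<bar>\<Phi> n x0 - \<Phi> n q'\<bar> \<le> real p * (4 * M)" if "q' \<in> Q" for q'
      proof -
        obtain k where k: "q' = (T ^^ k) x0" "k < p"
          using \<open>q' \<in> Q\<close> xp(3) by auto
        have "\<bar>\<Phi> n x0 - \<Phi> n q'\<bar> \<le> real k * (4 * M)"
          unfolding k(1) M_def by (rule orbit_oscillation[OF \<Phi> n xp(1)])
        also have "\<dots> \<le> real p * (4 * M)"
          using k(2) M0 by (intro mult_right_mono) auto
        finally show ?thesis .
      qed
      have lower: "\<Phi> n q - 8 * real p * M \<le> \<Phi> n q'" if "q' \<in> Q" for q'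
        using osc[OF that] osc[OF q] by linarith
      have "AE x in \<mu>. x \<in> Q"
        using \<mu>(2) by (intro AE_prob_1) (simp add: measure_def)
      then have AE: "AE x\<in>X in \<mu>. \<Phi> n q - 8 * real p * M \<le> \<Phi> n x"
        by eventually_elim (use lower in blast)
      have "\<Phi> n q - 8 * real p * M \<le> (LINT x:X|\<mu>. \<Phi> n x)"
        using set_integral_mono_AE[OF cont_integrable[OF \<mu>(1) continuous_on_const]
            cont_integrable[OF \<mu>(1) AA_continuous[OF \<Phi> n]] AE]
        by (simp add: integral_const[OF \<mu>(1)])
      moreover have "\<bar>(LINT x:X|\<mu>. \<Phi> n x) - real n * \<alpha>\<bar> \<le> M"
        unfolding \<alpha>_def M_def by (rule mean_value_limit(2)[OF \<mu>(1) \<Phi> n])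
      ultimately show ?thesis
        by (simp add: c_def algebra_simps)
    qed
    let ?g = "\<lambda>x. infdist x Q" and ?I = "LINT x:X|\<nu>. infdist x Q"
    have CM: "M + (c * M + 4 * M) / \<delta> = C * M"
      using \<delta> by (simp add: C_def field_simps)
    have cont_g: "continuous_on X ?g"
      by (intro continuous_on_infdist continuous_on_id)
    have int: "(LINT x:X|\<nu>. \<Phi> n x) / real n \<le> \<alpha> + c * M / real n + C * M * ?I" if n: "n \<ge> 1" for n
    proof -
      have cont_b: "continuous_on X (birkhoff_sum T ?g n)"
      proof -
        have "continuous_on X (\<lambda>x. \<Sum>j<n. ?g ((T ^^ j) x))"
          by (intro continuous_on_sum continuous_on_comp_funpow cont_g)
        then show ?thesis by (simp add: birkhoff_sum_def[abs_def])
      qed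
      have "\<Phi> n x \<le> (real n * \<alpha> + c * M) + C * M * birkhoff_sum T ?g n x" if x: "x \<in> X" for x
        using locking_pointwise[OF \<Phi> Qf(1,2,4,3) follow M_def \<alpha> K0 on_Q x n]
        unfolding CM by (simp add: birkhoff_sum_def)
      then have "(LINT x:X|\<nu>. \<Phi> n x) \<le> (LINT x:X|\<nu>. (real n * \<alpha> + c * M) + C * M * birkhoff_sum T ?g n x)"
        by (intro set_integral_mono cont_integrable[OF \<nu>] AA_continuous[OF \<Phi> n]
            continuous_on_add continuous_on_const continuous_on_mult cont_b)
      also have "\<dots> = (real n * \<alpha> + c * M) + C * M * (real n * ?I)"
        by (subst set_integral_add) (auto simp: integral_const[OF \<nu>] integral_birkhoff_sum[OF \<nu> cont_g]
            intro!: cont_integrable[OF \<nu>] continuous_on_mult continuous_on_const cont_b)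
      finally have "(LINT x:X|\<nu>. \<Phi> n x) / real n \<le> ((real n * \<alpha> + c * M) + C * M * (real n * ?I)) / real n"
        by (rule divide_right_mono) simp
      also have "\<dots> = \<alpha> + c * M / real n + C * M * ?I"
        using n by (simp add: field_simps)
      finally show ?thesis .
    qed
    have "mean_value X \<Phi> \<nu> \<le> \<alpha> + 0 + C * M * ?I"
    proof (rule tendsto_le[OF sequentially_bot])
      show "(\<lambda>n. \<alpha> + c * M / real n + C * M * ?I) \<longlonglongrightarrow> \<alpha> + 0 + C * M * ?I"
        by (intro tendsto_add tendsto_const lim_const_over_n)
      show "(\<lambda>n. (LINT x:X|\<nu>. \<Phi> n x) / real n) \<longlonglongrightarrow> mean_value X \<Phi> \<nu>"
        by (rule mean_value_limit(1)[OF \<nu> \<Phi>])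
      show "\<forall>\<^sub>F n in sequentially. (LINT x:X|\<nu>. \<Phi> n x) / real n \<le> \<alpha> + c * M / real n + C * M * ?I"
        by (rule eventually_mono[OF eventually_ge_at_top[of 1] int])
    qed
    then show ?thesis by (simp add: \<alpha>_def M_def)
  qed
  ultimately show thesis using that by blast
qed

text \<open>Invariance makes point masses nondecreasing along an orbit, and on a cycle this forces
  them to be equal. Hence every point of Q has mass 1 / card Q.\<close>

lemma periodic_measure_unique:
  assumes Q: "periodic_orbit X T Q"
    and \<mu>: "\<mu> \<in> invariant_measures X T" "emeasure \<mu> Q = 1"
    and \<nu>: "\<nu> \<in> invariant_measures X T" "emeasure \<nu> Q = 1"
  shows "\<mu> = \<nu>"
proof -
  obtain x0 p where xp: "x0 \<in> X" "(T ^^ p) x0 = x0" "Q = (\<lambda>j. (T ^^ j) x0) ` {..<p}" "p \<ge> 1"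
    and Qf: "finite Q" "Q \<noteq> {}" "Q \<subseteq> X" "T ` Q \<subseteq> Q"
    using periodic_orbit_facts[OF Q] .
  have weight: "emeasure \<rho> {q} = ennreal (1 / real (card Q))"
    if \<rho>: "\<rho> \<in> invariant_measures X T" "emeasure \<rho> Q = 1" and q: "q \<in> Q" for \<rho> q
  proof -
    interpret prob_space \<rho> by (rule inv_prob[OF \<rho>(1)])
    have step: "emeasure \<rho> {y} \<le> emeasure \<rho> {T y}" if "y \<in> X" for y
    proof -
      have "emeasure \<rho> {y} \<le> emeasure \<rho> (T -` {T y} \<inter> X)"
        using that vimage_borel[of "{T y}"] inv_sets[OF \<rho>(1)] by (intro emeasure_mono) auto
      also have "\<dots> = emeasure \<rho> {T y}"
        by (intro inv_vimage[OF \<rho>(1)]) simp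
      finally show ?thesis .
    qed
    have mono: "emeasure \<rho> {(T ^^ i) x0} \<le> emeasure \<rho> {(T ^^ j) x0}" if "i \<le> j" for i j
      using that
    proof (induction j rule: dec_induct)
      case (step j)
      then show ?case
        using \<open>\<And>y. y \<in> X \<Longrightarrow> emeasure \<rho> {y} \<le> emeasure \<rho> {T y}\<close>[OF funpow_in[OF xp(1), of j]] by simp
    qed simp
    have eq: "emeasure \<rho> {y} = emeasure \<rho> {x0}" if "y \<in> Q" for y
    proof -
      obtain j where "y = (T ^^ j) x0" "j < p" using \<open>y \<in> Q\<close> xp(3) by auto
      then show ?thesis
        using mono[of 0 j] mono[of j p] xp(2) by simp
    qed
    have "1 = (\<Sum>y\<in>Q. emeasure \<rho> {y})"
      using \<rho>(2) emeasure_eq_sum_singleton[of Q \<rho>] Qf(1) inv_sets[OF \<rho>(1)] by simp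
    also have "\<dots> = of_nat (card Q) * emeasure \<rho> {q}"
      using eq eq[OF q] by simp
    also have "\<dots> = ennreal (real (card Q) * prob {q})"
      by (simp add: emeasure_eq_measure ennreal_mult' ennreal_of_nat_eq_real_of_nat)
    finally have "ennreal (real (card Q) * prob {q}) = ennreal 1"
      by simp
    then have "real (card Q) * prob {q} = 1"
      by (subst (asm) ennreal_inj) auto
    moreover have "real (card Q) > 0"
      using Qf(1,2) by (simp add: card_gt_0_iff)
    ultimately have "prob {q} = 1 / real (card Q)"
      by (simp add: field_simps)
    then show ?thesis
      by (simp add: emeasure_eq_measure)
  qed
  have eval: "emeasure \<rho> A = (\<Sum>q\<in>A \<inter> Q. ennreal (1 / real (card Q)))"
    if \<rho>: "\<rho> \<in> invariant_measures X T" "emeasure \<rho> Q = 1" and A: "A \<in> sets borel" for \<rho> A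
  proof -
    interpret prob_space \<rho> by (rule inv_prob[OF \<rho>(1)])
    have Qb: "Q \<in> sets borel" using Qf(1) by (intro borel_closed finite_imp_closed)
    have AE: "AE x in \<rho>. x \<in> Q"
      using \<rho>(2) by (intro AE_prob_1) (simp add: measure_def)
    have "emeasure \<rho> A = emeasure \<rho> (A \<inter> Q)"
      using AE A Qb inv_sets[OF \<rho>(1)] by (intro emeasure_eq_AE) auto
    also have "\<dots> = (\<Sum>q\<in>A \<inter> Q. emeasure \<rho> {q})"
      using Qf(1) inv_sets[OF \<rho>(1)] by (intro emeasure_eq_sum_singleton) auto
    also have "\<dots> = (\<Sum>q\<in>A \<inter> Q. ennreal (1 / real (card Q)))"
      using weight[OF \<rho>] by (intro sum.cong) auto
    finally show ?thesis .
  qed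
  show ?thesis
  proof (rule measure_eqI)
    show "sets \<mu> = sets \<nu>"
      using inv_sets[OF \<mu>(1)] inv_sets[OF \<nu>(1)] by simp
    fix A assume "A \<in> sets \<mu>"
    then have "A \<in> sets borel"
      using inv_sets[OF \<mu>(1)] by simp
    then show "emeasure \<mu> A = emeasure \<nu> A"
      using eval[OF \<mu>] eval[OF \<nu>] by simp
  qed
qed

end

subsection \<open>Maximizing measures\<close>

context compact_system
begin

lemma max_measures_class_iff:
  assumes "\<Phi> \<in> AA_orb X T"
  shows "\<mu> \<in> max_measures X T (E_class X T \<Phi>) \<longleftrightarrow> \<mu> \<in> invariant_measures X T \<and>
    (\<forall>\<nu>\<in>invariant_measures X T. mean_value X \<Phi> \<nu> \<le> mean_value X \<Phi> \<mu>)"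
proof -
  have "E_star X (E_class X T \<Phi>) \<nu> = mean_value X \<Phi> \<nu>" if "\<nu> \<in> invariant_measures X T" for \<nu>
    by (rule E_star_eq[OF that assms])
  then show ?thesis
    by (auto simp: max_measures_def)
qed

text \<open>The distance function is 1-Lipschitz and bounded by a on X, hence the factor a + 1. As a
  does not depend on \<epsilon>, the strength of the penalty can be chosen after it.\<close>

lemma birkhoff_sum_infdist:
  assumes "0 \<le> \<epsilon>"
  shows "birkhoff_sum T (\<lambda>x. \<epsilon> * infdist x A) \<in> AA_orb X T" (is ?AA)
    and "\<exists>a\<ge>0. \<forall>\<epsilon>\<ge>0. AA_nm X T (birkhoff_sum T (\<lambda>x. \<epsilon> * infdist x A)) \<le> \<epsilon> * (a + 1)" (is ?nm)
    and "\<mu> \<in> invariant_measures X T \<Longrightarrow>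
      mean_value X (birkhoff_sum T (\<lambda>x. \<epsilon> * infdist x A)) \<mu> = \<epsilon> * (LINT x:X|\<mu>. infdist x A)" (is "_ \<Longrightarrow> ?mean")
proof -
  have cont_g: "continuous_on X (\<lambda>x. infdist x A)"
    by (intro continuous_on_infdist continuous_on_id)
  have "bounded ((\<lambda>x. infdist x A) ` X)"
    by (intro compact_imp_bounded compact_continuous_image compact cont_g)
  then obtain b where b: "\<forall>x\<in>X. \<bar>infdist x A\<bar> \<le> b"
    by (auto simp: bounded_iff)
  define a where "a = max 0 b"
  have a: "0 \<le> a" "\<And>x. x \<in> X \<Longrightarrow> \<bar>infdist x A\<bar> \<le> a"
    using b by (auto simp: a_def intro: max.coboundedI2)
  have lip: "\<bar>\<epsilon> * infdist x A - \<epsilon> * infdist y A\<bar> \<le> \<epsilon> * dist x y" if "0 \<le> \<epsilon>" for \<epsilon> x y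
    using mult_left_mono[OF infdist_triangle_abs[of x A y] that] that
    by (simp add: right_diff_distrib[symmetric] abs_mult)
  have bound: "\<bar>\<epsilon> * infdist x A\<bar> \<le> \<epsilon> * a" if "0 \<le> \<epsilon>" "x \<in> X" for \<epsilon> x
    using mult_left_mono[OF a(2)[OF that(2)] that(1)] that(1) by (simp add: abs_mult)
  show ?AA
    by (rule birkhoff_sum_AA(1)[OF lip[OF assms] assms bound[OF assms]]) (use a assms in auto)
  have "AA_nm X T (birkhoff_sum T (\<lambda>x. \<epsilon> * infdist x A)) \<le> \<epsilon> * (a + 1)" if "0 \<le> \<epsilon>" for \<epsilon>
    using birkhoff_sum_AA(2)[of "\<lambda>x. \<epsilon> * infdist x A" \<epsilon> "\<epsilon> * a", OF lip[OF that] that bound[OF that]]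
      a(1) that by (simp add: distrib_left)
  then show ?nm
    using a(1) by blast
  show ?mean if "\<mu> \<in> invariant_measures X T"
    using mean_value_birkhoff_sum[OF that continuous_on_mult[OF continuous_on_const cont_g]] by simp
qed

lemma integral_infdist_nonneg: "0 \<le> (LINT x:X|\<mu>. infdist x A)"
  unfolding set_lebesgue_integral_def by (intro integral_nonneg_AE AE_I2) (simp add: infdist_nonneg)

lemma E_dist_mean_value:
  assumes "\<Phi> \<in> AA_orb X T" "\<Psi> \<in> AA_orb X T" "\<mu> \<in> invariant_measures X T"
  shows "\<bar>mean_value X \<Phi> \<mu> - mean_value X \<Psi> \<mu>\<bar> \<le> AA_nm X T (\<Phi> - \<Psi>)"
  using mean_value_bound[OF assms(3) AA_diff[OF assms(1,2)]] mean_value_diff[OF assms(3,1,2)] by simp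

text \<open>Subtracting the penalty G costs the orbit measure nothing and every other \<nu> exactly
  \<epsilon> times its mean distance from Q. A further perturbation \<Theta> regains at most C *
  AA_nm X T \<Theta> times that distance, so \<epsilon> - C * AA_nm X T \<Theta> > 0 keeps the orbit
  measure strictly ahead.\<close>

lemma periodically_maximized_perturbation:
  assumes Q: "periodic_orbit X T Q" and \<Phi>: "\<Phi> \<in> AA_orb X T"
    and max: "orbit_measure Q \<in> max_measures X T (E_class X T \<Phi>)" and e: "e > 0"
  obtains \<Psi> where "\<Psi> \<in> AA_orb X T" "AA_nm X T (\<Phi> - \<Psi>) < e"
    "E_class X T \<Psi> \<in> E.mtopology interior_of {\<eta> \<in> E_orb X T. periodically_maximized X T \<eta>}"
proof -
  let ?m = "orbit_measure Q" and ?I = "\<lambda>\<nu>. LINT x:X|\<nu>. infdist x Q"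
  have Qf: "finite Q" "Q \<noteq> {}" "Q \<subseteq> X"
    by (rule periodic_orbit_facts[OF Q], assumption)+
  have closed_Q: "closed Q"
    by (rule finite_imp_closed[OF Qf(1)])
  \<comment> \<open>Invariance of the orbit measure is obtained from its being maximizing, not by
    computation.\<close>
  have m: "?m \<in> invariant_measures X T"
    and m_max: "\<And>\<nu>. \<nu> \<in> invariant_measures X T \<Longrightarrow> mean_value X \<Phi> \<nu> \<le> mean_value X \<Phi> ?m"
    using max unfolding max_measures_class_iff[OF \<Phi>] by blast+
  have mQ: "emeasure ?m Q = 1"
  proof -
    have "emeasure ?m Q = emeasure (uniform_count_measure Q) ((\<lambda>x. x) -` Q \<inter> space (uniform_count_measure Q))"
      unfolding orbit_measure_def using closed_Q
      by (intro emeasure_distr) (auto simp: measurable_def space_uniform_count_measure sets_uniform_count_measure)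
    also have "\<dots> = 1"
      using prob_space.emeasure_space_1[OF prob_space_uniform_count_measure[OF Qf(1,2)]]
      by (simp add: space_uniform_count_measure)
    finally show ?thesis .
  qed
  have I_m: "?I ?m = 0"
    by (rule integral_infdist_concentrated[OF m closed_Q mQ])
  obtain C where C: "C \<ge> 0" "\<forall>\<Phi> \<mu> \<nu>. \<Phi> \<in> AA_orb X T \<longrightarrow> \<mu> \<in> invariant_measures X T \<longrightarrow>
      emeasure \<mu> Q = 1 \<longrightarrow> \<nu> \<in> invariant_measures X T \<longrightarrow>
      mean_value X \<Phi> \<nu> \<le> mean_value X \<Phi> \<mu> + C * AA_nm X T \<Phi> * ?I \<nu>"
    using locking_inequality[OF Q] .
  from birkhoff_sum_infdist(2)[OF order_refl, of Q] obtain a where a: "a \<ge> 0"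
    "\<forall>\<epsilon>\<ge>0. AA_nm X T (birkhoff_sum T (\<lambda>x. \<epsilon> * infdist x Q)) \<le> \<epsilon> * (a + 1)"
    by blast
  \<comment> \<open>This choice makes the norm of the penalty at most e / 2.\<close>
  define \<epsilon> where "\<epsilon> = e / 2 / (a + 1)"
  have \<epsilon>: "\<epsilon> > 0" using e a(1) by (simp add: \<epsilon>_def)
  define G where "G = birkhoff_sum T (\<lambda>x. \<epsilon> * infdist x Q)"
  have G: "G \<in> AA_orb X T" and G_mean: "\<And>\<nu>. \<nu> \<in> invariant_measures X T \<Longrightarrow> mean_value X G \<nu> = \<epsilon> * ?I \<nu>"
    unfolding G_def
    by (rule birkhoff_sum_infdist(1)[OF less_imp_le[OF \<epsilon>]],
        rule birkhoff_sum_infdist(3)[OF less_imp_le[OF \<epsilon>]])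
  have "AA_nm X T G \<le> \<epsilon> * (a + 1)"
    unfolding G_def by (rule a(2)[rule_format, OF less_imp_le[OF \<epsilon>]])
  also have "\<dots> = e / 2"
  proof -
    have "a + 1 \<noteq> 0" using a(1) by simp
    from nonzero_divide_eq_eq[OF this, THEN iffD1, OF \<epsilon>_def[symmetric]] show ?thesis
      by (rule sym)
  qed
  also have "\<dots> < e"
    using e by simp
  finally have G_nm: "AA_nm X T G < e" .
  define \<Psi> where "\<Psi> = \<Phi> - G"
  have \<Psi>: "\<Psi> \<in> AA_orb X T"
    unfolding \<Psi>_def by (rule AA_diff[OF \<Phi> G])
  \<comment> \<open>C * r < \<epsilon>, also when C = 0.\<close>
  define r where "r = \<epsilon> / (C + 1)"
  have r: "r > 0" using \<epsilon> C(1) by (simp add: r_def)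
  have unique: "max_measures X T (E_class X T \<Psi>') = {?m}"
    if \<Psi>': "\<Psi>' \<in> AA_orb X T" "AA_nm X T (\<Psi> - \<Psi>') < r" for \<Psi>'
  proof -
    define \<Theta> where "\<Theta> = \<Psi>' - \<Psi>"
    have \<Theta>: "\<Theta> \<in> AA_orb X T"
      unfolding \<Theta>_def by (rule AA_diff[OF \<Psi>'(1) \<Psi>])
    have "AA_nm X T \<Theta> < r"
      using \<Psi>'(2) E.p_uminus[OF AA_diff[OF \<Psi> \<Psi>'(1)]] by (simp add: \<Theta>_def)
    then have "C * AA_nm X T \<Theta> \<le> C * r"
      using C(1) by (intro mult_left_mono) auto
    also have "\<dots> < \<epsilon>"
      using C(1) \<epsilon> by (simp add: r_def field_simps)
    finally have gap: "\<epsilon> - C * AA_nm X T \<Theta> > 0" by simp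
    have split: "mean_value X \<Psi>' \<nu> = mean_value X \<Phi> \<nu> - \<epsilon> * ?I \<nu> + mean_value X \<Theta> \<nu>"
      if \<nu>: "\<nu> \<in> invariant_measures X T" for \<nu>
      using mean_value_diff[OF \<nu> \<Psi>'(1) \<Psi>] mean_value_diff[OF \<nu> \<Phi> G] G_mean[OF \<nu>]
      by (simp add: \<Theta>_def \<Psi>_def)
    \<comment> \<open>The deficit of \<nu> is proportional to its mean distance from Q: equality of
      mean values forces \<nu> onto Q, where \<open>periodic_measure_unique\<close> identifies
      it.\<close>
    have key: "mean_value X \<Psi>' \<nu> \<le> mean_value X \<Psi>' ?m - (\<epsilon> - C * AA_nm X T \<Theta>) * ?I \<nu>"
      if \<nu>: "\<nu> \<in> invariant_measures X T" for \<nu>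
    proof -
      have "mean_value X \<Theta> \<nu> \<le> mean_value X \<Theta> ?m + C * AA_nm X T \<Theta> * ?I \<nu>"
        by (rule C(2)[rule_format, OF \<Theta> m mQ \<nu>])
      then show ?thesis
        using split[OF \<nu>] split[OF m] I_m m_max[OF \<nu>] by (simp add: left_diff_distrib)
    qed
    show ?thesis
    proof (intro equalityI subsetI)
      fix \<nu> assume "\<nu> \<in> max_measures X T (E_class X T \<Psi>')"
      then have \<nu>: "\<nu> \<in> invariant_measures X T" "mean_value X \<Psi>' ?m \<le> mean_value X \<Psi>' \<nu>"
        using m unfolding max_measures_class_iff[OF \<Psi>'(1)] by blast+
      then have "(\<epsilon> - C * AA_nm X T \<Theta>) * ?I \<nu> \<le> 0"
        using key[OF \<nu>(1)] by linarith
      then have "?I \<nu> = 0"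
        using gap integral_infdist_nonneg[of \<nu> Q] by (simp add: mult_le_0_iff)
      then have "emeasure \<nu> Q = 1"
        by (rule integral_infdist_eq_0[OF \<nu>(1) closed_Q Qf(2)])
      then show "\<nu> \<in> {?m}"
        using periodic_measure_unique[OF Q \<nu>(1) _ m mQ] by simp
    next
      fix \<nu> assume "\<nu> \<in> {?m}"
      moreover have "mean_value X \<Psi>' \<rho> \<le> mean_value X \<Psi>' ?m" if \<rho>: "\<rho> \<in> invariant_measures X T" for \<rho>
      proof -
        have "0 \<le> (\<epsilon> - C * AA_nm X T \<Theta>) * ?I \<rho>"
          using gap integral_infdist_nonneg[of \<rho> Q] by (intro mult_nonneg_nonneg) auto
        then show ?thesis using key[OF \<rho>] by linarith
      qed
      ultimately show "\<nu> \<in> max_measures X T (E_class X T \<Psi>')"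
        unfolding max_measures_class_iff[OF \<Psi>'(1)] using m by blast
    qed
  qed
  have "E.mball (E_class X T \<Psi>) r \<subseteq> {\<eta> \<in> E_orb X T. periodically_maximized X T \<eta>}"
  proof
    fix \<eta> assume "\<eta> \<in> E.mball (E_class X T \<Psi>) r"
    then have \<eta>: "\<eta> \<in> E_class X T ` AA_orb X T" "E_dist X T (E_class X T \<Psi>) \<eta> < r"
      by simp_all
    then obtain \<Psi>0 where \<Psi>0: "\<Psi>0 \<in> AA_orb X T" "\<eta> = E_class X T \<Psi>0"
      by blast
    \<comment> \<open>Maximizing measures depend only on the class, so it is enough to treat a
      representative within r of \<Psi>.\<close>
    obtain \<Psi>' where \<Psi>': "\<Psi>' \<in> AA_orb X T" "E_class X T \<Psi>' = E_class X T \<Psi>0"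
        "AA_nm X T (\<Psi> - \<Psi>') < r"
      using E.d_lessE[OF \<Psi> \<Psi>0(1) \<eta>(2)[unfolded \<Psi>0(2)]] .
    have "max_measures X T \<eta> = {?m}"
      using unique[OF \<Psi>'(1,3)] \<Psi>'(2) \<Psi>0(2) by simp
    then show "\<eta> \<in> {\<eta> \<in> E_orb X T. periodically_maximized X T \<eta>}"
      using Q \<eta>(1) unfolding periodically_maximized_def E_orb_eq by blast
  qed
  then have "E_class X T \<Psi> \<in> E.mtopology interior_of {\<eta> \<in> E_orb X T. periodically_maximized X T \<eta>}"
    unfolding E.in_interior_of_mball using \<Psi> r by blast
  moreover have "AA_nm X T (\<Phi> - \<Psi>) < e"
    using G_nm by (simp add: \<Psi>_def)
  ultimately show thesis
    using that \<Psi> by blast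
qed

end

section \<open>Closedness of the maximized sets and lifting of periodic maximization\<close>

context compact_subsystem
begin

text \<open>The hypothesis \<open>ex\<close> ranges over all classes because it is applied to the
  penalized class of \<Phi> - G and not to the limit \<eta> itself.\<close>

lemma closedin_E_maximized_on:
  assumes ne: "Z \<noteq> {}" and ex: "\<And>\<eta>. \<eta> \<in> E_orb X T \<Longrightarrow> max_measures X T \<eta> \<noteq> {}"
  shows "closedin E.mtopology (E_maximized_on X T Z)"
proof -
  let ?I = "\<lambda>\<nu>. LINT x:X|\<nu>. infdist x Z"
  have closed_Z: "closed Z"
    using Z by (simp add: closed_invariant_def)
  have "\<eta> \<in> E_maximized_on X T Z"
    if \<eta>: "\<eta> \<in> E_orb X T" and approx: "\<And>r. r > 0 \<Longrightarrow> \<exists>\<theta>\<in>E_maximized_on X T Z. \<theta> \<in> E.mball \<eta> r" for \<eta>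
  proof -
    obtain \<Phi> where \<Phi>: "\<Phi> \<in> AA_orb X T" "\<eta> = E_class X T \<Phi>"
      using \<eta> by (auto simp: E_orb_eq)
    \<comment> \<open>Replacing \<Phi> by a nearby \<Psi> costs e at \<mu> and again e at \<nu>,
      hence 2 * e.\<close>
    have near_max: "\<exists>\<nu>\<in>invariant_measures Z T. \<forall>\<mu>\<in>invariant_measures X T.
        mean_value X \<Phi> \<mu> \<le> mean_value X \<Phi> \<nu> + 2 * e" if e: "e > 0" for e
    proof -
      obtain \<theta> where \<theta>: "\<theta> \<in> E_maximized_on X T Z" "\<theta> \<in> E.mball \<eta> e"
        using approx[OF e] by blast
      then obtain \<Psi>0 where \<Psi>0: "\<Psi>0 \<in> AA_orb X T" "\<theta> = E_class X T \<Psi>0"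
          "E_dist X T (E_class X T \<Phi>) (E_class X T \<Psi>0) < e"
        using \<Phi>(2) by auto
      obtain \<Psi> where \<Psi>: "\<Psi> \<in> AA_orb X T" "E_class X T \<Psi> = E_class X T \<Psi>0" "AA_nm X T (\<Phi> - \<Psi>) < e"
        using E.d_lessE[OF \<Phi>(1) \<Psi>0(1,3)] .
      obtain \<nu> where \<nu>: "\<nu> \<in> max_measures X T (E_class X T \<Psi>)" "\<nu> \<in> invariant_measures Z T"
        using \<theta>(1) \<Psi>(2) \<Psi>0(2) by (auto simp: E_maximized_on_def)
      have "mean_value X \<Phi> \<mu> \<le> mean_value X \<Phi> \<nu> + 2 * e" if \<mu>: "\<mu> \<in> invariant_measures X T" for \<mu>
      proof -
        have \<nu>X: "\<nu> \<in> invariant_measures X T" "mean_value X \<Psi> \<mu> \<le> mean_value X \<Psi> \<nu>"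
          using \<nu>(1) \<mu> max_measures_class_iff[OF \<Psi>(1)] by auto
        show ?thesis
          using E_dist_mean_value[OF \<Phi>(1) \<Psi>(1) \<mu>] E_dist_mean_value[OF \<Phi>(1) \<Psi>(1) \<nu>X(1)] \<nu>X(2) \<Psi>(3)
          by linarith
      qed
      then show ?thesis using \<nu>(2) by blast
    qed
    define G where "G = birkhoff_sum T (\<lambda>x. 1 * infdist x Z)"
    have G: "G \<in> AA_orb X T" and G_mean: "\<And>\<nu>. \<nu> \<in> invariant_measures X T \<Longrightarrow> mean_value X G \<nu> = ?I \<nu>"
      unfolding G_def using birkhoff_sum_infdist(1)[of 1 Z] birkhoff_sum_infdist(3)[of 1 _ Z] by simp_all
    have D: "\<Phi> - G \<in> AA_orb X T"
      by (rule AA_diff[OF \<Phi>(1) G])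
    then have "E_class X T (\<Phi> - G) \<in> E_orb X T"
      by (simp add: E_orb_eq)
    from ex[OF this] obtain \<mu> where \<mu>: "\<mu> \<in> max_measures X T (E_class X T (\<Phi> - G))"
      by blast
    then have \<mu>X: "\<mu> \<in> invariant_measures X T"
      using max_measures_class_iff[OF D] by simp
    \<comment> \<open>A nearly optimal \<nu> on Z pays no penalty and loses to \<mu> in the
      penalized problem. Taking \<rho> = \<mu> bounds the penalty of \<mu> by 2 * e, which places
      \<mu> on Z; arbitrary \<rho> then gives its maximality.\<close>
    have step: "mean_value X \<Phi> \<rho> \<le> mean_value X \<Phi> \<mu> - ?I \<mu> + 2 * e"
      if e: "e > 0" and \<rho>: "\<rho> \<in> invariant_measures X T" for e \<rho>
    proof -
      obtain \<nu> where \<nu>: "\<nu> \<in> invariant_measures Z T" "mean_value X \<Phi> \<rho> \<le> mean_value X \<Phi> \<nu> + 2 * e"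
        using near_max[OF e] \<rho> by blast
      note \<nu>X = invariant_measures_extend[OF \<nu>(1)]
      have "?I \<nu> = 0"
        using \<nu>(1) by (intro integral_infdist_concentrated[OF \<nu>X closed_Z]) (simp add: invariant_measures_def)
      moreover have "mean_value X (\<Phi> - G) \<nu> \<le> mean_value X (\<Phi> - G) \<mu>"
        using \<mu> \<nu>X max_measures_class_iff[OF D] by simp
      ultimately show ?thesis
        using mean_value_diff[OF \<nu>X \<Phi>(1) G] mean_value_diff[OF \<mu>X \<Phi>(1) G] G_mean[OF \<nu>X] G_mean[OF \<mu>X] \<nu>(2)
        by linarith
    qed
    have "?I \<mu> \<le> 0"
    proof (rule field_le_epsilon)
      fix e :: real assume "e > 0"
      then show "?I \<mu> \<le> 0 + e"
        using step[OF _ \<mu>X, of "e / 2"] by simp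
    qed
    then have I0: "?I \<mu> = 0"
      using integral_infdist_nonneg[of \<mu> Z] by simp
    have "\<mu> \<in> invariant_measures Z T"
      by (intro invariant_measures_restrict \<mu>X integral_infdist_eq_0[OF \<mu>X closed_Z ne I0])
    moreover have "mean_value X \<Phi> \<rho> \<le> mean_value X \<Phi> \<mu>" if \<rho>: "\<rho> \<in> invariant_measures X T" for \<rho>
    proof (rule field_le_epsilon)
      fix e :: real assume "e > 0"
      then show "mean_value X \<Phi> \<rho> \<le> mean_value X \<Phi> \<mu> + e"
        using step[OF _ \<rho>, of "e / 2"] I0 by simp
    qed
    then have "\<mu> \<in> max_measures X T \<eta>"
      using max_measures_class_iff[OF \<Phi>(1)] \<mu>X \<Phi>(2) by simp
    ultimately show ?thesis
      using \<eta> by (auto simp: E_maximized_on_def)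
  qed
  then have "E.mtopology closure_of (E_maximized_on X T Z) \<subseteq> E_maximized_on X T Z"
    unfolding E.metric_closure_of unfolding E_orb_eq[symmetric] by blast
  moreover have "E_maximized_on X T Z \<subseteq> topspace E.mtopology"
    by (auto simp: E_maximized_on_def E_orb_eq)
  ultimately show ?thesis
    using closure_of_subset_eq by blast
qed

lemma max_measures_restrict:
  assumes \<Phi>: "\<Phi> \<in> AA_orb X T" and \<mu>: "\<mu> \<in> max_measures X T (E_class X T \<Phi>)" "\<mu> \<in> invariant_measures Z T"
  shows "\<mu> \<in> max_measures Z T (E_class Z T \<Phi>)"
  unfolding Z.max_measures_class_iff[OF AA_restrict[OF \<Phi>]]
proof (intro conjI ballI \<mu>(2))
  fix \<nu> assume \<nu>: "\<nu> \<in> invariant_measures Z T"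
  have "mean_value X \<Phi> \<nu> \<le> mean_value X \<Phi> \<mu>"
    using \<mu>(1) invariant_measures_extend[OF \<nu>] max_measures_class_iff[OF \<Phi>] by simp
  then show "mean_value Z \<Phi> \<nu> \<le> mean_value Z \<Phi> \<mu>"
    by (simp add: mean_value_restrict[OF \<nu> \<Phi>] mean_value_restrict[OF \<mu>(2) \<Phi>])
qed

text \<open>Lifting distance below r provides \<Phi>' within r of \<Phi> on X whose restriction is a
  periodically maximized class. As \<Phi>' is still in the ball, some maximizing measure lives on Z;
  it also maximizes the restriction, so uniqueness there identifies it with an orbit measure, which
  is thus maximizing on all of X.\<close>

lemma extendable_TPO_dense:
  assumes TPO: "extendable_TPO X T Z" and \<Phi>: "\<Phi> \<in> AA_orb X T" and r: "r > 0"
    and ball: "E.mball (E_class X T \<Phi>) r \<subseteq> E_maximized_on X T Z"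
  obtains \<Psi> where "\<Psi> \<in> AA_orb X T" "AA_nm X T (\<Phi> - \<Psi>) < r"
    "E_class X T \<Psi> \<in> E.mtopology interior_of {\<eta> \<in> E_orb X T. periodically_maximized X T \<eta>}"
proof -
  obtain U where U: "lift.mtopology closure_of U = topspace lift.mtopology"
      "\<forall>\<zeta>\<in>U. periodically_maximized Z T \<zeta>"
    using TPO unfolding extendable_TPO_def open_dense_def lift_topology_eq by blast
  have "E_class Z T \<Phi> \<in> lift.mtopology closure_of U"
    using U(1) \<Phi> by simp
  then obtain \<zeta> where \<zeta>: "\<zeta> \<in> U" "\<zeta> \<in> lift.mball (E_class Z T \<Phi>) r"
    using r unfolding lift.metric_closure_of by blast
  then obtain \<Phi>0 where \<Phi>0: "\<Phi>0 \<in> AA_orb X T" "\<zeta> = E_class Z T \<Phi>0"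
      "lift_dist X T Z (E_class Z T \<Phi>) (E_class Z T \<Phi>0) < r"
    by auto
  obtain \<Phi>' where \<Phi>': "\<Phi>' \<in> AA_orb X T" "E_class Z T \<Phi>' = E_class Z T \<Phi>0" "AA_nm X T (\<Phi> - \<Phi>') < r"
    using lift.d_lessE[OF \<Phi> \<Phi>0(1,3)] .
  have "E_dist X T (E_class X T \<Phi>) (E_class X T \<Phi>') < r"
    using E.d_le[OF \<Phi> \<Phi>'(1)] \<Phi>'(3) by simp
  then have "E_class X T \<Phi>' \<in> E_maximized_on X T Z"
    using ball \<Phi> \<Phi>'(1) by auto
  then obtain \<mu> where \<mu>: "\<mu> \<in> max_measures X T (E_class X T \<Phi>')" "\<mu> \<in> invariant_measures Z T"
    by (auto simp: E_maximized_on_def)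
  have "periodically_maximized Z T (E_class Z T \<Phi>')"
    using U(2) \<zeta>(1) \<Phi>0(2) \<Phi>'(2) by simp
  then obtain Q where Q: "periodic_orbit Z T Q" "max_measures Z T (E_class Z T \<Phi>') = {orbit_measure Q}"
    by (auto simp: periodically_maximized_def)
  have "\<mu> = orbit_measure Q"
    using max_measures_restrict[OF \<Phi>'(1) \<mu>] Q(2) by simp
  then have max: "orbit_measure Q \<in> max_measures X T (E_class X T \<Phi>')"
    using \<mu>(1) by simp
  have QX: "periodic_orbit X T Q"
    using Q(1) Z_subset unfolding periodic_orbit_def by blast
  \<comment> \<open>The room left by the first perturbation is spent on the second, which makes the
    maximization stable.\<close>
  have "r - AA_nm X T (\<Phi> - \<Phi>') > 0"
    using \<Phi>'(3) by simp
  from periodically_maximized_perturbation[OF QX \<Phi>'(1) max this]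
  obtain \<Psi> where \<Psi>: "\<Psi> \<in> AA_orb X T" "AA_nm X T (\<Phi>' - \<Psi>) < r - AA_nm X T (\<Phi> - \<Phi>')"
    "E_class X T \<Psi> \<in> E.mtopology interior_of {\<eta> \<in> E_orb X T. periodically_maximized X T \<eta>}" .
  have "AA_nm X T (\<Phi> - \<Psi>) < r"
    using E.p_add[OF AA_diff[OF \<Phi> \<Phi>'(1)] AA_diff[OF \<Phi>'(1) \<Psi>(1)]] \<Psi>(2) by simp
  then show thesis
    using that \<Psi>(1,3) by blast
qed

end

theorem mainTheorem2:
  fixes X :: "'a::metric_space set" and T :: "'a \<Rightarrow> 'a" and Z :: "nat \<Rightarrow> 'a set"
  defines "P \<equiv> E_topology X T interior_of {\<eta> \<in> E_orb X T. periodically_maximized X T \<eta>}"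
    and "W \<equiv> E_topology X T interior_of E_maximized_on X T (Z 0)"
  assumes "X \<noteq> {}" and "compact X" and "continuous_on X T" and "T ` X \<subseteq> X"
    and "\<And>i. Z i \<noteq> {}" and "\<And>i. closed_invariant X T (Z i)"
    and "maximizable X T ({Z 0} \<union> {Z i |i. i \<ge> 1})"
    and "\<And>i. i \<ge> 1 \<Longrightarrow> extendable_TPO X T (Z i)"
  shows "open_dense (E_topology X T) (P \<union> W) \<and> (W = {} \<longrightarrow> global_TPO X T)"
proof -
  interpret compact_system X T
    by standard (fact assms)+
  have sub: "compact_subsystem X T (Z i)" for i
    by unfold_locales (fact assms)
  have family: "{Z 0} \<union> {Z i |i. i \<ge> 1} = range Z"
  proof (intro equalityI subsetI)
    fix S assume "S \<in> range Z"
    then obtain i where "S = Z i" by auto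
    then show "S \<in> {Z 0} \<union> {Z i |i. i \<ge> 1}"
      by (cases i) auto
  qed auto
  have cover: "E_orb X T = (\<Union>i. E_maximized_on X T (Z i))"
    using assms(9) unfolding maximizable_def family by simp
  have ex: "max_measures X T \<eta> \<noteq> {}" if \<eta>: "\<eta> \<in> E_orb X T" for \<eta>
  proof -
    obtain i where "\<eta> \<in> E_maximized_on X T (Z i)"
      using \<eta>[unfolded cover] by blast
    then show ?thesis by (auto simp: E_maximized_on_def)
  qed
  have closed: "closedin E.mtopology (E_maximized_on X T (Z i))" for i
    by (rule compact_subsystem.closedin_E_maximized_on[OF sub assms(7) ex])
  have dense: "E.mtopology closure_of (\<Union>i. E.mtopology interior_of E_maximized_on X T (Z i)) = E_orb X T"
    by (rule interiors_dense[OF closed eq_refl[OF cover]])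
  have PW: "P = E.mtopology interior_of {\<eta> \<in> E_orb X T. periodically_maximized X T \<eta>}"
    "W = E.mtopology interior_of E_maximized_on X T (Z 0)"
    by (simp_all add: P_def W_def E_topology_eq)
  have "\<exists>\<theta>\<in>P \<union> W. \<theta> \<in> E.mball \<eta> r" if \<eta>: "\<eta> \<in> E_orb X T" and r: "r > 0" for \<eta> r
  proof -
    \<comment> \<open>Half of r is kept for moving on from \<theta> to a class in P.\<close>
    have "\<exists>\<theta>\<in>(\<Union>i. E.mtopology interior_of E_maximized_on X T (Z i)). \<theta> \<in> E.mball \<eta> (r / 2)"
      using dense \<eta> half_gt_zero[OF r] unfolding E.metric_closure_of by blast
    then obtain i \<theta> where \<theta>: "\<theta> \<in> E.mtopology interior_of E_maximized_on X T (Z i)" "\<theta> \<in> E.mball \<eta> (r / 2)"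
      by blast
    show ?thesis
    proof (cases "i = 0")
      case True
      then have "\<theta> \<in> W" using \<theta>(1) PW by simp
      moreover have "\<theta> \<in> E.mball \<eta> r"
        using \<theta>(2) r by simp
      ultimately show ?thesis by blast
    next
      case False
      interpret sub: compact_subsystem X T "Z i" by (rule sub)
      have TPO: "extendable_TPO X T (Z i)"
        using False by (intro assms(10)) simp
      obtain s where s: "s > 0" "E.mball \<theta> s \<subseteq> E_maximized_on X T (Z i)"
        using \<theta>(1) unfolding E.in_interior_of_mball by blast
      have \<eta>\<theta>: "\<eta> \<in> E_class X T ` AA_orb X T" "\<theta> \<in> E_class X T ` AA_orb X T" "E_dist X T \<eta> \<theta> < r / 2"
        using \<theta>(2) by simp_all
      then obtain \<Phi> where \<Phi>: "\<Phi> \<in> AA_orb X T" "\<theta> = E_class X T \<Phi>"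
        by blast
      \<comment> \<open>t \<le> s keeps the ball inside the set maximized on \<open>Z i\<close>; t
        \<le> r / 2 keeps the class found there within r of \<eta>.\<close>
      define t where "t = min s (r / 2)"
      have t: "t > 0" "t \<le> s" "t \<le> r / 2" using s(1) r by (simp_all add: t_def)
      have "E.mball (E_class X T \<Phi>) t \<subseteq> E_maximized_on X T (Z i)"
        using s(2) E.mball_subset_concentric[OF t(2), of \<theta>] unfolding \<Phi>(2) by (rule order_trans[rotated])
      from sub.extendable_TPO_dense[OF TPO \<Phi>(1) t(1) this]
      obtain \<Psi> where \<Psi>: "\<Psi> \<in> AA_orb X T" "AA_nm X T (\<Phi> - \<Psi>) < t"
          "E_class X T \<Psi> \<in> E.mtopology interior_of {\<eta> \<in> E_orb X T. periodically_maximized X T \<eta>}" .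
      have "E_dist X T \<eta> (E_class X T \<Psi>) \<le> E_dist X T \<eta> \<theta> + E_dist X T \<theta> (E_class X T \<Psi>)"
        by (intro E.triangle \<eta>\<theta>(1,2) imageI \<Psi>(1))
      also have "\<dots> < r"
        using \<eta>\<theta>(3) E.d_le[OF \<Phi>(1) \<Psi>(1)] \<Psi>(2) t(3) unfolding \<Phi>(2) by linarith
      finally have "E_class X T \<Psi> \<in> E.mball \<eta> r"
        using \<eta>\<theta>(1) \<Psi>(1) by simp
      then show ?thesis using \<Psi>(3) unfolding PW by blast
    qed
  qed
  then have "E.mtopology closure_of (P \<union> W) = topspace E.mtopology"
    unfolding E.metric_closure_of E.topspace_mtopology unfolding E_orb_eq[symmetric] by blast
  moreover have "openin E.mtopology (P \<union> W)"
    unfolding PW by (intro openin_Un openin_interior_of)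
  ultimately have main: "open_dense (E_topology X T) (P \<union> W)"
    by (simp add: open_dense_def E_topology_eq)
  moreover have "global_TPO X T" if "W = {}"
  proof -
    have "open_dense (E_topology X T) P"
      using main that by simp
    moreover have "periodically_maximized X T \<eta>" if "\<eta> \<in> P" for \<eta>
      using subsetD[OF interior_of_subset that[unfolded PW]] by simp
    ultimately show ?thesis
      unfolding global_TPO_def by blast
  qed
  ultimately show ?thesis by blast
qed

end
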